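(* In the setting described in the context, assume [Drift], [Control topology], [Stability], [Metric growth], [Cost growth] and [TV-continuity]. Then there exists a mean field game (MFG) solution, i.e. there exists $\eta\in\mathcal G$ with $\eta\in\mathcal A(\eta)$. Equivalently, there exist $\eta\in\mathcal G$, $V_\eta\in\mathcal C(\mathcal X)\cap\mathfrak o(\mathcal V)$ with $V_\eta(0)=0$, $\varrho_\eta\in\mathbb R$ and $v\in\mathfrak U_{\mathrm{SM}}$ such that $$V_\eta(x)+\varrho_\eta=\min_{u\in\mathbb U}\Big\{r(x,u,\eta)+\int_{\mathcal X}V_\eta(y)P(dy|x,u)\Big\}\quad\text{for all }x\in\mathcal X,$$ the control $v$ attains this minimum in the sense that for $\eta$-almost every $x$ $$V_\eta(x)+\varrho_\eta=\int_{\mathbb U}r(x,u,\eta)\,v(du|x)+\int_{\mathbb U}\int_{\mathcal X}V_\eta(y)\,P(dy|x,u)\,v(du|x),$$ and $\eta=\eta_v$, i.e. $\int_{\mathcal X}f\,d\eta=\int_{\mathcal X}\mathbb E^v_y[f(X_1)]\,\eta(dy)$ for all $f\in\mathcal C_b(\mathcal X)$.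
   Context: Setting. $(\mathcal X,d)$ is a $\sigma$-compact Polish space with a distinguished point $0\in\mathcal X$; $\mathbb U$ is a compact metric space (control space). $\mathcal P(S)$ denotes the Borel probability measures on $S$, $\mathcal C(\mathcal X)$ (resp. $\mathcal C_b(\mathcal X)$) the continuous (resp. bounded continuous) real functions. $P(dy|x,u)$ is a controlled stochastic kernel, i.e. a Borel map $\mathcal X\times\mathbb U\to\mathcal P(\mathcal X)$. A (randomized) Markov control is a sequence $v=(v_n)_{n\ge 0}$ of Borel maps $v_n:\mathcal X\to\mathcal P(\mathbb U)$; a map into $\mathbb U$ is identified with the corresponding Dirac-valued map. $\mathfrak U$ is the set of all Markov controls, $\mathfrak U_{\mathrm{SM}}$ the set of stationary ones ($v_n=v$ for all $n$). For $v\in\mathfrak U$, the controlled chain $(X_n)$ moves from $X_i=x$ according to $P(\cdot|x,v_i(x)):=\int_{\mathbb U}P(\cdot|x,u)\,v_i(du|x)$; $\mathbb E^v_x$ is expectation for the chain started at $x$. For a function $f(x,u)$ write $f(x,v(x))=\int_{\mathbb U}f(x,u)\,v(du|x)$. The family $\mathfrak o(g)$. Let $(K_n)$ be compact sets with $K_n=\mathcal X$ if $\mathcal X$ is compact, and otherwise $K_n\subset K_{n+1}^{o}$ (interior), $\bigcup_nK_n=\mathcal X$ (existence of such a family is assumed). For lower semicontinuous (lsc) $g:\mathcal X\to\mathbb R_+$, $\mathfrak o(g)$ is the set of $f:\mathcal X\to\mathbb R$ with $\limsup_{n\to\infty}\sup\{|f(x)|/(1+g(x)):x\in\mathcal X\setminus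 K_n\}=0$ (supremum of the empty set is $0$). Measures. For $p\ge1$, $\mathcal P_p(\mathcal X)=\{\mu\in\mathcal P(\mathcal X):\int d(x,0)^p\mu(dx)<\infty\}$ with the $p$-Wasserstein metric $\mathfrak D_p$. $\|\cdot\|_{TV}$ is total variation norm. The running cost is a continuous function $r:\mathcal X\times\mathbb U\times\mathcal P_p(\mathcal X)\to\mathbb R_+$, where $p$ is the exponent in [Metric growth]. Hypotheses. [Drift]: there are an lsc function $\mathcal V:\mathcal X\to\mathbb R$, $\mathcal V\ge1$, with compact sublevel sets $\{\mathcal V\le\kappa\}$, $\kappa\in\mathbb R$, a compact set $C\subset\mathcal X$ and constants $\beta_1,\beta_2>0$ with $\sup_{u\in\mathbb U}\int\mathcal V(y)P(dy|x,u)-\mathcal V(x)\le-\beta_1\mathcal V(x)\mathbf 1_{C^c}(x)+\beta_2\mathbf 1_C(x)$ for all $x$, and $\inf_{x\in C^c}\mathcal V(x)\ge\max(\sup_{x\in C}\mathcal V(x),2\beta_2/\beta_1)$. [Control topology]: there is a metric $d_M$ on $\mathfrak U_{\mathrm{SM}}$ making it a compact metric space, such that pointwise convergence $v^n(x)\to v(x)$ for all $x\in\mathcal X$ (of stationary Markov controls) implies $d_M(v^n,v)\to0$, and such that for every bounded continuous $f:\mathcal X\times\mathbb U\to\mathbb R$ and $k\in\mathbb N$ the map $(x,v)\in\mathcal X\times\mathfrak U_{\mathrm{SM}}\mapsto(\mathbb E^v_x[f(X_1,v(X_1))],\dots,\mathbb E^v_x[f(X_k,v(X_k))])$ is continuous.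 [Stability]: for every $v\in\mathfrak U_{\mathrm{SM}}$ the chain is aperiodic, Harris recurrent and $\Lambda$-irreducible for some non-negative Borel measure $\Lambda$ with $\Lambda(\mathcal X)>0$; moreover there are a probability measure $\nu$ with $\nu(C)=1$ and $\gamma\in(0,1)$ with $\inf_{u\in\mathbb U}\inf_{x\in C}P(A|x,u)\ge\gamma\,\nu(A)$ for all Borel $A\subset\mathcal X$. [Metric growth]: for some $p\in[1,\infty)$, $d(\cdot,0)^p\in\mathfrak o(\mathcal V)$. [Cost growth]: for every compact $\mathcal K\subset\mathcal P_p(\mathcal X)$, $\sup_{(u,\mu)\in\mathbb U\times\mathcal K}r(\cdot,u,\mu)\in\mathfrak o(\mathcal V)$. [TV-continuity]: if $v_n\to v$ in $(\mathfrak U_{\mathrm{SM}},d_M)$ then $\|\eta_{v_n}-\eta_v\|_{TV}\to0$. Invariant measures. Under [Drift] and [Stability], each $v\in\mathfrak U_{\mathrm{SM}}$ has a unique invariant probability measure $\eta_v$ ($\int f\,d\eta_v=\int\mathbb E^v_y[f(X_1)]\eta_v(dy)$ for bounded Borel $f$). $\mathcal G=\{\eta_v:v\in\mathfrak U_{\mathrm{SM}}\}$. The map $\mathcal A$ and MFG solutions. Under these hypotheses, for each $\mu\in\mathcal P_p(\mathcal X)$ there is a unique pair $(V_\mu,\varrho_\mu)\in(\mathcal C(\mathcal X)\cap\mathfrak o(\mathcal V))\times\mathbb R$ with $V_\mu(0)=0$ and $V_\mu(x)+\varrho_\mu=\min_{u\in\mathbb U}\{r(x,u,\mu)+\int V_\mu(y)P(dy|x,u)\}$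 for all $x$. A control $v\in\mathfrak U_{\mathrm{SM}}$ is a minimizing selector of this equation if $V_\mu(x)+\varrho_\mu=\int_{\mathbb U}r(x,u,\mu)v(du|x)+\int_{\mathbb U}\int_{\mathcal X}V_\mu(y)P(dy|x,u)v(du|x)$ for $\eta_v$-almost every $x$. $\mathcal A(\mu)$ is the set of $\eta_v$ with $v$ such a minimizing selector. An MFG solution is $\eta\in\mathcal G$ with $\eta\in\mathcal A(\eta)$.
   Formalization: The unique solvability of the optimality equation (V_μ, ϱ_μ) for every μ in P_p, which the setting presents as a consequence of the hypotheses, is assumed explicitly; it can fail when the Lyapunov function is only lsc and not locally bounded. *)

theory Defs
  imports "HOL-Probability.Probability"
begin

text \<open>
  The state space is a type \<open>'x :: polish_space\<close>, the control space a type
  \<open>'u :: polish_space\<close> that is assumed to be compact where it matters (every compact metric space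
  is Polish, so the sort is no restriction). Borel probability measures on a type are the elements
  of \<^term>\<open>space (prob_algebra borel)\<close>, and \<^term>\<open>prob_algebra borel\<close> carries the Borel
  \<open>\<sigma>\<close>-algebra of the topology of weak convergence.
\<close>

section \<open>Semicontinuity and the family \<open>\<oo>(g)\<close>\<close>

definition lsc :: "('a::topological_space \<Rightarrow> real) \<Rightarrow> bool" where
  "lsc f \<longleftrightarrow> (\<forall>a. open {x. a < f x})"

definition compact_exhaustion :: "(nat \<Rightarrow> 'x::topological_space set) \<Rightarrow> bool" where
  "compact_exhaustion K \<longleftrightarrow>
     (\<forall>n. compact (K n)) \<and>
     (if compact (UNIV :: 'x set) then \<forall>n. K n = UNIV
      else (\<forall>n. K n \<subseteq> interior (K (Suc n))) \<and> (\<Union>n. K n) = UNIV)"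

text \<open>The supremum is taken in \<^typ>\<open>ennreal\<close>, where the supremum of the empty set is 0.\<close>

definition small_o :: "(nat \<Rightarrow> 'x set) \<Rightarrow> ('x \<Rightarrow> real) \<Rightarrow> ('x \<Rightarrow> real) set" where
  "small_o K g = {f. limsup (\<lambda>n. SUP x \<in> - K n. ennreal (\<bar>f x\<bar> / (1 + g x))) = 0}"


section \<open>Spaces of probability measures\<close>

definition weakly_converges ::
    "(nat \<Rightarrow> 'a::topological_space measure) \<Rightarrow> 'a measure \<Rightarrow> bool" where
  "weakly_converges \<mu>s \<mu> \<longleftrightarrow>
     (\<forall>f :: 'a \<Rightarrow> real. continuous_on UNIV f \<and> bounded (range f) \<longrightarrow>
        (\<lambda>n. \<integral>y. f y \<partial>\<mu>s n) \<longlonglongrightarrow> (\<integral>y. f y \<partial>\<mu>))"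

definition P_p :: "real \<Rightarrow> 'x \<Rightarrow> 'x::polish_space measure set" where
  "P_p p x0 = {\<mu> \<in> space (prob_algebra borel). (\<integral>\<^sup>+x. ennreal (dist x x0 powr p) \<partial>\<mu>) < \<infinity>}"

definition couplings :: "'x::polish_space measure \<Rightarrow> 'x measure \<Rightarrow> ('x \<times> 'x) measure set" where
  "couplings \<mu> \<nu> =
     {\<pi> \<in> space (prob_algebra (borel \<Otimes>\<^sub>M borel)). distr \<pi> borel fst = \<mu> \<and> distr \<pi> borel snd = \<nu>}"

definition wasserstein :: "real \<Rightarrow> 'x::polish_space measure \<Rightarrow> 'x measure \<Rightarrow> real" where
  "wasserstein p \<mu> \<nu> =
     enn2real (INF \<pi> \<in> couplings \<mu> \<nu>. \<integral>\<^sup>+z. ennreal (dist (fst z) (snd z) powr p) \<partial>\<pi>) powr (1 / p)"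

abbreviation wasserstein_topology :: "real \<Rightarrow> 'x \<Rightarrow> 'x::polish_space measure topology" where
  "wasserstein_topology p x0 \<equiv> Metric_space.mtopology (P_p p x0) (wasserstein p)"

text \<open>The total variation norm of \<open>\<mu> - \<nu>\<close>, for probability measures \<open>\<mu>\<close> and \<open>\<nu>\<close>.\<close>

definition tv_dist :: "'x::topological_space measure \<Rightarrow> 'x measure \<Rightarrow> real" where
  "tv_dist \<mu> \<nu> =
     (SUP f \<in> {f \<in> borel_measurable borel. \<forall>x. \<bar>f x\<bar> \<le> 1}. \<bar>(\<integral>x. f x \<partial>\<mu>) - (\<integral>x. f x \<partial>\<nu>)\<bar>)"


section \<open>Controlled chains\<close>

definition stochastic_kernel :: "('x::polish_space \<Rightarrow> 'u::polish_space \<Rightarrow> 'x measure) \<Rightarrow> bool" where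
  "stochastic_kernel P \<longleftrightarrow> (\<lambda>(x, u). P x u) \<in> borel \<rightarrow>\<^sub>M prob_algebra borel"

text \<open>The stationary Markov controls, identified with the map \<open>v\<close> they repeat at each time.\<close>

definition stationary_controls :: "('x::polish_space \<Rightarrow> 'u::polish_space measure) set" where
  "stationary_controls = borel \<rightarrow>\<^sub>M prob_algebra borel"

text \<open>The law of the path \<open>(X\<^sub>0, X\<^sub>1, \<dots>)\<close> with \<open>X\<^sub>0 = x\<close> under a Markov control \<open>(v n)\<close>.
  The step from \<open>X\<^sub>n\<close> has law \<open>\<integral>P(\<cdot>|X\<^sub>n, u) v\<^sub>n(du|X\<^sub>n)\<close>, which is the monadic bind.\<close>

definition chain_law ::
    "('x::polish_space \<Rightarrow> 'u::polish_space \<Rightarrow> 'x measure) \<Rightarrow> (nat \<Rightarrow> 'x \<Rightarrow> 'u measure) \<Rightarrow>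
     'x \<Rightarrow> (nat \<Rightarrow> 'x) measure" where
  "chain_law P v x =
     projective_family.lim UNIV
       (Ionescu_Tulcea.CI
          (\<lambda>i \<omega>. case i of 0 \<Rightarrow> return borel x | Suc n \<Rightarrow> v n (\<omega> n) \<bind> P (\<omega> n))
          (\<lambda>_. borel))
       (\<lambda>_. borel)"

abbreviation stationary_law ::
    "('x::polish_space \<Rightarrow> 'u::polish_space \<Rightarrow> 'x measure) \<Rightarrow> ('x \<Rightarrow> 'u measure) \<Rightarrow>
     'x \<Rightarrow> (nat \<Rightarrow> 'x) measure" where
  "stationary_law P v \<equiv> chain_law P (\<lambda>_. v)"

definition invariant_measure ::
    "('x::polish_space \<Rightarrow> 'u::polish_space \<Rightarrow> 'x measure) \<Rightarrow> ('x \<Rightarrow> 'u measure) \<Rightarrow>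
     'x measure \<Rightarrow> bool" where
  "invariant_measure P v \<eta> \<longleftrightarrow>
     \<eta> \<in> space (prob_algebra borel) \<and>
     (\<forall>f :: 'x \<Rightarrow> real. f \<in> borel_measurable borel \<and> bounded (range f) \<longrightarrow>
        (\<integral>x. f x \<partial>\<eta>) = (\<integral>y. (\<integral>\<omega>. f (\<omega> 1) \<partial>stationary_law P v y) \<partial>\<eta>))"

definition \<eta>_inv ::
    "('x::polish_space \<Rightarrow> 'u::polish_space \<Rightarrow> 'x measure) \<Rightarrow> ('x \<Rightarrow> 'u measure) \<Rightarrow> 'x measure" where
  "\<eta>_inv P v = (THE \<eta>. invariant_measure P v \<eta>)"

definition invariant_measures ::
    "('x::polish_space \<Rightarrow> 'u::polish_space \<Rightarrow> 'x measure) \<Rightarrow> 'x measure set" where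
  "invariant_measures P = \<eta>_inv P ` stationary_controls"


section \<open>Irreducibility, periodicity and Harris recurrence\<close>

text \<open>
  The notions of Meyn and Tweedie for a time-homogeneous chain, given by its family \<open>Pr\<close> of path
  laws: \<open>Pr x\<close> is the law of the chain started at \<open>x\<close>.
\<close>

definition irreducibility_measure ::
    "('x::polish_space \<Rightarrow> (nat \<Rightarrow> 'x) measure) \<Rightarrow> 'x measure \<Rightarrow> bool" where
  "irreducibility_measure Pr \<Lambda> \<longleftrightarrow>
     sets \<Lambda> = sets borel \<and> emeasure \<Lambda> UNIV > 0 \<and>
     (\<forall>A \<in> sets borel. emeasure \<Lambda> A > 0 \<longrightarrow> (\<forall>x. \<P>(\<omega> in Pr x. \<exists>n\<ge>1. \<omega> n \<in> A) > 0))"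

definition maximal_irreducibility_measure ::
    "('x::polish_space \<Rightarrow> (nat \<Rightarrow> 'x) measure) \<Rightarrow> 'x measure \<Rightarrow> bool" where
  "maximal_irreducibility_measure Pr \<psi> \<longleftrightarrow>
     irreducibility_measure Pr \<psi> \<and>
     (\<forall>\<Lambda>. irreducibility_measure Pr \<Lambda> \<longrightarrow> absolutely_continuous \<psi> \<Lambda>)"

definition harris_recurrent :: "('x::polish_space \<Rightarrow> (nat \<Rightarrow> 'x) measure) \<Rightarrow> bool" where
  "harris_recurrent Pr \<longleftrightarrow>
     (\<exists>\<psi>. maximal_irreducibility_measure Pr \<psi> \<and>
        (\<forall>A \<in> sets borel. emeasure \<psi> A > 0 \<longrightarrow>
           (\<forall>x\<in>A. AE \<omega> in Pr x. \<exists>\<^sub>\<infinity>n. \<omega> n \<in> A)))"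

definition d_cycle ::
    "('x::polish_space \<Rightarrow> (nat \<Rightarrow> 'x) measure) \<Rightarrow> 'x measure \<Rightarrow> nat \<Rightarrow> (nat \<Rightarrow> 'x set) \<Rightarrow> bool" where
  "d_cycle Pr \<psi> d D \<longleftrightarrow>
     d \<ge> 1 \<and> (\<forall>i<d. D i \<in> sets borel) \<and> disjoint_family_on D {..<d} \<and>
     (\<forall>i<d. \<forall>x \<in> D i. \<P>(\<omega> in Pr x. \<omega> 1 \<in> D (Suc i mod d)) = 1) \<and>
     emeasure \<psi> (- (\<Union>i<d. D i)) = 0"

definition aperiodic_chain :: "('x::polish_space \<Rightarrow> (nat \<Rightarrow> 'x) measure) \<Rightarrow> bool" where
  "aperiodic_chain Pr \<longleftrightarrow>
     (\<exists>\<psi>. maximal_irreducibility_measure Pr \<psi> \<and> (\<forall>d D. d_cycle Pr \<psi> d D \<longrightarrow> d = 1))"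


section \<open>Hypotheses\<close>

text \<open>
  In the drift inequality the term \<open>-\<V>(x)\<close> has been moved to the right-hand side. Where that side
  is negative, \<^const>\<open>ennreal\<close> truncates it to 0, and the inequality fails, as it should, since
  \<open>\<V> \<ge> 1\<close> makes the left-hand side at least 1. The last inequality is in \<^typ>\<open>ereal\<close>, so that
  suprema and infima over empty sets and of unbounded functions have their usual meaning.
\<close>

definition drift_condition ::
    "('x::polish_space \<Rightarrow> 'u::polish_space \<Rightarrow> 'x measure) \<Rightarrow> ('x \<Rightarrow> real) \<Rightarrow> 'x set \<Rightarrow>
     real \<Rightarrow> real \<Rightarrow> bool" where
  "drift_condition P \<V> C \<beta>1 \<beta>2 \<longleftrightarrow>
     lsc \<V> \<and> (\<forall>x. 1 \<le> \<V> x) \<and> (\<forall>\<kappa>. compact {x. \<V> x \<le> \<kappa>}) \<and>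
     compact C \<and> 0 < \<beta>1 \<and> 0 < \<beta>2 \<and>
     (\<forall>x. (SUP u. \<integral>\<^sup>+y. ennreal (\<V> y) \<partial>P x u) \<le>
        ennreal (\<V> x - \<beta>1 * \<V> x * indicator (- C) x + \<beta>2 * indicator C x)) \<and>
     max (SUP x\<in>C. ereal (\<V> x)) (ereal (2 * \<beta>2 / \<beta>1)) \<le> (INF x \<in> - C. ereal (\<V> x))"

definition control_topology ::
    "('x::polish_space \<Rightarrow> 'u::polish_space \<Rightarrow> 'x measure) \<Rightarrow>
     (('x \<Rightarrow> 'u measure) \<Rightarrow> ('x \<Rightarrow> 'u measure) \<Rightarrow> real) \<Rightarrow> bool" where
  "control_topology P d_M \<longleftrightarrow>
     Metric_space stationary_controls d_M \<and>
     compact_space (Metric_space.mtopology stationary_controls d_M) \<and>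
     (\<forall>vs. \<forall>v \<in> stationary_controls.
        (\<forall>n. vs n \<in> stationary_controls) \<and> (\<forall>x. weakly_converges (\<lambda>n. vs n x) (v x)) \<longrightarrow>
        (\<lambda>n. d_M (vs n) v) \<longlonglongrightarrow> 0) \<and>
     (\<forall>f :: 'x \<times> 'u \<Rightarrow> real. \<forall>k. continuous_on UNIV f \<and> bounded (range f) \<longrightarrow>
        continuous_map
          (prod_topology euclidean (Metric_space.mtopology stationary_controls d_M))
          (powertop_real {1..k})
          (\<lambda>(x, v). \<lambda>i\<in>{1..k}.
             \<integral>\<omega>. (\<integral>u. f (\<omega> i, u) \<partial>v (\<omega> i)) \<partial>stationary_law P v x))"

definition stability ::
    "('x::polish_space \<Rightarrow> 'u::polish_space \<Rightarrow> 'x measure) \<Rightarrow> 'x set \<Rightarrow> bool" where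
  "stability P C \<longleftrightarrow>
     (\<forall>v \<in> stationary_controls.
        aperiodic_chain (stationary_law P v) \<and> harris_recurrent (stationary_law P v) \<and>
        (\<exists>\<Lambda>. irreducibility_measure (stationary_law P v) \<Lambda>)) \<and>
     (\<exists>\<nu> \<in> space (prob_algebra borel). \<exists>\<gamma>. emeasure \<nu> C = 1 \<and> 0 < \<gamma> \<and> \<gamma> < 1 \<and>
        (\<forall>A \<in> sets borel. (INF u. INF x\<in>C. emeasure (P x u) A) \<ge> ennreal \<gamma> * emeasure \<nu> A))"

definition running_cost ::
    "real \<Rightarrow> 'x::polish_space \<Rightarrow> ('x \<Rightarrow> 'u::polish_space \<Rightarrow> 'x measure \<Rightarrow> real) \<Rightarrow> bool" where
  "running_cost p x0 r \<longleftrightarrow>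
     continuous_map
       (prod_topology euclidean (prod_topology euclidean (wasserstein_topology p x0)))
       euclideanreal (\<lambda>(x, u, \<mu>). r x u \<mu>) \<and>
     (\<forall>x u. \<forall>\<mu> \<in> P_p p x0. 0 \<le> r x u \<mu>)"

definition cost_growth ::
    "real \<Rightarrow> 'x::polish_space \<Rightarrow> (nat \<Rightarrow> 'x set) \<Rightarrow> ('x \<Rightarrow> real) \<Rightarrow>
     ('x \<Rightarrow> 'u::polish_space \<Rightarrow> 'x measure \<Rightarrow> real) \<Rightarrow> bool" where
  "cost_growth p x0 K \<V> r \<longleftrightarrow>
     (\<forall>\<K>. compactin (wasserstein_topology p x0) \<K> \<and> \<K> \<noteq> {} \<longrightarrow>
        (\<lambda>x. SUP (u, \<mu>) \<in> UNIV \<times> \<K>. r x u \<mu>) \<in> small_o K \<V>)"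

definition tv_continuity ::
    "('x::polish_space \<Rightarrow> 'u::polish_space \<Rightarrow> 'x measure) \<Rightarrow>
     (('x \<Rightarrow> 'u measure) \<Rightarrow> ('x \<Rightarrow> 'u measure) \<Rightarrow> real) \<Rightarrow> bool" where
  "tv_continuity P d_M \<longleftrightarrow>
     (\<forall>vs. \<forall>v \<in> stationary_controls.
        (\<forall>n. vs n \<in> stationary_controls) \<and>
        limitin (Metric_space.mtopology stationary_controls d_M) vs v sequentially \<longrightarrow>
        (\<lambda>n. tv_dist (\<eta>_inv P (vs n)) (\<eta>_inv P v)) \<longlonglongrightarrow> 0)"


section \<open>The average cost optimality equation and the map \<open>\<A>\<close>\<close>

definition is_minimum :: "real \<Rightarrow> real set \<Rightarrow> bool" where
  "is_minimum m S \<longleftrightarrow> m \<in> S \<and> (\<forall>s\<in>S. m \<le> s)"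

definition acoe_solution ::
    "('x::polish_space \<Rightarrow> 'u::polish_space \<Rightarrow> 'x measure) \<Rightarrow>
     ('x \<Rightarrow> 'u \<Rightarrow> 'x measure \<Rightarrow> real) \<Rightarrow> (nat \<Rightarrow> 'x set) \<Rightarrow> ('x \<Rightarrow> real) \<Rightarrow> 'x \<Rightarrow>
     'x measure \<Rightarrow> ('x \<Rightarrow> real) \<Rightarrow> real \<Rightarrow> bool" where
  "acoe_solution P r K \<V> x0 \<mu> V \<rho> \<longleftrightarrow>
     continuous_on UNIV V \<and> V \<in> small_o K \<V> \<and> V x0 = 0 \<and>
     (\<forall>x. is_minimum (V x + \<rho>) (range (\<lambda>u. r x u \<mu> + (\<integral>y. V y \<partial>P x u))))"

text \<open>
  The fact on which the notation \<open>V\<^sub>\<mu>\<close>, \<open>\<rho>\<^sub>\<mu>\<close> and the map \<open>\<A>\<close> rest. Existence of a solution with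
  continuous \<open>V\<close> is not implied by the conditions above when \<open>\<V>\<close> is not locally bounded: take
  one control, isolated points \<open>c\<close>, \<open>a\<^sub>j\<close>, \<open>b\<^sub>j\<close> and a limit \<open>a\<close> of the \<open>a\<^sub>j\<close>, where the
  \<open>b\<^sub>j\<close> leave every compact set. From \<open>a\<^sub>j\<close> the chain moves to \<open>b\<^sub>j\<close> with probability
  \<open>\<epsilon>\<^sub>j = 2\<^sup>-\<^sup>j\<close> and to \<open>c\<close> otherwise; from every other point it moves to \<open>c\<close>. Let the cost be
  \<open>1 / \<epsilon>\<^sub>j\<close> at \<open>b\<^sub>j\<close> and 0 elsewhere, \<open>C = {c}\<close> and \<open>\<V>\<close> of order \<open>j / \<epsilon>\<^sub>j\<close> at \<open>b\<^sub>j\<close> and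
  of order \<open>j\<close> at \<open>a\<^sub>j\<close>. Then \<open>V(a\<^sub>j) - V(a) = 1\<close> for every \<open>j\<close>.
\<close>

definition acoe_well_posed ::
    "real \<Rightarrow> ('x::polish_space \<Rightarrow> 'u::polish_space \<Rightarrow> 'x measure) \<Rightarrow>
     ('x \<Rightarrow> 'u \<Rightarrow> 'x measure \<Rightarrow> real) \<Rightarrow> (nat \<Rightarrow> 'x set) \<Rightarrow> ('x \<Rightarrow> real) \<Rightarrow> 'x \<Rightarrow> bool" where
  "acoe_well_posed p P r K \<V> x0 \<longleftrightarrow>
     (\<forall>\<mu> \<in> P_p p x0. \<exists>!(V, \<rho>). acoe_solution P r K \<V> x0 \<mu> V \<rho>)"

definition minimizing_selector ::
    "('x::polish_space \<Rightarrow> 'u::polish_space \<Rightarrow> 'x measure) \<Rightarrow>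
     ('x \<Rightarrow> 'u \<Rightarrow> 'x measure \<Rightarrow> real) \<Rightarrow> 'x measure \<Rightarrow> ('x \<Rightarrow> real) \<Rightarrow> real \<Rightarrow>
     'x measure \<Rightarrow> ('x \<Rightarrow> 'u measure) \<Rightarrow> bool" where
  "minimizing_selector P r \<mu> V \<rho> \<eta> v \<longleftrightarrow>
     (AE x in \<eta>. V x + \<rho> = (\<integral>u. r x u \<mu> \<partial>v x) + (\<integral>u. (\<integral>y. V y \<partial>P x u) \<partial>v x))"

definition \<A>_map ::
    "('x::polish_space \<Rightarrow> 'u::polish_space \<Rightarrow> 'x measure) \<Rightarrow>
     ('x \<Rightarrow> 'u \<Rightarrow> 'x measure \<Rightarrow> real) \<Rightarrow> (nat \<Rightarrow> 'x set) \<Rightarrow> ('x \<Rightarrow> real) \<Rightarrow> 'x \<Rightarrow>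
     'x measure \<Rightarrow> 'x measure set" where
  "\<A>_map P r K \<V> x0 \<mu> =
     {\<eta>_inv P v | v. v \<in> stationary_controls \<and>
        (\<exists>V \<rho>. acoe_solution P r K \<V> x0 \<mu> V \<rho> \<and> minimizing_selector P r \<mu> V \<rho> (\<eta>_inv P v) v)}"

definition mfg_solution ::
    "('x::polish_space \<Rightarrow> 'u::polish_space \<Rightarrow> 'x measure) \<Rightarrow>
     ('x \<Rightarrow> 'u \<Rightarrow> 'x measure \<Rightarrow> real) \<Rightarrow> (nat \<Rightarrow> 'x set) \<Rightarrow> ('x \<Rightarrow> real) \<Rightarrow> 'x \<Rightarrow>
     'x measure \<Rightarrow> bool" where
  "mfg_solution P r K \<V> x0 \<eta> \<longleftrightarrow> \<eta> \<in> invariant_measures P \<and> \<eta> \<in> \<A>_map P r K \<V> x0 \<eta>"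

end

theory Submission
  imports Defs
begin

text \<open>
  Write \<open>\<eta>\<^sub>v\<close> for the invariant law of the chain under the stationary control \<open>v\<close>, let
  \<open>\<pi>\<^sub>v(dx, du) = \<eta>\<^sub>v(dx) v(du|x)\<close> be its occupation measure, and \<open>J v \<mu> = \<integral>r(x, u, \<mu>) d\<pi>\<^sub>v\<close> the
  average cost of \<open>v\<close> against a population \<open>\<mu>\<close>. Integrate the optimality equation of \<open>\<mu>\<close> with
  respect to \<open>\<pi>\<^sub>v\<close>. Invariance of \<open>\<eta>\<^sub>v\<close> cancels the value function, and what remains is
  \<open>J v \<mu> = \<rho>\<^sub>\<mu> + \<integral>gap d\<pi>\<^sub>v\<close>, where \<open>gap(x, u) \<ge> 0\<close> is the amount by which the action \<open>u\<close> misses the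
  minimum at \<open>x\<close> (\<open>J_eq_gap\<close>). Actions that are measurable in \<open>x\<close> and optimal up to \<open>e\<close>
  show that the infimum of \<open>J v \<mu>\<close> over \<open>v\<close> is \<open>\<rho>\<^sub>\<mu>\<close> (\<open>near_optimal_control\<close>). Hence \<open>v\<close> is a minimizing
  selector for \<open>\<mu>\<close> exactly when it minimizes \<open>J v \<mu>\<close>, and a mean field solution is the same as a
  control \<open>v\<close> with \<open>J v \<eta>\<^sub>v \<le> J w \<eta>\<^sub>v\<close> for all \<open>w\<close>: a symmetric equilibrium.

  Such a \<open>v\<close> exists by Ky Fan's argument. The occupation measures form a convex set, because the
  densities of the invariant laws with respect to their mixture can be absorbed into the control
  (\<open>occ_mixture\<close>), and the cost is affine on it. Against finitely many competitors one therefore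
  works on a simplex of mixtures, where Brouwer's theorem gives a mixture that no competitor
  improves upon (\<open>finite_equilibrium\<close>). The controls that a given competitor does not improve
  upon form a closed set in the compact space of controls, so the finite intersection property
  leaves a control that is optimal against all of them (\<open>equilibrium_exists\<close>).

  Three analytic facts carry this. First, each kernel has exactly one invariant
  probability measure, with a bound on the integral of the drift function that is uniform in the
  control (locale \<open>drift_kernel\<close>): a chain that regenerates on the small set has a finite expected
  cycle, and the mutually singular parts of two invariant laws would both dominate the
  minorizing measure. Secondly, total variation convergence of such laws implies
  Wasserstein convergence, by leaving their common part in place and coupling the
  two Jordan parts independently (\<open>wasserstein_tendsto_of_tv\<close>). The topology used for the cost is the one of
  the Wasserstein metric, whose triangle inequality comes from gluing two couplings along a
  countable partition into small cells (\<open>approximate_gluing\<close>). Thirdly, occupation measures depend weakly continuously on the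
  control (\<open>occ_weakly_continuous\<close>), and functions negligible with respect to the drift function
  are uniformly integrable for them, which makes the cost continuous.
\<close>

section \<open>Fixed points on cubes and simplices of arbitrary dimension\<close>

lemma finitely_many_bounded_subsequences:
  fixes X :: "nat \<Rightarrow> nat \<Rightarrow> real"
  assumes "\<And>k j. j < n \<Longrightarrow> 0 \<le> X k j \<and> X k j \<le> 1"
  shows "\<exists>\<rho> x. strict_mono (\<rho> :: nat \<Rightarrow> nat) \<and> (\<forall>j<n. (\<lambda>k. X (\<rho> k) j) \<longlonglongrightarrow> x j)"
  using assms
proof (induction n)
  case 0
  show ?case by (auto intro: strict_mono_id)
next
  case (Suc n)
  then obtain \<rho> x where \<rho>: "strict_mono (\<rho> :: nat \<Rightarrow> nat)" "\<forall>j<n. (\<lambda>k. X (\<rho> k) j) \<longlonglongrightarrow> x j"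
    by (meson less_SucI)
  have "seq_compact {0..1::real}" by (simp add: compact_imp_seq_compact)
  moreover have "\<forall>k. X (\<rho> k) n \<in> {0..1}" using Suc.prems by auto
  ultimately obtain l \<sigma> where \<sigma>: "strict_mono (\<sigma> :: nat \<Rightarrow> nat)" "((\<lambda>k. X (\<rho> k) n) \<circ> \<sigma>) \<longlonglongrightarrow> l"
    using seq_compactE[of "{0..1::real}" "\<lambda>k. X (\<rho> k) n"] by metis
  have "(\<lambda>k. X ((\<rho> \<circ> \<sigma>) k) j) \<longlonglongrightarrow> (x(n := l)) j" if "j < Suc n" for j
  proof (cases "j = n")
    case False
    with that have "(\<lambda>k. X (\<rho> k) j) \<longlonglongrightarrow> x j" using \<rho> by auto
    from LIMSEQ_subseq_LIMSEQ[OF this \<sigma>(1)] False show ?thesis by (simp add: o_def)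
  qed (use \<sigma>(2) in \<open>simp add: o_def\<close>)
  then show ?case using strict_mono_o[OF \<rho>(1) \<sigma>(1)] by blast
qed

text \<open>Brouwer's theorem in dimension \<open>n\<close> for a number \<open>n\<close> that is not tied to a type; points are
  functions of which the values at \<open>i < n\<close> matter. Kuhn's lemma on a grid of mesh \<open>1 / p\<close> gives, for
  each coordinate, two neighbouring grid points at which \<open>f\<close> does not decrease, respectively does not
  increase, this coordinate. A limit point for \<open>p \<rightarrow> \<infinity>\<close> is fixed.\<close>

lemma brouwer_cube_nat:
  fixes f :: "(nat \<Rightarrow> real) \<Rightarrow> nat \<Rightarrow> real" and n :: nat
  defines "cube \<equiv> {x. \<forall>i<n. 0 \<le> x i \<and> x i \<le> (1::real)}"
  assumes range: "\<And>x. x \<in> cube \<Longrightarrow> f x \<in> cube"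
    and cont: "\<And>X x i. (\<And>k. X k \<in> cube) \<Longrightarrow> x \<in> cube \<Longrightarrow> (\<And>j. j < n \<Longrightarrow> (\<lambda>k. X k j) \<longlonglongrightarrow> x j) \<Longrightarrow>
       i < n \<Longrightarrow> (\<lambda>k. f (X k) i) \<longlonglongrightarrow> f x i"
  shows "\<exists>x\<in>cube. \<forall>i<n. f x i = x i"
proof -
  define pt where "pt p q = (\<lambda>j. real (q j) / real p)" for p :: nat and q :: "nat \<Rightarrow> nat"
  \<comment> \<open>The first two cases are the boundary conditions of Kuhn's lemma. They agree with the sense
    of the labels, as \<open>f\<close> maps the cube to itself.\<close>
  define label where "label p q i =
      (if q i = 0 then 0 else if q i = p then 1 else if f (pt p q) i < pt p q i then 1 else (0::nat))"
    for p q i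
  have pt_cube: "pt p q \<in> cube" if "0 < p" "\<And>j. j < n \<Longrightarrow> q j \<le> p" for p q
    using that by (auto simp: pt_def cube_def)
  have label0: "pt p q i \<le> f (pt p q) i"
    if "label p q i = 0" "0 < p" "\<And>j. j < n \<Longrightarrow> q j \<le> p" "i < n" for p q i
    using that range[OF pt_cube[OF that(2,3)]]
    by (auto simp: label_def cube_def pt_def split: if_splits)
  have label1: "f (pt p q) i \<le> pt p q i"
    if "label p q i \<noteq> 0" "0 < p" "\<And>j. j < n \<Longrightarrow> q j \<le> p" "i < n" for p q i
    using that range[OF pt_cube[OF that(2,3)]]
    by (auto simp: label_def cube_def pt_def split: if_splits)
  have "\<exists>x R S. x \<in> cube \<and> (\<forall>i<n. R i \<in> cube \<and> S i \<in> cube \<and> R i i \<le> f (R i) i \<and> f (S i) i \<le> S i i \<and>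
     (\<forall>j<n. \<bar>R i j - x j\<bar> \<le> 1 / Suc k \<and> \<bar>S i j - x j\<bar> \<le> 1 / Suc k))" for k
  proof -
    obtain q where q: "\<forall>i<n. q i < Suc k"
      and rs: "\<forall>i<n. \<exists>r s. (\<forall>j<n. q j \<le> r j \<and> r j \<le> q j + 1) \<and>
         (\<forall>j<n. q j \<le> s j \<and> s j \<le> q j + 1) \<and> label (Suc k) r i \<noteq> label (Suc k) s i"
      by (rule kuhn_lemma[of "Suc k" n "label (Suc k)"]) (auto simp: label_def)
    have near: "\<bar>pt (Suc k) r j - pt (Suc k) q j\<bar> \<le> 1 / Suc k"
      if "\<forall>j<n. q j \<le> r j \<and> r j \<le> q j + 1" "j < n" for r j
    proof -
      have "\<bar>real (r j) - real (q j)\<bar> \<le> 1" using that by force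
      then show ?thesis by (simp add: pt_def diff_divide_distrib[symmetric] divide_right_mono)
    qed
    have "\<exists>r s. r \<in> cube \<and> s \<in> cube \<and> r i \<le> f r i \<and> f s i \<le> s i \<and>
       (\<forall>j<n. \<bar>r j - pt (Suc k) q j\<bar> \<le> 1 / Suc k \<and> \<bar>s j - pt (Suc k) q j\<bar> \<le> 1 / Suc k)" if i: "i < n" for i
    proof -
      obtain r s where r: "\<forall>j<n. q j \<le> r j \<and> r j \<le> q j + 1" and s: "\<forall>j<n. q j \<le> s j \<and> s j \<le> q j + 1"
        and "label (Suc k) r i \<noteq> label (Suc k) s i" using rs i by blast
      then consider "label (Suc k) r i = 0" "label (Suc k) s i \<noteq> 0"
        | "label (Suc k) s i = 0" "label (Suc k) r i \<noteq> 0" by (auto simp: label_def split: if_splits)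
      then obtain r s where r: "\<forall>j<n. q j \<le> r j \<and> r j \<le> q j + 1" and s: "\<forall>j<n. q j \<le> s j \<and> s j \<le> q j + 1"
        and l: "label (Suc k) r i = 0" "label (Suc k) s i \<noteq> 0" using r s by metis
      have le: "\<And>j. j < n \<Longrightarrow> r j \<le> Suc k" "\<And>j. j < n \<Longrightarrow> s j \<le> Suc k" using r s q by fastforce+
      show ?thesis
        by (rule exI[of _ "pt (Suc k) r"], rule exI[of _ "pt (Suc k) s"])
          (use le near r s i label0[OF l(1)] label1[OF l(2)] pt_cube in auto)
    qed
    then obtain R S where "\<forall>i<n. R i \<in> cube \<and> S i \<in> cube \<and> R i i \<le> f (R i) i \<and> f (S i) i \<le> S i i \<and>
       (\<forall>j<n. \<bar>R i j - pt (Suc k) q j\<bar> \<le> 1 / Suc k \<and> \<bar>S i j - pt (Suc k) q j\<bar> \<le> 1 / Suc k)"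
      by metis
    moreover have "pt (Suc k) q \<in> cube" using q by (intro pt_cube) auto
    ultimately show ?thesis by blast
  qed
  then obtain Q R S where Q: "\<And>k. Q k \<in> cube"
    and RS: "\<And>k i. i < n \<Longrightarrow> R k i \<in> cube \<and> S k i \<in> cube \<and> R k i i \<le> f (R k i) i \<and> f (S k i) i \<le> S k i i"
    and near: "\<And>k i j. i < n \<Longrightarrow> j < n \<Longrightarrow> \<bar>R k i j - Q k j\<bar> \<le> 1 / Suc k \<and> \<bar>S k i j - Q k j\<bar> \<le> 1 / Suc k"
    by metis
  obtain \<rho> x where \<rho>: "strict_mono (\<rho> :: nat \<Rightarrow> nat)" and x: "\<And>j. j < n \<Longrightarrow> (\<lambda>k. Q (\<rho> k) j) \<longlonglongrightarrow> x j"
    using finitely_many_bounded_subsequences[of n Q] Q by (auto simp: cube_def)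
  have x_cube: "x \<in> cube"
    using LIMSEQ_le_const[OF x] LIMSEQ_le_const2[OF x] Q by (fastforce simp: cube_def)
  have small: "(\<lambda>k. 1 / real (Suc (\<rho> k))) \<longlonglongrightarrow> 0"
    using LIMSEQ_subseq_LIMSEQ[OF LIMSEQ_inverse_real_of_nat \<rho>] by (simp add: o_def inverse_eq_divide)
  have close: "(\<lambda>k. T (\<rho> k) j) \<longlonglongrightarrow> x j"
    if T: "\<And>k. \<bar>T k j - Q k j\<bar> \<le> 1 / Suc k" and "j < n" for T :: "nat \<Rightarrow> nat \<Rightarrow> real" and j
  proof -
    have "(\<lambda>k. T (\<rho> k) j - Q (\<rho> k) j) \<longlonglongrightarrow> 0"
      by (rule tendsto_rabs_zero_cancel, rule tendsto_sandwich[OF _ _ tendsto_const small]) (use T in auto)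
    from tendsto_add[OF this x[OF \<open>j < n\<close>]] show ?thesis by simp
  qed
  have "f x i = x i" if i: "i < n" for i
  proof (rule antisym)
    have R: "(\<lambda>k. R (\<rho> k) i j) \<longlonglongrightarrow> x j" if "j < n" for j
      using close[of "\<lambda>k. R k i" j] near i that by auto
    have S: "(\<lambda>k. S (\<rho> k) i j) \<longlonglongrightarrow> x j" if "j < n" for j
      using close[of "\<lambda>k. S k i" j] near i that by auto
    show "x i \<le> f x i"
      by (rule LIMSEQ_le[OF R[OF i] cont[of "\<lambda>k. R (\<rho> k) i", OF _ x_cube R i]]) (use RS i in auto)
    show "f x i \<le> x i"
      by (rule LIMSEQ_le[OF cont[of "\<lambda>k. S (\<rho> k) i", OF _ x_cube S i] S[OF i]]) (use RS i in auto)
  qed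
  with x_cube show ?thesis by blast
qed

definition weights :: "nat \<Rightarrow> (nat \<Rightarrow> real) set" where
  "weights n = {t. (\<forall>i<n. 0 \<le> t i) \<and> (\<Sum>i<n. t i) = 1}"

lemma weights_le_1: "t \<in> weights n \<Longrightarrow> i < n \<Longrightarrow> t i \<le> 1"
  unfolding weights_def using member_le_sum[of i "{..<n}" t] by auto

text \<open>The map \<open>ret\<close> retracts the cube onto the simplex: it adds the missing mass in equal parts, or
  divides by the mass if that exceeds 1. A fixed point of \<open>T \<circ> ret\<close> lies in the simplex.\<close>

lemma brouwer_simplex_nat:
  fixes T :: "(nat \<Rightarrow> real) \<Rightarrow> nat \<Rightarrow> real"
  assumes n: "0 < n"
    and range: "\<And>t. t \<in> weights n \<Longrightarrow> T t \<in> weights n"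
    and cont: "\<And>X t i. (\<And>k. X k \<in> weights n) \<Longrightarrow> t \<in> weights n \<Longrightarrow>
       (\<And>j. j < n \<Longrightarrow> (\<lambda>k. X k j) \<longlonglongrightarrow> t j) \<Longrightarrow> i < n \<Longrightarrow> (\<lambda>k. T (X k) i) \<longlonglongrightarrow> T t i"
  shows "\<exists>t\<in>weights n. \<forall>i<n. T t i = t i"
proof -
  define sm where "sm x = (\<Sum>j<n. x j)" for x :: "nat \<Rightarrow> real"
  define ret where "ret x i = (x i + max 0 (1 - sm x) / n) / max (sm x) 1" for x :: "nat \<Rightarrow> real" and i
  let ?cube = "{x. \<forall>i<n. 0 \<le> x i \<and> x i \<le> (1::real)}"
  have ret: "ret x \<in> weights n" if "x \<in> ?cube" for x
  proof -
    have "(\<Sum>i<n. ret x i) = (sm x + max 0 (1 - sm x)) / max (sm x) 1"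
      using n by (simp add: ret_def sm_def sum_divide_distrib[symmetric] sum.distrib)
    then have "(\<Sum>i<n. ret x i) = 1" by (auto simp: max_def)
    moreover have "0 \<le> ret x i" if "i < n" for i
      using \<open>x \<in> ?cube\<close> that by (auto simp: ret_def intro!: divide_nonneg_pos add_nonneg_nonneg)
    ultimately show ?thesis by (simp add: weights_def)
  qed
  have ret_id: "ret x i = x i" if "sm x = 1" for x i using that by (simp add: ret_def)
  have ret_cont: "(\<lambda>k. ret (X k) i) \<longlonglongrightarrow> ret x i"
    if "\<And>j. j < n \<Longrightarrow> (\<lambda>k. X k j) \<longlonglongrightarrow> x j" "i < n" for X x i
    unfolding ret_def sm_def using that n by (intro tendsto_intros) auto
  have "\<exists>x\<in>?cube. \<forall>i<n. T (ret x) i = x i"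
  proof (rule brouwer_cube_nat[of n "\<lambda>x. T (ret x)"])
    show "T (ret x) \<in> ?cube" if "x \<in> ?cube" for x
      using range[OF ret[OF that]] weights_le_1 by (auto simp: weights_def)
    show "(\<lambda>k. T (ret (X k)) i) \<longlonglongrightarrow> T (ret x) i"
      if "\<And>k. X k \<in> ?cube" "x \<in> ?cube" "\<And>j. j < n \<Longrightarrow> (\<lambda>k. X k j) \<longlonglongrightarrow> x j" "i < n" for X x i
      using that by (intro cont ret ret_cont) auto
  qed
  then obtain x where x: "x \<in> ?cube" "\<forall>i<n. T (ret x) i = x i" by blast
  have "sm x = (\<Sum>i<n. T (ret x) i)" using x by (simp add: sm_def)
  then have "sm x = 1" using range[OF ret[OF x(1)]] by (simp add: weights_def)
  then have "ret x = x" using ret_id by blast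
  then show ?thesis using x ret[OF x(1)] by auto
qed

text \<open>Nash's map shifts weight towards the pure strategies \<open>i\<close> with \<open>G i t\<close> below the current average
  cost. At a fixed point with a positive total shift, every strategy in use would cost
  less than the average.\<close>

lemma symmetric_equilibrium_on_simplex:
  fixes G :: "nat \<Rightarrow> (nat \<Rightarrow> real) \<Rightarrow> real"
  assumes n: "0 < n"
    and cont: "\<And>X t i. (\<And>k. X k \<in> weights n) \<Longrightarrow> t \<in> weights n \<Longrightarrow>
       (\<And>j. j < n \<Longrightarrow> (\<lambda>k. X k j) \<longlonglongrightarrow> t j) \<Longrightarrow> i < n \<Longrightarrow> (\<lambda>k. G i (X k)) \<longlonglongrightarrow> G i t"
  shows "\<exists>t\<in>weights n. \<forall>i<n. (\<Sum>j<n. t j * G j t) \<le> G i t"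
proof -
  define A where "A t = (\<Sum>j<n. t j * G j t)" for t
  define g where "g t i = max 0 (A t - G i t)" for t i
  define T where "T t i = (t i + g t i) / (1 + (\<Sum>j<n. g t j))" for t i
  have pos: "0 < 1 + (\<Sum>j<n. g t j)" for t
    by (intro add_pos_nonneg sum_nonneg) (auto simp: g_def)
  have "\<exists>t\<in>weights n. \<forall>i<n. T t i = t i"
  proof (rule brouwer_simplex_nat[OF n])
    fix t assume t: "t \<in> weights n"
    have "(\<Sum>i<n. T t i) = 1"
      using pos[of t] t by (simp add: T_def sum_divide_distrib[symmetric] sum.distrib weights_def)
    moreover have "0 \<le> T t i" if "i < n" for i
      using pos[of t] t that by (auto simp: T_def g_def weights_def)
    ultimately show "T t \<in> weights n" by (simp add: weights_def)
  next
    fix X t i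
    assume *: "\<And>k. X k \<in> weights n" "t \<in> weights n" "\<And>j. j < n \<Longrightarrow> (\<lambda>k. X k j) \<longlonglongrightarrow> t j" "i < n"
    have "(\<lambda>k. g (X k) i) \<longlonglongrightarrow> g t i" if "i < n" for i
      unfolding g_def A_def using that *(3) by (intro tendsto_intros cont *(1,2)) auto
    then show "(\<lambda>k. T (X k) i) \<longlonglongrightarrow> T t i"
      unfolding T_def using * pos[of t] by (intro tendsto_intros) auto
  qed
  then obtain t where t: "t \<in> weights n" and fix_t: "\<And>i. i < n \<Longrightarrow> T t i = t i" by blast
  define s where "s = (\<Sum>j<n. g t j)"
  have g_eq: "g t i = t i * s" if "i < n" for i
    using fix_t[OF that] pos[of t] by (simp add: T_def s_def[symmetric] field_simps)
  have nonneg: "0 \<le> t i" if "i < n" for i using t that by (auto simp: weights_def)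
  have sum_t: "(\<Sum>i<n. t i) = 1" using t by (simp add: weights_def)
  have "s = 0"
  proof (rule ccontr)
    assume "s \<noteq> 0"
    then have s: "s > 0" unfolding s_def by (smt (verit) g_def sum_nonneg)
    have "t i * G i t \<le> t i * A t" if "i < n" for i
      using g_eq[OF that] nonneg[OF that] s
      by (cases "t i = 0") (auto simp: g_def max_def intro!: mult_left_mono split: if_splits)
    moreover obtain i where i: "i < n" "t i > 0"
      using sum_t nonneg by (metis finite_lessThan lessThan_iff less_eq_real_def sum.neutral zero_neq_one)
    moreover have "t i * G i t < t i * A t"
      using g_eq[OF i(1)] mult_pos_pos[OF i(2) s] i(2) by (simp add: g_def)
    ultimately have "(\<Sum>i<n. t i * G i t) < (\<Sum>i<n. t i * A t)"
      by (intro sum_strict_mono_ex1) (blast, blast, metis lessThan_iff)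
    also have "\<dots> = A t" using sum_t by (simp add: sum_distrib_right[symmetric])
    finally show False by (simp add: A_def)
  qed
  then have "A t \<le> G i t" if "i < n" for i
    using g_eq[OF that] by (simp add: g_def max_def split: if_splits)
  then show ?thesis using t unfolding A_def by blast
qed

section \<open>Mixtures and Jordan parts of measures\<close>

text \<open>The sum of the measures \<open>w i \<cdot> N i\<close>, as a monadic bind, so that integrals against it come from the
  Giry monad. The weights need not sum to 1.\<close>

definition mixture :: "nat \<Rightarrow> (nat \<Rightarrow> ennreal) \<Rightarrow> (nat \<Rightarrow> 'a measure) \<Rightarrow> 'a measure" where
  "mixture n w N = density (count_space {..<n}) w \<bind> N"

lemma nn_integral_mixture:
  assumes "\<And>i. i < n \<Longrightarrow> N i \<in> space (subprob_algebra B)" "f \<in> borel_measurable B"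
  shows "(\<integral>\<^sup>+x. f x \<partial>mixture n w N) = (\<Sum>i<n. w i * (\<integral>\<^sup>+x. f x \<partial>N i))"
proof -
  have "N \<in> density (count_space {..<n}) w \<rightarrow>\<^sub>M subprob_algebra B"
    using assms(1) by (simp add: measurable_count_space_eq1)
  then show ?thesis
    unfolding mixture_def using assms(2)
    by (simp add: nn_integral_bind nn_integral_density nn_integral_count_space_finite)
qed

lemma sets_mixture:
  assumes "0 < n" "\<And>i. i < n \<Longrightarrow> sets (N i) = sets B"
  shows "sets (mixture n w N) = sets B"
  unfolding mixture_def using assms by (subst sets_bind[where N = B]) auto

lemma emeasure_mixture:
  assumes "0 < n" "\<And>i. i < n \<Longrightarrow> N i \<in> space (subprob_algebra B)" "A \<in> sets B"
  shows "emeasure (mixture n w N) A = (\<Sum>i<n. w i * emeasure (N i) A)"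
proof -
  have s: "\<And>i. i < n \<Longrightarrow> sets (N i) = sets B" using assms(2) by (auto simp: space_subprob_algebra)
  have "emeasure (mixture n w N) A = (\<integral>\<^sup>+x. indicator A x \<partial>mixture n w N)"
    using assms(3) sets_mixture[OF assms(1) s] by simp
  also have "\<dots> = (\<Sum>i<n. w i * (\<integral>\<^sup>+x. indicator A x \<partial>N i))"
    by (rule nn_integral_mixture) (use assms in auto)
  finally show ?thesis using assms(3) s by simp
qed

lemma mixture_in_prob_algebra:
  assumes "0 < n" "\<And>i. i < n \<Longrightarrow> N i \<in> space (prob_algebra B)" "(\<Sum>i<n. w i) = 1"
  shows "mixture n w N \<in> space (prob_algebra B)"
proof -
  have sub: "N i \<in> space (subprob_algebra B)" if "i < n" for i
    using assms(2)[OF that] by (auto simp: space_prob_algebra space_subprob_algebra prob_space_imp_subprob_space)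
  have sets: "sets (mixture n w N) = sets B"
    using assms by (intro sets_mixture) (auto simp: space_prob_algebra)
  moreover have "emeasure (mixture n w N) (space B) = (\<Sum>i<n. w i)"
    using emeasure_mixture[OF assms(1) sub, where A = "space B" and w = w] in_space_prob_algebra[OF assms(2)] by simp
  ultimately show ?thesis
    using assms(3) sets_eq_imp_space_eq[OF sets] by (auto simp: space_prob_algebra intro!: prob_spaceI)
qed

lemma measurable_mixture:
  assumes "0 < n" "\<And>i. i < n \<Longrightarrow> N i \<in> M \<rightarrow>\<^sub>M prob_algebra B"
    and "\<And>i. i < n \<Longrightarrow> w i \<in> borel_measurable M" "\<And>x. x \<in> space M \<Longrightarrow> (\<Sum>i<n. w i x) = 1"
  shows "(\<lambda>x. mixture n (\<lambda>i. w i x) (\<lambda>i. N i x)) \<in> M \<rightarrow>\<^sub>M prob_algebra B"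
proof -
  have in_prob: "N i x \<in> space (prob_algebra B)" if "i < n" "x \<in> space M" for i x
    using measurable_space[OF assms(2)[OF that(1)] that(2)] .
  then have sub: "N i x \<in> space (subprob_algebra B)" if "i < n" "x \<in> space M" for i x
    using that by (auto simp: space_prob_algebra space_subprob_algebra prob_space_imp_subprob_space)
  have mix: "mixture n (\<lambda>i. w i x) (\<lambda>i. N i x) \<in> space (prob_algebra B)" if "x \<in> space M" for x
    by (rule mixture_in_prob_algebra) (use assms in_prob that in auto)
  show ?thesis
  proof (rule measurable_prob_algebraI[OF _ measurable_subprob_algebra])
    fix A assume A: "A \<in> sets B"
    have "(\<lambda>x. \<Sum>i<n. w i x * emeasure (N i x) A) \<in> borel_measurable M"
      using assms(3) measurable_emeasure_kernel[OF measurable_prob_algebraD[OF assms(2)] A]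
      by (intro borel_measurable_sum borel_measurable_times) auto
    then show "(\<lambda>x. emeasure (mixture n (\<lambda>i. w i x) (\<lambda>i. N i x)) A) \<in> borel_measurable M"
      by (subst measurable_cong[OF emeasure_mixture[OF assms(1) sub A]]) auto
  qed (use mix in \<open>auto simp: space_prob_algebra prob_space_imp_subprob_space\<close>)
qed

text \<open>The set \<open>Y\<close> is a Hahn set, on which \<open>M\<close> dominates \<open>N\<close>, and \<open>\<alpha>\<close> and \<open>\<beta>\<close> are the positive and the
  negative part of \<open>M - N\<close>.\<close>

lemma jordan_parts:
  fixes M N :: "'a measure"
  assumes "finite_measure M" "finite_measure N" and sets_eq: "sets N = sets M"
  obtains Y \<alpha> \<beta> where "Y \<in> sets M" "sets \<alpha> = sets M" "sets \<beta> = sets M"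
    "\<And>A. A \<in> sets M \<Longrightarrow> emeasure \<alpha> A + emeasure N (A \<inter> Y) = emeasure M (A \<inter> Y)"
    "\<And>A. A \<in> sets M \<Longrightarrow> emeasure \<beta> A + emeasure M (A - Y) = emeasure N (A - Y)"
proof -
  interpret M: finite_measure M by fact
  interpret N: finite_measure N by fact
  obtain Y where Y: "Y \<in> sets M"
    and sub: "\<forall>X\<in>sets M. X \<subseteq> Y \<longrightarrow> emeasure N X \<le> emeasure M X"
    and disj: "\<forall>X\<in>sets M. X \<inter> Y = {} \<longrightarrow> emeasure M X \<le> emeasure N X"
    using finite_unsigned_Hahn_decomposition[OF assms(1,2) sets_eq] by (elim bexE conjE)
  note le = sub[rule_format] disj[rule_format]
  have part: "\<exists>\<alpha>. sets \<alpha> = sets M \<and> (\<forall>A\<in>sets M. emeasure \<alpha> A + emeasure Q (A \<inter> Z) = emeasure R (A \<inter> Z))"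
    if "finite_measure Q" "finite_measure R" "sets Q = sets M" "sets R = sets M" "Z \<in> sets M"
      and "\<And>X. X \<in> sets M \<Longrightarrow> X \<subseteq> Z \<Longrightarrow> emeasure Q X \<le> emeasure R X" for Q R :: "'a measure" and Z
  proof -
    let ?Q = "density Q (indicator Z)" and ?R = "density R (indicator Z)"
    have eq: "emeasure ?Q A = emeasure Q (A \<inter> Z)" "emeasure ?R A = emeasure R (A \<inter> Z)" if "A \<in> sets M" for A
      using emeasure_restricted[of Z Q A] emeasure_restricted[of Z R A] that \<open>Z \<in> sets M\<close>
        \<open>sets Q = sets M\<close> \<open>sets R = sets M\<close> by (simp_all add: Int_commute)
    have le': "emeasure Q (A \<inter> Z) \<le> emeasure R (A \<inter> Z)" if "A \<in> sets M" for A
      by (rule \<open>\<And>X. X \<in> sets M \<Longrightarrow> X \<subseteq> Z \<Longrightarrow> emeasure Q X \<le> emeasure R X\<close>)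
        (simp_all add: that \<open>Z \<in> sets M\<close> sets.Int)
    have "emeasure (diff_measure ?R ?Q) A + emeasure Q (A \<inter> Z) = emeasure R (A \<inter> Z)" if A: "A \<in> sets M" for A
    proof -
      have "space Q = space M" "space R = space M"
        by (rule sets_eq_imp_space_eq, fact)+
      then have fin: "finite_measure ?R" "finite_measure ?Q"
        using finite_measure.emeasure_finite[OF \<open>finite_measure Q\<close>]
          finite_measure.emeasure_finite[OF \<open>finite_measure R\<close>] eq[of "space M"]
        by (auto intro!: finite_measureI)
      have "emeasure (diff_measure ?R ?Q) A = emeasure ?R A - emeasure ?Q A"
        by (rule emeasure_diff_measure[OF fin]) (simp_all add: \<open>sets Q = sets M\<close> \<open>sets R = sets M\<close> A eq le')
      then show ?thesis
        using le'[OF A] by (simp add: eq[OF A] diff_add_cancel_ennreal)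
    qed
    moreover have "sets (diff_measure ?R ?Q) = sets M" using that by simp
    ultimately show ?thesis by (intro exI[of _ "diff_measure ?R ?Q"]) simp
  qed
  have "\<exists>\<alpha>. sets \<alpha> = sets M \<and> (\<forall>A\<in>sets M. emeasure \<alpha> A + emeasure N (A \<inter> Y) = emeasure M (A \<inter> Y))"
    by (rule part[OF assms(2,1) sets_eq refl Y]) (rule le(1))
  then obtain \<alpha> where \<alpha>: "sets \<alpha> = sets M"
    "\<forall>A\<in>sets M. emeasure \<alpha> A + emeasure N (A \<inter> Y) = emeasure M (A \<inter> Y)"
    by (elim exE conjE)
  have Yc: "space M - Y \<in> sets M" using Y by auto
  have "\<exists>\<beta>. sets \<beta> = sets M \<and> (\<forall>A\<in>sets M. emeasure \<beta> A + emeasure M (A \<inter> (space M - Y)) =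
      emeasure N (A \<inter> (space M - Y)))"
    by (rule part[OF assms(1,2) refl sets_eq Yc]) (rule le(2), auto)
  then obtain \<beta> where \<beta>: "sets \<beta> = sets M"
    "\<forall>A\<in>sets M. emeasure \<beta> A + emeasure M (A \<inter> (space M - Y)) = emeasure N (A \<inter> (space M - Y))"
    by (elim exE conjE)
  have "A \<inter> (space M - Y) = A - Y" if "A \<in> sets M" for A
    using sets.sets_into_space[OF that] by auto
  then have "emeasure \<beta> A + emeasure M (A - Y) = emeasure N (A - Y)" if "A \<in> sets M" for A
    using bspec[OF \<beta>(2) that] that by simp
  from that[OF Y \<alpha>(1) \<beta>(1) bspec[OF \<alpha>(2)] this] show thesis .
qed

section \<open>Couplings and approximate gluing\<close>

lemma convex_on_powr_nonneg:
  assumes "1 \<le> p"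
  shows "convex_on {0..} (\<lambda>x::real. x powr p)"
proof (rule convex_onI)
  fix t x y :: real assume t: "0 < t" "t < 1" and xy: "x \<in> {0..}" "y \<in> {0..}"
  have scale: "(s * z) powr p \<le> s * z powr p" if "0 < s" "s < 1" "0 \<le> z" for s z
  proof -
    have "s powr p \<le> s powr 1" using that assms by (intro powr_mono') auto
    then show ?thesis using that by (simp add: powr_mult mult_right_mono)
  qed
  consider "x = 0" | "y = 0" | "0 < x" "0 < y" using xy by fastforce
  then show "((1 - t) *\<^sub>R x + t *\<^sub>R y) powr p \<le> (1 - t) * x powr p + t * y powr p"
  proof cases
    case 3
    then show ?thesis using convex_onD[OF powr_convex[OF assms], of t x y] t by simp
  qed (use scale[of t y] scale[of "1 - t" x] t xy in auto)
qed (simp add: convex_real_interval)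

lemma powr_add_le_weighted:
  fixes a b A B :: real
  assumes p: "1 \<le> p" and AB: "0 < A" "0 < B" and ab: "0 \<le> a" "0 \<le> b"
  shows "(a + b) powr p \<le> (A + B) powr p * (A / (A + B) * (a / A) powr p + B / (A + B) * (b / B) powr p)"
proof -
  have "((1 - B / (A + B)) *\<^sub>R (a / A) + (B / (A + B)) *\<^sub>R (b / B)) powr p \<le>
      (1 - B / (A + B)) * (a / A) powr p + B / (A + B) * (b / B) powr p"
    using AB ab by (intro convex_onD[OF convex_on_powr_nonneg[OF p]]) (auto simp: field_simps)
  moreover have "1 - B / (A + B) = A / (A + B)" using AB by (simp add: field_simps)
  moreover have "(A / (A + B)) *\<^sub>R (a / A) + (B / (A + B)) *\<^sub>R (b / B) = (a + b) / (A + B)"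
    using AB by (simp add: add_divide_distrib)
  ultimately have "((a + b) / (A + B)) powr p \<le> A / (A + B) * (a / A) powr p + B / (A + B) * (b / B) powr p"
    by simp
  then have "(A + B) powr p * ((a + b) / (A + B)) powr p \<le>
      (A + B) powr p * (A / (A + B) * (a / A) powr p + B / (A + B) * (b / B) powr p)"
    by (rule mult_left_mono) simp
  moreover have "(A + B) powr p * ((a + b) / (A + B)) powr p = (a + b) powr p"
    using AB ab by (simp add: powr_mult[symmetric])
  ultimately show ?thesis by simp
qed

text \<open>The triangle inequality in \<open>L\<^sup>p\<close> with its bounds prescribed: integrated against functions \<open>a\<close> and
  \<open>b\<close> with \<open>p\<close>-norms at most \<open>A\<close> and \<open>B\<close>, the inequality bounds the \<open>p\<close>-norm of \<open>a + b + e\<close> by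
  \<open>A + B + e\<close>. It is Jensen's inequality for the convex combination
  \<open>(A (a / A) + B (b / B) + e \<cdot> 1) / (A + B + e)\<close>.\<close>

lemma minkowski_weights:
  assumes p: "1 \<le> p" and pos: "0 < A" "0 < B" "0 < (e::real)"
  obtains k1 k2 k3 where "0 \<le> k1" "0 \<le> k2" "0 \<le> k3"
    "\<And>a b. 0 \<le> a \<Longrightarrow> 0 \<le> b \<Longrightarrow> (a + b + e) powr p \<le> k1 * a powr p + k2 * b powr p + k3"
    "k1 * A powr p + k2 * B powr p + k3 = (A + B + e) powr p"
proof -
  define S where "S = A + B + e"
  have S: "0 < S" "A + (B + e) = S" using pos by (auto simp: S_def)
  let ?k1 = "S powr p * (A / S) / A powr p" and ?k2 = "S powr p * (B / S) / B powr p"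
    and ?k3 = "S powr p * (e / S)"
  have "(a + b + e) powr p \<le> ?k1 * a powr p + ?k2 * b powr p + ?k3" if ab: "0 \<le> a" "0 \<le> b" for a b
  proof -
    have "((b + e) / (B + e)) powr p = (b + e) powr p / (B + e) powr p"
      using ab pos by (simp add: powr_divide)
    also have "\<dots> \<le> B / (B + e) * (b / B) powr p + e / (B + e) * (e / e) powr p"
      using powr_add_le_weighted[OF p pos(2,3) ab(2), of e] pos
      by (simp add: divide_le_eq mult.commute)
    also have "\<dots> = B / (B + e) * (b / B) powr p + e / (B + e)" using pos by simp
    finally have be: "((b + e) / (B + e)) powr p \<le> B / (B + e) * (b / B) powr p + e / (B + e)" .
    have "(a + b + e) powr p = (a + (b + e)) powr p" by (simp add: add.assoc)
    also have "\<dots> \<le> S powr p * (A / S * (a / A) powr p + (B + e) / S * ((b + e) / (B + e)) powr p)"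
      using powr_add_le_weighted[of p A "B + e" a "b + e"] p pos ab S by simp
    also have "\<dots> \<le> S powr p * (A / S * (a / A) powr p + (B + e) / S *
        (B / (B + e) * (b / B) powr p + e / (B + e)))"
      using be pos S by (intro mult_left_mono add_left_mono) auto
    also have "\<dots> = S powr p * (A / S * (a / A) powr p + B / S * (b / B) powr p + e / S)"
    proof -
      have "(B + e) / S * (B / (B + e) * y + e / (B + e)) = B / S * y + e / S" for y
      proof -
        have "D / S * (B / D * y + e / D) = B / S * y + e / S" if "D \<noteq> 0" for D
          using that by (simp add: distrib_left)
        from this[of "B + e"] pos show ?thesis by simp
      qed
      then show ?thesis by (simp add: add.assoc)
    qed
    also have "\<dots> = ?k1 * a powr p + ?k2 * b powr p + ?k3"
      using pos ab by (simp add: powr_divide distrib_left)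
    finally show ?thesis .
  qed
  moreover have "?k1 * A powr p + ?k2 * B powr p + ?k3 = (A + B + e) powr p"
  proof -
    have "?k1 * A powr p + ?k2 * B powr p + ?k3 = S powr p * ((A + B + e) / S)"
      using pos by (simp add: add_divide_distrib distrib_left)
    then show ?thesis using S by (simp add: S_def[symmetric])
  qed
  moreover have "0 \<le> ?k1" "0 \<le> ?k2" "0 \<le> ?k3" using pos S by auto
  ultimately show thesis using that[of ?k1 ?k2 ?k3] by simp
qed

lemma powr_add_le:
  fixes a b p :: real
  assumes "0 \<le> a" "0 \<le> b" "0 \<le> p"
  shows "(a + b) powr p \<le> 2 powr p * (a powr p + b powr p)"
proof -
  have "(a + b) powr p \<le> (2 * max a b) powr p" using assms by (intro powr_mono2) auto
  also have "\<dots> = 2 powr p * max a b powr p" using assms by (simp add: powr_mult)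
  also have "\<dots> \<le> 2 powr p * (a powr p + b powr p)" by (intro mult_left_mono) (auto simp: max_def)
  finally show ?thesis .
qed

definition transport_cost :: "real \<Rightarrow> ('x::polish_space \<times> 'x) measure \<Rightarrow> ennreal" where
  "transport_cost p \<pi> = (\<integral>\<^sup>+z. ennreal (dist (fst z) (snd z) powr p) \<partial>\<pi>)"

lemma measurable_dist_powr [measurable]:
  "(\<lambda>z. ennreal (dist (fst z) (snd z) powr p)) \<in>
     borel_measurable (borel \<Otimes>\<^sub>M borel :: ('x::polish_space \<times> 'x) measure)"
  by measurable

lemma couplings_iff:
  "\<pi> \<in> couplings \<mu> \<nu> \<longleftrightarrow> sets \<pi> = sets (borel \<Otimes>\<^sub>M borel) \<and> prob_space \<pi> \<and>
     distr \<pi> borel fst = \<mu> \<and> distr \<pi> borel snd = \<nu>"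
  by (auto simp: couplings_def space_prob_algebra)

lemma coupling_nn_integral:
  assumes "\<pi> \<in> couplings \<mu> (\<nu> :: 'x::polish_space measure)" "f \<in> borel_measurable borel"
  shows "(\<integral>\<^sup>+z. f (fst z) \<partial>\<pi>) = (\<integral>\<^sup>+x. f x \<partial>\<mu>)" "(\<integral>\<^sup>+z. f (snd z) \<partial>\<pi>) = (\<integral>\<^sup>+x. f x \<partial>\<nu>)"
proof -
  have s[measurable_cong]: "sets \<pi> = sets (borel \<Otimes>\<^sub>M borel)"
    and m: "distr \<pi> borel fst = \<mu>" "distr \<pi> borel snd = \<nu>"
    using assms(1) by (auto simp: couplings_iff)
  have "fst \<in> \<pi> \<rightarrow>\<^sub>M borel" "snd \<in> \<pi> \<rightarrow>\<^sub>M borel" by measurable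
  then show "(\<integral>\<^sup>+z. f (fst z) \<partial>\<pi>) = (\<integral>\<^sup>+x. f x \<partial>\<mu>)" "(\<integral>\<^sup>+z. f (snd z) \<partial>\<pi>) = (\<integral>\<^sup>+x. f x \<partial>\<nu>)"
    using assms(2) by (simp_all add: m[symmetric] nn_integral_distr)
qed

text \<open>That \<open>\<pi>\<close> is a probability measure follows from its first marginal.\<close>

lemma couplingI:
  assumes s: "sets \<pi> = sets (borel \<Otimes>\<^sub>M (borel :: 'x::polish_space measure))"
    and \<mu>: "\<mu> \<in> space (prob_algebra borel)" and \<nu>: "\<nu> \<in> space (prob_algebra borel)"
    and marg: "\<And>A. A \<in> sets borel \<Longrightarrow> (\<integral>\<^sup>+z. indicator A (fst z) \<partial>\<pi>) = emeasure \<mu> A"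
      "\<And>A. A \<in> sets borel \<Longrightarrow> (\<integral>\<^sup>+z. indicator A (snd z) \<partial>\<pi>) = emeasure \<nu> A"
  shows "\<pi> \<in> couplings \<mu> (\<nu> :: 'x measure)"
proof -
  note [measurable_cong] = s
  have sets: "sets \<mu> = sets borel" "sets \<nu> = sets borel" and "prob_space \<mu>"
    using \<mu> \<nu> by (auto simp: space_prob_algebra)
  have "distr \<pi> borel fst = \<mu>" "distr \<pi> borel snd = \<nu>"
    using marg
    by (auto intro!: measure_eqI simp: sets nn_integral_indicator[symmetric] nn_integral_distr
        simp del: nn_integral_indicator)
  moreover from this(1) have "prob_space \<pi>"
    using \<open>prob_space \<mu>\<close> prob_space_distrD[of fst \<pi> borel] by simp
  ultimately show ?thesis using s by (simp add: couplings_iff)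
qed

lemma wasserstein_le:
  assumes "\<pi> \<in> couplings \<mu> \<nu>" "transport_cost p \<pi> \<le> ennreal (A powr p)" "0 \<le> A" "1 \<le> p"
  shows "wasserstein p \<mu> \<nu> \<le> A"
proof -
  have "(INF \<pi> \<in> couplings \<mu> \<nu>. transport_cost p \<pi>) \<le> ennreal (A powr p)"
    using INF_lower[OF assms(1), of "transport_cost p"] assms(2) by simp
  then have "enn2real (INF \<pi> \<in> couplings \<mu> \<nu>. transport_cost p \<pi>) \<le> A powr p"
    by (simp add: enn2real_leI)
  then have "enn2real (INF \<pi> \<in> couplings \<mu> \<nu>. transport_cost p \<pi>) powr (1 / p) \<le> (A powr p) powr (1 / p)"
    using assms by (intro powr_mono2) auto
  then show ?thesis using assms by (simp add: wasserstein_def transport_cost_def powr_powr)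
qed

text \<open>The product coupling has finite cost. Finiteness matters because \<^const>\<open>wasserstein\<close> sends an
  infinite cost to 0.\<close>

lemma P_p_finite_cost:
  assumes "\<mu> \<in> P_p p x0" "\<nu> \<in> P_p p x0" "0 \<le> p"
  shows "\<exists>\<pi> \<in> couplings \<mu> \<nu>. transport_cost p \<pi> < \<infinity>"
proof -
  have [measurable_cong]: "sets \<mu> = sets borel" "sets \<nu> = sets borel"
    and "prob_space \<mu>" "prob_space \<nu>"
    and fin: "(\<integral>\<^sup>+x. ennreal (dist x x0 powr p) \<partial>\<mu>) < \<infinity>" "(\<integral>\<^sup>+x. ennreal (dist x x0 powr p) \<partial>\<nu>) < \<infinity>"
    using assms by (auto simp: P_p_def space_prob_algebra)
  interpret M: prob_space \<mu> by fact
  interpret N: prob_space \<nu> by fact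
  interpret pair_prob_space \<mu> \<nu> ..
  have s: "sets (\<mu> \<Otimes>\<^sub>M \<nu>) = sets (borel \<Otimes>\<^sub>M borel)" by (rule sets_pair_measure_cong) fact+
  have sp: "space \<mu> = UNIV" "space \<nu> = UNIV"
    using sets_eq_imp_space_eq[of \<mu> borel] sets_eq_imp_space_eq[of \<nu> borel]
      \<open>sets \<mu> = sets borel\<close> \<open>sets \<nu> = sets borel\<close> by auto
  have c: "\<mu> \<Otimes>\<^sub>M \<nu> \<in> couplings \<mu> \<nu>"
  proof (rule couplingI[OF s])
    fix A :: "'a set" assume A: "A \<in> sets borel"
    have "(\<integral>\<^sup>+z. indicator A (fst z) \<partial>(\<mu> \<Otimes>\<^sub>M \<nu>)) = (\<integral>\<^sup>+x. \<integral>\<^sup>+y. indicator A x \<partial>\<nu> \<partial>\<mu>)"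
      using A by (subst N.nn_integral_fst[symmetric]) auto
    then show "(\<integral>\<^sup>+z. indicator A (fst z) \<partial>(\<mu> \<Otimes>\<^sub>M \<nu>)) = emeasure \<mu> A"
      using A by (simp add: N.emeasure_space_1)
    have "(\<integral>\<^sup>+z. indicator A (snd z) \<partial>(\<mu> \<Otimes>\<^sub>M \<nu>)) = (\<integral>\<^sup>+x. \<integral>\<^sup>+y. indicator A y \<partial>\<nu> \<partial>\<mu>)"
      using A by (subst N.nn_integral_fst[symmetric]) auto
    then show "(\<integral>\<^sup>+z. indicator A (snd z) \<partial>(\<mu> \<Otimes>\<^sub>M \<nu>)) = emeasure \<nu> A"
      using A by (simp add: M.emeasure_space_1)
  qed (use assms in \<open>auto simp: P_p_def\<close>)
  have "transport_cost p (\<mu> \<Otimes>\<^sub>M \<nu>) \<le>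
      (\<integral>\<^sup>+z. ennreal (2 powr p) * (ennreal (dist (fst z) x0 powr p) + ennreal (dist (snd z) x0 powr p)) \<partial>(\<mu> \<Otimes>\<^sub>M \<nu>))"
    unfolding transport_cost_def
  proof (rule nn_integral_mono)
    fix z :: "'a \<times> 'a"
    have "dist (fst z) (snd z) powr p \<le> (dist (fst z) x0 + dist (snd z) x0) powr p"
      using assms by (intro powr_mono2 dist_triangle2) auto
    also have "\<dots> \<le> 2 powr p * (dist (fst z) x0 powr p + dist (snd z) x0 powr p)"
      using assms by (intro powr_add_le) auto
    finally show "ennreal (dist (fst z) (snd z) powr p) \<le>
        ennreal (2 powr p) * (ennreal (dist (fst z) x0 powr p) + ennreal (dist (snd z) x0 powr p))"
      by (simp flip: ennreal_plus ennreal_mult add: ennreal_leI)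
  qed
  also have "\<dots> = ennreal (2 powr p) * ((\<integral>\<^sup>+x. ennreal (dist x x0 powr p) \<partial>\<mu>) + (\<integral>\<^sup>+x. ennreal (dist x x0 powr p) \<partial>\<nu>))"
    using coupling_nn_integral[OF c, of "\<lambda>x. ennreal (dist x x0 powr p)"]
    by (simp add: nn_integral_cmult nn_integral_add)
  also have "\<dots> < \<infinity>" using fin by (simp add: ennreal_mult_less_top)
  finally show ?thesis using c by blast
qed

lemma coupling_of_wasserstein_less:
  assumes "\<mu> \<in> P_p p x0" "\<nu> \<in> P_p p x0" "1 \<le> p" "wasserstein p \<mu> \<nu> < A"
  shows "\<exists>\<pi> \<in> couplings \<mu> \<nu>. transport_cost p \<pi> \<le> ennreal (A powr p)"
proof -
  let ?I = "INF \<pi> \<in> couplings \<mu> \<nu>. transport_cost p \<pi>"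
  obtain \<pi> where \<pi>: "\<pi> \<in> couplings \<mu> \<nu>" "transport_cost p \<pi> < \<infinity>"
    using P_p_finite_cost[OF assms(1,2)] assms(3) by auto
  then have "?I < \<infinity>" using INF_lower[OF \<pi>(1), of "transport_cost p"] by (simp add: order_le_less_trans)
  then have I: "?I = ennreal (enn2real ?I)" by simp
  have "enn2real ?I powr (1 / p) < A" using assms(4) by (simp add: wasserstein_def transport_cost_def)
  then have "(enn2real ?I powr (1 / p)) powr p < A powr p"
    using assms(3) by (intro powr_less_mono2) auto
  then have "enn2real ?I < A powr p" using assms(3) by (simp add: powr_powr)
  then have "?I < ennreal (A powr p)" using ennreal_lessI[of "A powr p"] I
    by (metis enn2real_nonneg ennreal_less_iff)
  then show ?thesis by (metis (no_types, lifting) INF_less_iff less_imp_le)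
qed


text \<open>A point goes to the first element of a dense sequence within distance \<open>e / 2\<close>.\<close>

lemma small_cells:
  assumes "0 < (e::real)"
  obtains cell :: "'x::polish_space \<Rightarrow> nat" where "cell \<in> borel \<rightarrow>\<^sub>M count_space UNIV"
    "\<And>y z. cell y = cell z \<Longrightarrow> dist y z < e"
proof -
  obtain D :: "'x set" where D: "countable D" "\<And>X. open X \<Longrightarrow> X \<noteq> {} \<Longrightarrow> \<exists>d\<in>D. d \<in> X"
    using countable_dense_setE by blast
  have "D \<noteq> {}" using D(2)[of UNIV] by auto
  define q where "q = from_nat_into D"
  have near: "\<exists>n. dist y (q n) < e / 2" for y
  proof -
    obtain d where "d \<in> D" "d \<in> ball y (e / 2)" using D(2)[of "ball y (e / 2)"] assms by auto
    then show ?thesis using from_nat_into_surj[OF D(1)] by (auto simp: q_def)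
  qed
  define cell where "cell y = (LEAST n. dist y (q n) < e / 2)" for y
  have cell: "dist y (q (cell y)) < e / 2" for y
    unfolding cell_def by (rule LeastI_ex[OF near])
  show thesis
  proof (rule that[of cell])
    show "cell \<in> borel \<rightarrow>\<^sub>M count_space UNIV" unfolding cell_def by measurable
    show "dist y z < e" if "cell y = cell z" for y z
      using cell[of y] cell[of z] dist_triangle_half_r[of "q (cell y)" y e z] that
      by (simp add: dist_commute)
  qed
qed

text \<open>Two couplings with the common marginal \<open>\<nu>\<close> are composed along a countable partition into cells of
  diameter less than \<open>e\<close>: from \<open>(x, y)\<close> drawn with \<open>\<pi>1\<close>, draw \<open>(y', z)\<close> from \<open>\<pi>2\<close> conditioned on
  \<open>y'\<close> lying in the cell of \<open>y\<close>. Since a cell has the same mass under both couplings, \<open>(y', z)\<close> has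
  law \<open>\<pi>2\<close>, so that \<open>(x, z)\<close> couples \<open>\<mu>\<close> and \<open>\<rho>\<close>, while \<open>y\<close> and \<open>y'\<close> differ by less than \<open>e\<close>.\<close>

lemma approximate_gluing:
  fixes \<mu> \<nu> \<rho> :: "'x::polish_space measure" and h1 h2 c :: "'x \<times> 'x \<Rightarrow> ennreal"
  assumes \<pi>1: "\<pi>1 \<in> couplings \<mu> \<nu>" and \<pi>2: "\<pi>2 \<in> couplings \<nu> \<rho>" and e: "0 < (e::real)"
    and \<mu>: "\<mu> \<in> space (prob_algebra borel)" and \<nu>: "\<nu> \<in> space (prob_algebra borel)"
    and \<rho>: "\<rho> \<in> space (prob_algebra borel)"
    and [measurable]: "h1 \<in> borel_measurable (borel \<Otimes>\<^sub>M borel)" "h2 \<in> borel_measurable (borel \<Otimes>\<^sub>M borel)"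
      "c \<in> borel_measurable (borel \<Otimes>\<^sub>M borel)"
    and le: "\<And>x y y' z. dist y y' < e \<Longrightarrow> c (x, z) \<le> h1 (x, y) + h2 (y', z)"
  shows "\<exists>\<gamma> \<in> couplings \<mu> \<rho>. (\<integral>\<^sup>+z. c z \<partial>\<gamma>) \<le> (\<integral>\<^sup>+z. h1 z \<partial>\<pi>1) + (\<integral>\<^sup>+z. h2 z \<partial>\<pi>2)"
proof -
  let ?bb = "borel \<Otimes>\<^sub>M borel :: ('x \<times> 'x) measure"
  obtain cell :: "'x \<Rightarrow> nat" where cell[measurable]: "cell \<in> borel \<rightarrow>\<^sub>M count_space UNIV"
    and near: "\<And>y z. cell y = cell z \<Longrightarrow> dist y z < e"
    by (rule small_cells[OF e]) (rule that)
  have s1[measurable_cong]: "sets \<pi>1 = sets ?bb" and s2[measurable_cong]: "sets \<pi>2 = sets ?bb"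
    and p1: "prob_space \<pi>1" and p2: "prob_space \<pi>2"
    using \<pi>1 \<pi>2 by (simp_all add: couplings_iff)
  have s\<nu>[measurable_cong]: "sets \<nu> = sets borel" using \<nu> by (simp add: space_prob_algebra)
  have cell_ind[measurable]: "(\<lambda>y. indicator {n} (cell y) :: ennreal) \<in> borel_measurable borel" for n
    by (rule measurable_compose[OF cell]) simp
  define B where "B n = {\<omega> \<in> space \<pi>2. cell (fst \<omega>) = n}" for n
  have B[measurable]: "B n \<in> sets ?bb" for n unfolding B_def s2[symmetric] by measurable
  define a where "a n = emeasure \<pi>2 (B n)" for n
  have a_\<nu>: "(\<integral>\<^sup>+y. indicator {n} (cell y) \<partial>\<nu>) = a n" for n
  proof -
    have "(\<integral>\<^sup>+y. indicator {n} (cell y) \<partial>\<nu>) = (\<integral>\<^sup>+\<omega>. indicator {n} (cell (fst \<omega>)) \<partial>\<pi>2)"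
      by (rule coupling_nn_integral(1)[OF \<pi>2 cell_ind, symmetric])
    also have "\<dots> = (\<integral>\<^sup>+\<omega>. indicator (B n) \<omega> \<partial>\<pi>2)"
      by (rule nn_integral_cong) (auto simp: B_def split: split_indicator)
    finally show ?thesis by (simp add: a_def s2)
  qed
  have a_fin: "a n \<noteq> \<infinity>" for n
    using prob_space.measure_le_1[OF p2, of "B n"] by (auto simp: a_def top_unique)
  \<comment> \<open>On null cells \<open>\<kappa>\<close> takes an arbitrary value that is a probability measure.\<close>
  define \<kappa> where "\<kappa> n = (if a n = 0 then \<pi>2 else uniform_measure \<pi>2 (B n))" for n
  have \<kappa>_prob: "\<kappa> n \<in> space (prob_algebra ?bb)" for n
    using p2 s2 a_fin[of n]
    by (auto simp: \<kappa>_def space_prob_algebra a_def intro!: prob_space_uniform_measure)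
  have \<kappa>[measurable]: "\<kappa> \<in> count_space UNIV \<rightarrow>\<^sub>M prob_algebra ?bb"
    using \<kappa>_prob by (auto simp: measurable_count_space_eq1)
  have \<kappa>_sets: "sets (\<kappa> n) = sets ?bb" for n using \<kappa>_prob[of n] by (simp add: space_prob_algebra)
  have disint: "(\<integral>\<^sup>+y. \<integral>\<^sup>+\<omega>. g \<omega> \<partial>\<kappa> (cell y) \<partial>\<nu>) = (\<integral>\<^sup>+\<omega>. g \<omega> \<partial>\<pi>2)"
    if [measurable]: "g \<in> borel_measurable ?bb" for g
  proof -
    let ?G = "\<lambda>n. \<integral>\<^sup>+\<omega>. g \<omega> \<partial>\<kappa> n"
    have single: "(\<Sum>n. F n * indicator {n} m) = F m" for F :: "nat \<Rightarrow> ennreal" and m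
      by (subst suminf_finite[of "{m}"]) auto
    have "(\<integral>\<^sup>+y. ?G (cell y) \<partial>\<nu>) = (\<integral>\<^sup>+y. (\<Sum>n. ?G n * indicator {n} (cell y)) \<partial>\<nu>)"
      by (simp add: single)
    also have "\<dots> = (\<Sum>n. ?G n * a n)"
      by (subst nn_integral_suminf) (auto simp: nn_integral_cmult a_\<nu>)
    also have "\<dots> = (\<Sum>n. \<integral>\<^sup>+\<omega>. g \<omega> * indicator (B n) \<omega> \<partial>\<pi>2)"
    proof (rule arg_cong[where f = suminf], rule ext)
      fix n
      show "?G n * a n = (\<integral>\<^sup>+\<omega>. g \<omega> * indicator (B n) \<omega> \<partial>\<pi>2)"
      proof (cases "a n = 0")
        case True
        then have "B n \<in> null_sets \<pi>2" by (intro null_setsI) (auto simp: a_def s2)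
        then have "AE \<omega> in \<pi>2. \<omega> \<notin> B n" by (rule AE_not_in)
        then have "(\<integral>\<^sup>+\<omega>. g \<omega> * indicator (B n) \<omega> \<partial>\<pi>2) = (\<integral>\<^sup>+\<omega>. 0 \<partial>\<pi>2)"
          by (intro nn_integral_cong_AE) auto
        then show ?thesis using True by simp
      next
        case False
        then show ?thesis using a_fin[of n]
          by (simp add: \<kappa>_def nn_integral_uniform_measure s2 a_def[symmetric] ennreal_divide_times
              ennreal_times_divide[symmetric] divide_mult_eq ennreal_divide_self less_top)
      qed
    qed
    also have "\<dots> = (\<integral>\<^sup>+\<omega>. (\<Sum>n. g \<omega> * indicator (B n) \<omega>) \<partial>\<pi>2)"
      by (subst nn_integral_suminf) auto
    also have "\<dots> = (\<integral>\<^sup>+\<omega>. g \<omega> \<partial>\<pi>2)"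
    proof (rule nn_integral_cong)
      fix \<omega> assume \<omega>: "\<omega> \<in> space \<pi>2"
      have "(\<Sum>n. g \<omega> * indicator (B n) \<omega>) = (\<Sum>n. g \<omega> * indicator {n} (cell (fst \<omega>)))"
        by (intro arg_cong[where f = suminf] ext) (use \<omega> in \<open>auto simp: B_def split: split_indicator\<close>)
      also have "\<dots> = g \<omega>" by (rule single)
      finally show "(\<Sum>n. g \<omega> * indicator (B n) \<omega>) = g \<omega>" .
    qed
    finally show ?thesis .
  qed
  define N where "N \<omega> = distr (\<kappa> (cell (snd \<omega>))) ?bb (\<lambda>\<omega>'. (fst \<omega>, snd \<omega>'))" for \<omega> :: "'x \<times> 'x"
  have N[measurable]: "N \<in> ?bb \<rightarrow>\<^sub>M prob_algebra ?bb" unfolding N_def by measurable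
  define \<gamma> where "\<gamma> = \<pi>1 \<bind> N"
  have \<gamma>_int: "(\<integral>\<^sup>+z. f z \<partial>\<gamma>) = (\<integral>\<^sup>+\<omega>. \<integral>\<^sup>+\<omega>'. f (fst \<omega>, snd \<omega>') \<partial>\<kappa> (cell (snd \<omega>)) \<partial>\<pi>1)"
    if [measurable]: "f \<in> borel_measurable ?bb" for f
  proof -
    have "N \<in> \<pi>1 \<rightarrow>\<^sub>M subprob_algebra ?bb" by (intro measurable_prob_algebraD) measurable
    then have "(\<integral>\<^sup>+z. f z \<partial>\<gamma>) = (\<integral>\<^sup>+\<omega>. \<integral>\<^sup>+z. f z \<partial>N \<omega> \<partial>\<pi>1)"
      unfolding \<gamma>_def by (rule nn_integral_bind[rotated]) measurable
    also have "\<dots> = (\<integral>\<^sup>+\<omega>. \<integral>\<^sup>+\<omega>'. f (fst \<omega>, snd \<omega>') \<partial>\<kappa> (cell (snd \<omega>)) \<partial>\<pi>1)"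
      unfolding N_def by (intro nn_integral_cong nn_integral_distr) (auto simp: \<kappa>_sets cong: measurable_cong_sets)
    finally show ?thesis .
  qed
  have \<kappa>_1: "emeasure (\<kappa> n) (space (\<kappa> n)) = 1" for n
    using \<kappa>_prob[of n] by (simp add: space_prob_algebra prob_space.emeasure_space_1)
  have snd_int: "(\<integral>\<^sup>+\<omega>. \<integral>\<^sup>+\<omega>'. g \<omega>' \<partial>\<kappa> (cell (snd \<omega>)) \<partial>\<pi>1) = (\<integral>\<^sup>+\<omega>. g \<omega> \<partial>\<pi>2)"
    if [measurable]: "g \<in> borel_measurable ?bb" for g
  proof -
    have [measurable]: "\<kappa> \<in> count_space UNIV \<rightarrow>\<^sub>M subprob_algebra ?bb"
      by (rule measurable_prob_algebraD) measurable
    have "(\<lambda>y. \<integral>\<^sup>+\<omega>'. g \<omega>' \<partial>\<kappa> (cell y)) \<in> borel_measurable borel" by measurable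
    from coupling_nn_integral(2)[OF \<pi>1 this] show ?thesis by (simp add: disint)
  qed
  have "\<gamma> \<in> couplings \<mu> \<rho>"
  proof (rule couplingI[OF _ \<mu> \<rho>])
    show "sets \<gamma> = sets ?bb"
      unfolding \<gamma>_def using p1 s1 N by (intro sets_bind') (auto simp: space_prob_algebra)
    fix A :: "'x set" assume A[measurable]: "A \<in> sets borel"
    have "(\<integral>\<^sup>+z. indicator A (fst z) \<partial>\<gamma>) = (\<integral>\<^sup>+\<omega>. indicator A (fst \<omega>) \<partial>\<pi>1)"
      by (subst \<gamma>_int) (auto simp: \<kappa>_1)
    also have "\<dots> = (\<integral>\<^sup>+x. indicator A x \<partial>\<mu>)" by (rule coupling_nn_integral(1)[OF \<pi>1]) auto
    finally show "(\<integral>\<^sup>+z. indicator A (fst z) \<partial>\<gamma>) = emeasure \<mu> A"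
      using \<mu> by (simp add: space_prob_algebra)
    have "(\<integral>\<^sup>+z. indicator A (snd z) \<partial>\<gamma>) = (\<integral>\<^sup>+\<omega>. indicator A (snd \<omega>) \<partial>\<pi>2)"
      by (subst \<gamma>_int) (auto simp: snd_int)
    also have "\<dots> = (\<integral>\<^sup>+x. indicator A x \<partial>\<rho>)" by (rule coupling_nn_integral(2)[OF \<pi>2]) auto
    finally show "(\<integral>\<^sup>+z. indicator A (snd z) \<partial>\<gamma>) = emeasure \<rho> A"
      using \<rho> by (simp add: space_prob_algebra)
  qed
  moreover have "(\<integral>\<^sup>+z. c z \<partial>\<gamma>) \<le> (\<integral>\<^sup>+z. h1 z \<partial>\<pi>1) + (\<integral>\<^sup>+z. h2 z \<partial>\<pi>2)"
  proof -
    have ae\<nu>: "AE y in \<nu>. a (cell y) \<noteq> 0"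
    proof -
      have "AE y in \<nu>. a n = 0 \<longrightarrow> cell y \<noteq> n" for n
      proof (cases "a n = 0")
        case True
        then have "(\<integral>\<^sup>+y. indicator {n} (cell y) \<partial>\<nu>) = 0" by (simp add: a_\<nu>)
        moreover have "(\<lambda>y. indicator {n} (cell y) :: ennreal) \<in> borel_measurable \<nu>" by measurable
        ultimately have "AE y in \<nu>. indicator {n} (cell y) = (0 :: ennreal)"
          using nn_integral_0_iff_AE by blast
        then show ?thesis by eventually_elim (auto split: split_indicator_asm)
      qed simp
      then have "AE y in \<nu>. \<forall>n. a n = 0 \<longrightarrow> cell y \<noteq> n" by (simp add: AE_all_countable)
      then show ?thesis by eventually_elim blast
    qed
    have d: "distr \<pi>1 borel snd = \<nu>" using \<pi>1 by (simp add: couplings_iff)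
    have "AE y in distr \<pi>1 borel snd. a (cell y) \<noteq> 0" unfolding d by (rule ae\<nu>)
    moreover have "snd \<in> \<pi>1 \<rightarrow>\<^sub>M borel" by measurable
    ultimately have ae: "AE \<omega> in \<pi>1. a (cell (snd \<omega>)) \<noteq> 0"
      using AE_distrD by blast
    have "(\<integral>\<^sup>+z. c z \<partial>\<gamma>) = (\<integral>\<^sup>+\<omega>. \<integral>\<^sup>+\<omega>'. c (fst \<omega>, snd \<omega>') \<partial>\<kappa> (cell (snd \<omega>)) \<partial>\<pi>1)"
      by (rule \<gamma>_int) measurable
    also have "\<dots> \<le> (\<integral>\<^sup>+\<omega>. h1 \<omega> + (\<integral>\<^sup>+\<omega>'. h2 \<omega>' \<partial>\<kappa> (cell (snd \<omega>))) \<partial>\<pi>1)"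
    proof (rule nn_integral_mono_AE, use ae in eventually_elim)
      fix \<omega> :: "'x \<times> 'x" assume a: "a (cell (snd \<omega>)) \<noteq> 0"
      let ?n = "cell (snd \<omega>)"
      have "AE \<omega>' in \<kappa> ?n. cell (fst \<omega>') = ?n"
      proof -
        have "\<kappa> ?n = uniform_measure \<pi>2 (B ?n)" using a by (simp add: \<kappa>_def)
        then show ?thesis by (rule ssubst) (rule AE_uniform_measureI, simp add: s2 B, simp add: B_def)
      qed
      then have "(\<integral>\<^sup>+\<omega>'. c (fst \<omega>, snd \<omega>') \<partial>\<kappa> ?n) \<le> (\<integral>\<^sup>+\<omega>'. h1 \<omega> + h2 \<omega>' \<partial>\<kappa> ?n)"
      proof (intro nn_integral_mono_AE, eventually_elim)
        fix \<omega>' :: "'x \<times> 'x" assume "cell (fst \<omega>') = ?n"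
        then have "dist (snd \<omega>) (fst \<omega>') < e" by (intro near) simp
        then show "c (fst \<omega>, snd \<omega>') \<le> h1 \<omega> + h2 \<omega>'"
          using le[of "snd \<omega>" "fst \<omega>'" "fst \<omega>" "snd \<omega>'"] by simp
      qed
      also have "\<dots> = h1 \<omega> + (\<integral>\<^sup>+\<omega>'. h2 \<omega>' \<partial>\<kappa> ?n)"
        by (subst nn_integral_add) (auto simp: \<kappa>_1 \<kappa>_sets cong: measurable_cong_sets)
      finally show "(\<integral>\<^sup>+\<omega>'. c (fst \<omega>, snd \<omega>') \<partial>\<kappa> ?n) \<le> h1 \<omega> + (\<integral>\<^sup>+\<omega>'. h2 \<omega>' \<partial>\<kappa> ?n)" .
    qed
    also have "\<dots> = (\<integral>\<^sup>+z. h1 z \<partial>\<pi>1) + (\<integral>\<^sup>+z. h2 z \<partial>\<pi>2)"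
    proof -
      have [measurable]: "\<kappa> \<in> count_space UNIV \<rightarrow>\<^sub>M subprob_algebra ?bb"
        by (rule measurable_prob_algebraD) measurable
      have "(\<lambda>\<omega>. \<integral>\<^sup>+\<omega>'. h2 \<omega>' \<partial>\<kappa> (cell (snd \<omega>))) \<in> borel_measurable \<pi>1" by measurable
      then show ?thesis by (subst nn_integral_add) (auto simp: snd_int)
    qed
    finally show ?thesis .
  qed
  ultimately show ?thesis by blast
qed

section \<open>The Wasserstein metric and total variation\<close>

lemma couplings_swap:
  assumes "\<pi> \<in> couplings \<mu> (\<nu> :: 'x::polish_space measure)"
  shows "\<exists>\<pi>' \<in> couplings \<nu> \<mu>. transport_cost p \<pi>' = transport_cost p \<pi>"
proof
  have s[measurable_cong]: "sets \<pi> = sets (borel \<Otimes>\<^sub>M borel)" and "prob_space \<pi>"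
    and m: "distr \<pi> borel fst = \<mu>" "distr \<pi> borel snd = \<nu>"
    using assms by (auto simp: couplings_iff)
  have [measurable]: "prod.swap \<in> \<pi> \<rightarrow>\<^sub>M borel \<Otimes>\<^sub>M (borel :: 'x measure)"
    unfolding prod.swap_def by measurable
  let ?\<pi>' = "distr \<pi> (borel \<Otimes>\<^sub>M borel) prod.swap"
  show "?\<pi>' \<in> couplings \<nu> \<mu>"
    using \<open>prob_space \<pi>\<close> by (auto simp: couplings_iff m[symmetric] distr_distr o_def intro: prob_space.prob_space_distr)
  show "transport_cost p ?\<pi>' = transport_cost p \<pi>"
    unfolding transport_cost_def by (subst nn_integral_distr) (auto simp: dist_commute)
qed

lemma wasserstein_commute: "wasserstein p \<mu> \<nu> = wasserstein p \<nu> (\<mu> :: 'x::polish_space measure)"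
proof -
  have "(INF \<pi> \<in> couplings \<mu> \<nu>. transport_cost p \<pi>) \<le> (INF \<pi> \<in> couplings \<nu> \<mu>. transport_cost p \<pi>)"
    for \<mu> \<nu> :: "'x measure"
    by (intro INF_mono) (metis couplings_swap order_refl)
  then have "(INF \<pi> \<in> couplings \<mu> \<nu>. transport_cost p \<pi>) = (INF \<pi> \<in> couplings \<nu> \<mu>. transport_cost p \<pi>)"
    by (intro antisym)
  then show ?thesis by (simp add: wasserstein_def transport_cost_def)
qed

lemma wasserstein_refl:
  assumes "\<mu> \<in> P_p p x0" "1 \<le> p"
  shows "wasserstein p \<mu> \<mu> = 0"
proof -
  have s[measurable_cong]: "sets \<mu> = sets borel" and \<mu>: "\<mu> \<in> space (prob_algebra borel)"
    using assms by (auto simp: P_p_def space_prob_algebra)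
  have d[measurable]: "(\<lambda>x. (x, x)) \<in> \<mu> \<rightarrow>\<^sub>M borel \<Otimes>\<^sub>M borel" by measurable
  have "distr \<mu> (borel \<Otimes>\<^sub>M borel) (\<lambda>x. (x, x)) \<in> couplings \<mu> \<mu>"
    by (rule couplingI[OF _ \<mu> \<mu>]) (auto simp: nn_integral_distr s)
  moreover have "transport_cost p (distr \<mu> (borel \<Otimes>\<^sub>M borel) (\<lambda>x. (x, x))) = 0"
    unfolding transport_cost_def by (subst nn_integral_distr) auto
  ultimately have "wasserstein p \<mu> \<mu> \<le> 0" using assms(2) by (intro wasserstein_le) auto
  then show ?thesis by (simp add: wasserstein_def antisym)
qed

text \<open>Mass in \<open>F\<close> either stays within distance \<open>\<delta>\<close> or is moved by more than \<open>\<delta>\<close>, and Markov's inequality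
  bounds the latter by \<open>\<delta>\<^sup>p \<le> \<delta>\<close>; this is where the exponent 2 in the cost bound is used.\<close>

lemma emeasure_closed_le_neighbourhood:
  assumes \<pi>: "\<pi> \<in> couplings \<mu> \<nu>" "transport_cost p \<pi> \<le> ennreal ((\<delta> ^ 2) powr p)"
    and \<delta>: "0 < \<delta>" "\<delta> \<le> 1" and p: "1 \<le> p" and F: "closed F" "F \<noteq> {}"
  shows "emeasure \<mu> F \<le> emeasure \<nu> {y. infdist y F \<le> \<delta>} + ennreal (\<delta> :: real)"
proof -
  have s[measurable_cong]: "sets \<pi> = sets (borel \<Otimes>\<^sub>M borel)" using \<pi> by (simp add: couplings_iff)
  have [measurable]: "F \<in> sets borel" "{y. infdist y F \<le> \<delta>} \<in> sets borel"
    using F by (auto intro!: borel_closed closed_Collect_le continuous_intros)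
  have sets: "sets \<mu> = sets borel" "sets \<nu> = sets borel" using \<pi> by (auto simp: couplings_iff)
  have "emeasure \<mu> F = (\<integral>\<^sup>+z. indicator F (fst z) \<partial>\<pi>)"
    by (subst coupling_nn_integral(1)[OF \<pi>(1)]) (auto simp: sets)
  also have "\<dots> \<le> (\<integral>\<^sup>+z. indicator {y. infdist y F \<le> \<delta>} (snd z) +
      ennreal (1 / \<delta> powr p) * ennreal (dist (fst z) (snd z) powr p) \<partial>\<pi>)"
  proof (rule nn_integral_mono)
    fix z
    show "indicator F (fst z) \<le> indicator {y. infdist y F \<le> \<delta>} (snd z) +
      ennreal (1 / \<delta> powr p) * ennreal (dist (fst z) (snd z) powr p)"
    proof (cases "fst z \<in> F \<and> \<delta> < infdist (snd z) F")
      case True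
      then have "\<delta> < dist (fst z) (snd z)"
        using infdist_le[of "fst z" F "snd z"] by (simp add: dist_commute)
      then have "\<delta> powr p \<le> dist (fst z) (snd z) powr p" using \<delta> p by (intro powr_mono2) auto
      then have "1 \<le> 1 / \<delta> powr p * dist (fst z) (snd z) powr p" using \<delta> by (simp add: field_simps)
      then have "1 \<le> ennreal (1 / \<delta> powr p) * ennreal (dist (fst z) (snd z) powr p)"
        by (simp flip: ennreal_mult ennreal_1 add: ennreal_leI del: ennreal_1)
      then show ?thesis using True by simp
    qed (auto split: split_indicator)
  qed
  also have "\<dots> = (\<integral>\<^sup>+z. indicator {y. infdist y F \<le> \<delta>} (snd z) \<partial>\<pi>) + ennreal (1 / \<delta> powr p) * transport_cost p \<pi>"
    by (simp add: nn_integral_add nn_integral_cmult transport_cost_def)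
  also have "(\<integral>\<^sup>+z. indicator {y. infdist y F \<le> \<delta>} (snd z) \<partial>\<pi>) = emeasure \<nu> {y. infdist y F \<le> \<delta>}"
    by (subst coupling_nn_integral(2)[OF \<pi>(1)]) (auto simp: sets)
  also have "ennreal (1 / \<delta> powr p) * transport_cost p \<pi> \<le> ennreal (1 / \<delta> powr p) * ennreal ((\<delta> ^ 2) powr p)"
    by (intro mult_left_mono \<pi>(2)) simp
  also have "\<dots> = ennreal (\<delta> powr p)"
    using \<delta> by (simp flip: ennreal_mult add: power2_eq_square powr_mult)
  also have "\<dots> \<le> ennreal \<delta>"
    using powr_mono'[of 1 p \<delta>] \<delta> p by (intro ennreal_leI) simp
  finally show ?thesis by (simp add: add_left_mono)
qed

lemma emeasure_closed_le_of_wasserstein_0: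
  assumes "\<mu> \<in> P_p p x0" "\<nu> \<in> P_p p x0" "1 \<le> p" "wasserstein p \<mu> \<nu> = 0" and F: "closed F"
  shows "emeasure \<mu> F \<le> emeasure \<nu> F"
proof (cases "F = {}")
  case False
  let ?N = "\<lambda>k. {y. infdist y F \<le> 1 / real (Suc k)}"
  have \<nu>: "sets \<nu> = sets borel" "prob_space \<nu>" using assms by (auto simp: P_p_def space_prob_algebra)
  interpret N: prob_space \<nu> by fact
  have closed_N: "closed (?N k)" for k by (intro closed_Collect_le continuous_intros)
  have "emeasure \<mu> F \<le> emeasure \<nu> (?N k) + ennreal (1 / real (Suc k))" for k
  proof -
    have "\<exists>\<pi> \<in> couplings \<mu> \<nu>. transport_cost p \<pi> \<le> ennreal (((1 / real (Suc k)) ^ 2) powr p)"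
      by (rule coupling_of_wasserstein_less[OF assms(1-3)]) (simp add: assms(4))
    then show ?thesis
      using emeasure_closed_le_neighbourhood[OF _ _ _ _ assms(3) F False, of _ _ _ "1 / real (Suc k)"] by auto
  qed
  moreover have "(\<lambda>k. emeasure \<nu> (?N k) + ennreal (1 / real (Suc k))) \<longlonglongrightarrow> emeasure \<nu> (\<Inter>k. ?N k) + ennreal 0"
  proof (intro tendsto_add tendsto_ennrealI)
    show "(\<lambda>k. 1 / real (Suc k)) \<longlonglongrightarrow> 0"
      using LIMSEQ_inverse_real_of_nat by (simp add: inverse_eq_divide)
    show "(\<lambda>k. emeasure \<nu> (?N k)) \<longlonglongrightarrow> emeasure \<nu> (\<Inter>k. ?N k)"
    proof (rule Lim_emeasure_decseq)
      show "range ?N \<subseteq> sets \<nu>" using closed_N by (auto simp: \<nu>(1) intro!: borel_closed)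
      show "decseq ?N"
      proof (intro decseq_SucI subsetI)
        fix k y assume "y \<in> ?N (Suc k)"
        moreover have "1 / real (Suc (Suc k)) \<le> 1 / real (Suc k)" by (intro frac_le) auto
        ultimately show "y \<in> ?N k" by simp
      qed
    qed auto
  qed
  moreover have "(\<Inter>k. ?N k) = F"
  proof
    show "(\<Inter>k. ?N k) \<subseteq> F"
    proof
      fix y assume "y \<in> (\<Inter>k. ?N k)"
      then have le: "infdist y F \<le> 1 / real (Suc k)" for k by auto
      have "infdist y F \<le> 0"
        by (rule LIMSEQ_le_const[OF LIMSEQ_inverse_real_of_nat]) (use le in \<open>auto simp: inverse_eq_divide\<close>)
      then show "y \<in> F"
        using in_closed_iff_infdist_zero[OF F False, of y] infdist_nonneg[of y F] by simp
    qed
  qed auto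
  ultimately show ?thesis by (intro LIMSEQ_le_const) auto
qed simp

lemma eq_of_wasserstein_0:
  assumes "\<mu> \<in> P_p p x0" "\<nu> \<in> P_p p x0" "1 \<le> p" "wasserstein p \<mu> \<nu> = 0"
  shows "\<mu> = \<nu>"
proof (rule measure_eqI_generator_eq[where E = "Collect closed" and \<Omega> = UNIV and A = "\<lambda>_. UNIV"])
  have s: "sets \<mu> = sets borel" "sets \<nu> = sets borel" and "prob_space \<mu>"
    using assms by (auto simp: P_p_def space_prob_algebra)
  show "sets \<mu> = sigma_sets UNIV (Collect closed)" "sets \<nu> = sigma_sets UNIV (Collect closed)"
    using s by (auto simp: borel_eq_closed)
  show "emeasure \<mu> F = emeasure \<nu> F" if "F \<in> Collect closed" for F
    using emeasure_closed_le_of_wasserstein_0[OF assms] assms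
      emeasure_closed_le_of_wasserstein_0[OF assms(2,1,3)] that wasserstein_commute[of p \<mu> \<nu>]
    by (intro antisym) auto
  show "emeasure \<mu> UNIV \<noteq> \<infinity>"
    using \<open>prob_space \<mu>\<close> sets_eq_imp_space_eq[OF s(1)] prob_space.emeasure_space_1 by fastforce
qed (auto simp: Int_stable_def)

text \<open>With \<open>A\<close> and \<open>B\<close> slightly above the two distances, the weights of \<open>minkowski_weights\<close> turn
  the costs of the glued couplings into the bound \<open>(A + B + e)\<^sup>p\<close>.\<close>

lemma wasserstein_triangle:
  assumes "\<mu> \<in> P_p p x0" "\<nu> \<in> P_p p x0" "\<rho> \<in> P_p p x0" "1 \<le> p"
  shows "wasserstein p \<mu> \<rho> \<le> wasserstein p \<mu> \<nu> + wasserstein p \<nu> \<rho>"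
proof (rule field_le_epsilon)
  fix \<epsilon> :: real assume "0 < \<epsilon>"
  define e where "e = \<epsilon> / 3"
  have e: "0 < e" using \<open>0 < \<epsilon>\<close> by (simp add: e_def)
  define A where "A = wasserstein p \<mu> \<nu> + e"
  define B where "B = wasserstein p \<nu> \<rho> + e"
  have AB: "0 < A" "0 < B" using e by (auto simp: A_def B_def wasserstein_def intro: add_nonneg_pos)
  obtain \<pi>1 where \<pi>1: "\<pi>1 \<in> couplings \<mu> \<nu>" "transport_cost p \<pi>1 \<le> ennreal (A powr p)"
    using coupling_of_wasserstein_less[OF assms(1,2,4), of A] e by (auto simp: A_def)
  obtain \<pi>2 where \<pi>2: "\<pi>2 \<in> couplings \<nu> \<rho>" "transport_cost p \<pi>2 \<le> ennreal (B powr p)"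
    using coupling_of_wasserstein_less[OF assms(2,3,4), of B] e by (auto simp: B_def)
  obtain k1 k2 k3 where k: "0 \<le> k1" "0 \<le> k2" "0 \<le> k3"
    and le: "\<And>a b. 0 \<le> a \<Longrightarrow> 0 \<le> b \<Longrightarrow> (a + b + e) powr p \<le> k1 * a powr p + k2 * b powr p + k3"
    and eq: "k1 * A powr p + k2 * B powr p + k3 = (A + B + e) powr p"
    by (rule minkowski_weights[OF assms(4) AB e]) (rule that)
  let ?d = "\<lambda>z :: 'a \<times> 'a. ennreal (dist (fst z) (snd z) powr p)"
  have prob: "\<mu> \<in> space (prob_algebra borel)" "\<nu> \<in> space (prob_algebra borel)" "\<rho> \<in> space (prob_algebra borel)"
    using assms by (auto simp: P_p_def)
  have "\<exists>\<gamma> \<in> couplings \<mu> \<rho>. (\<integral>\<^sup>+z. ?d z \<partial>\<gamma>) \<le>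
      (\<integral>\<^sup>+z. ennreal k1 * ?d z \<partial>\<pi>1) + (\<integral>\<^sup>+z. ennreal k2 * ?d z + ennreal k3 \<partial>\<pi>2)"
  proof (rule approximate_gluing[OF \<pi>1(1) \<pi>2(1) e prob])
    fix x y y' z :: 'a assume "dist y y' < e"
    then have "dist x z \<le> dist x y + dist y' z + e"
      using dist_triangle[of x z y] dist_triangle[of y z y'] by simp
    then have "dist x z powr p \<le> (dist x y + dist y' z + e) powr p"
      using assms(4) by (intro powr_mono2) auto
    also have "\<dots> \<le> k1 * dist x y powr p + k2 * dist y' z powr p + k3" by (rule le) auto
    finally have "ennreal (dist x z powr p) \<le> ennreal (k1 * dist x y powr p + (k2 * dist y' z powr p + k3))"
      by (intro ennreal_leI) simp
    also have "\<dots> = ennreal k1 * ennreal (dist x y powr p) + (ennreal k2 * ennreal (dist y' z powr p) + ennreal k3)"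
      using k by (simp add: ennreal_plus ennreal_mult)
    finally show "?d (x, z) \<le> ennreal k1 * ?d (x, y) + (ennreal k2 * ?d (y', z) + ennreal k3)" by simp
  qed measurable
  then obtain \<gamma> where \<gamma>: "\<gamma> \<in> couplings \<mu> \<rho>" "(\<integral>\<^sup>+z. ?d z \<partial>\<gamma>) \<le>
      (\<integral>\<^sup>+z. ennreal k1 * ?d z \<partial>\<pi>1) + (\<integral>\<^sup>+z. ennreal k2 * ?d z + ennreal k3 \<partial>\<pi>2)" by (elim bexE)
  have s[measurable_cong]: "sets \<pi>1 = sets (borel \<Otimes>\<^sub>M borel)" "sets \<pi>2 = sets (borel \<Otimes>\<^sub>M borel)" "prob_space \<pi>2"
    using \<pi>1 \<pi>2 by (auto simp: couplings_iff)
  note \<gamma>(2)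
  also have "(\<integral>\<^sup>+z. ennreal k1 * ?d z \<partial>\<pi>1) + (\<integral>\<^sup>+z. ennreal k2 * ?d z + ennreal k3 \<partial>\<pi>2) =
      ennreal k1 * transport_cost p \<pi>1 + (ennreal k2 * transport_cost p \<pi>2 + ennreal k3)"
    using prob_space.emeasure_space_1[OF s(3)]
    by (simp add: nn_integral_cmult nn_integral_add transport_cost_def)
  also have "\<dots> \<le> ennreal k1 * ennreal (A powr p) + (ennreal k2 * ennreal (B powr p) + ennreal k3)"
    by (intro add_mono mult_left_mono \<pi>1 \<pi>2) auto
  also have "\<dots> = ennreal (k1 * A powr p + k2 * B powr p + k3)"
    using k by (simp flip: ennreal_plus ennreal_mult add: add.assoc)
  also note eq
  finally have "wasserstein p \<mu> \<rho> \<le> A + B + e"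
    using AB e assms(4) by (intro wasserstein_le[OF \<gamma>(1)]) (auto simp: transport_cost_def)
  then show "wasserstein p \<mu> \<rho> \<le> wasserstein p \<mu> \<nu> + wasserstein p \<nu> \<rho> + \<epsilon>"
    by (simp add: A_def B_def e_def)
qed

lemma Metric_space_wasserstein:
  assumes "1 \<le> p"
  shows "Metric_space (P_p p x0) (wasserstein p)"
proof
  show "0 \<le> wasserstein p \<mu> \<nu>" for \<mu> \<nu> :: "'a measure" by (simp add: wasserstein_def)
  show "wasserstein p \<mu> \<nu> = wasserstein p \<nu> \<mu>" for \<mu> \<nu> :: "'a measure" by (rule wasserstein_commute)
  show "(wasserstein p \<mu> \<nu> = 0) = (\<mu> = \<nu>)" if "\<mu> \<in> P_p p x0" "\<nu> \<in> P_p p x0" for \<mu> \<nu>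
    using eq_of_wasserstein_0[OF that assms] wasserstein_refl[OF that(1) assms] by auto
qed (rule wasserstein_triangle[OF _ _ _ assms])

text \<open>The common part of \<open>\<mu>\<close> and \<open>\<nu>\<close>, which is \<open>\<nu>\<close> on \<open>Y\<close> and \<open>\<mu>\<close> off \<open>Y\<close>, is left in place, and the excess
  \<open>\<alpha>\<close> is moved to the deficit \<open>\<beta>\<close> independently. Both have mass \<open>m\<close>, hence the factor \<open>1 / m\<close>, which
  reads 0 if there is nothing to move.\<close>

lemma coupling_of_jordan_parts:
  fixes \<mu> \<nu> \<alpha> \<beta> :: "'x::polish_space measure"
  assumes \<mu>: "\<mu> \<in> space (prob_algebra borel)" and \<nu>: "\<nu> \<in> space (prob_algebra borel)"
    and [measurable]: "Y \<in> sets borel" and s[measurable_cong]: "sets \<alpha> = sets borel" "sets \<beta> = sets borel"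
    and sub: "subprob_space \<alpha>" "subprob_space \<beta>"
    and \<alpha>: "\<And>A. A \<in> sets borel \<Longrightarrow> emeasure \<alpha> A + emeasure \<nu> (A \<inter> Y) = emeasure \<mu> (A \<inter> Y)"
    and \<beta>: "\<And>A. A \<in> sets borel \<Longrightarrow> emeasure \<beta> A + emeasure \<mu> (A - Y) = emeasure \<nu> (A - Y)"
    and mass: "emeasure \<alpha> UNIV = ennreal m" "emeasure \<beta> UNIV = ennreal m" "0 \<le> m" and p: "0 \<le> p"
  shows "\<exists>\<pi> \<in> couplings \<mu> \<nu>. transport_cost p \<pi> \<le> ennreal (2 powr p) *
     ((\<integral>\<^sup>+x. ennreal (dist x x0 powr p) \<partial>\<alpha>) + (\<integral>\<^sup>+x. ennreal (dist x x0 powr p) \<partial>\<beta>))"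
proof -
  let ?bb = "borel \<Otimes>\<^sub>M borel :: ('x \<times> 'x) measure"
  have sp[measurable_cong]: "sets \<mu> = sets borel" "sets \<nu> = sets borel"
    and "prob_space \<mu>" "prob_space \<nu>" using \<mu> \<nu> by (auto simp: space_prob_algebra)
  interpret A: subprob_space \<alpha> by fact
  interpret B: subprob_space \<beta> by fact
  interpret AB: pair_subprob_space \<alpha> \<beta> ..
  have spaces: "space \<mu> = UNIV" "space \<nu> = UNIV" "space \<alpha> = UNIV" "space \<beta> = UNIV"
    using sp s sets_eq_imp_space_eq[of _ "borel :: 'x measure"] by simp_all
  define N where "N i = (if i = 0 then distr (density \<nu> (indicator Y)) ?bb (\<lambda>x. (x, x))
      else if i = 1 then distr (density \<mu> (indicator (- Y))) ?bb (\<lambda>x. (x, x)) else \<alpha> \<Otimes>\<^sub>M \<beta>)" for i :: nat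
  define w where "w i = (if i = 2 then ennreal (1 / m) else 1)" for i :: nat
  define \<pi> where "\<pi> = mixture 3 w N"
  have restricted: "distr (density Q (indicator Z)) ?bb (\<lambda>x. (x, x)) \<in> space (subprob_algebra ?bb)"
    if "sets Q = sets borel" "prob_space Q" "Z \<in> sets borel" for Q :: "'x measure" and Z
  proof -
    note [measurable_cong] = that(1) and [measurable] = that(3)
    have "emeasure (density Q (indicator Z)) (space Q) \<le> 1"
      using prob_space.measure_le_1[OF that(2), of Z] that
        emeasure_restricted[of Z Q "space Q"] sets_eq_imp_space_eq[OF that(1)] by simp
    then have "subprob_space (density Q (indicator Z))"
      using prob_space.not_empty[OF that(2)] by (intro subprob_spaceI) auto
    then show ?thesis
      unfolding space_subprob_algebra
      by (auto intro!: subprob_space.subprob_space_distr simp: space_pair_measure)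
  qed
  have "N i \<in> space (subprob_algebra ?bb)" for i
  proof -
    have "subprob_space (\<alpha> \<Otimes>\<^sub>M \<beta>)" by unfold_locales
    moreover have "sets (\<alpha> \<Otimes>\<^sub>M \<beta>) = sets ?bb" by (rule sets_pair_measure_cong[OF s])
    ultimately show ?thesis
      using restricted[OF sp(2) \<open>prob_space \<nu>\<close>, of Y] restricted[OF sp(1) \<open>prob_space \<mu>\<close>, of "- Y"]
      by (auto simp: N_def space_subprob_algebra)
  qed
  note N = this
  have int: "(\<integral>\<^sup>+z. f z \<partial>\<pi>) = (\<integral>\<^sup>+x. f (x, x) * indicator Y x \<partial>\<nu>) + (\<integral>\<^sup>+x. f (x, x) * indicator (- Y) x \<partial>\<mu>)
      + ennreal (1 / m) * (\<integral>\<^sup>+x. \<integral>\<^sup>+y. f (x, y) \<partial>\<beta> \<partial>\<alpha>)"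
    if [measurable]: "f \<in> borel_measurable ?bb" for f
  proof -
    have "(\<integral>\<^sup>+z. f z \<partial>\<pi>) = (\<Sum>i<3. w i * (\<integral>\<^sup>+z. f z \<partial>N i))"
      unfolding \<pi>_def by (rule nn_integral_mixture[OF N that])
    also have "\<dots> = (\<integral>\<^sup>+z. f z \<partial>N 0) + (\<integral>\<^sup>+z. f z \<partial>N 1) + ennreal (1 / m) * (\<integral>\<^sup>+z. f z \<partial>N 2)"
      by (simp add: numeral_3_eq_3 w_def numeral_2_eq_2 add.assoc)
    also have "(\<integral>\<^sup>+z. f z \<partial>N 0) = (\<integral>\<^sup>+x. f (x, x) * indicator Y x \<partial>\<nu>)"
      by (simp add: N_def nn_integral_distr nn_integral_density mult.commute)
    also have "(\<integral>\<^sup>+z. f z \<partial>N 1) = (\<integral>\<^sup>+x. f (x, x) * indicator (- Y) x \<partial>\<mu>)"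
      by (simp add: N_def nn_integral_distr nn_integral_density mult.commute)
    also have "(\<integral>\<^sup>+z. f z \<partial>N 2) = (\<integral>\<^sup>+x. \<integral>\<^sup>+y. f (x, y) \<partial>\<beta> \<partial>\<alpha>)"
      unfolding N_def by (simp, rule B.nn_integral_fst[symmetric]) measurable
    finally show ?thesis .
  qed
  have cancel_m: "ennreal (1 / m) * (x * ennreal m) = x" if "m = 0 \<Longrightarrow> x = 0" for x
  proof (cases "m = 0")
    case False
    then have "ennreal (1 / m) * ennreal m = 1" using mass(3) by (simp flip: ennreal_mult)
    then show ?thesis by (metis mult.left_commute mult.right_neutral)
  qed (use that in simp)
  have small: "emeasure \<alpha> A \<le> ennreal m" "emeasure \<beta> A \<le> ennreal m" for A
    using emeasure_space[of \<alpha> A] emeasure_space[of \<beta> A] by (simp_all add: spaces mass)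
  have "\<pi> \<in> couplings \<mu> \<nu>"
  proof (rule couplingI[OF _ \<mu> \<nu>])
    show "sets \<pi> = sets ?bb"
      unfolding \<pi>_def using N by (intro sets_mixture) (auto simp: space_subprob_algebra)
    fix A :: "'x set" assume [measurable]: "A \<in> sets borel"
    have ind: "(\<integral>\<^sup>+x. indicator A x * indicator Y x \<partial>\<nu>) = emeasure \<nu> (A \<inter> Y)"
      "(\<integral>\<^sup>+x. indicator A x * indicator (- Y) x \<partial>\<mu>) = emeasure \<mu> (A - Y)"
      by (simp_all add: indicator_inter_arith[symmetric] Diff_eq sp)
    have split: "emeasure \<mu> (A \<inter> Y) + emeasure \<mu> (A - Y) = emeasure \<mu> A"
      "emeasure \<nu> (A \<inter> Y) + emeasure \<nu> (A - Y) = emeasure \<nu> A"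
      by (subst plus_emeasure; auto intro!: arg_cong2[where f = emeasure] simp: sp)+
    have cancel: "ennreal (1 / m) * (emeasure \<alpha> A * ennreal m) = emeasure \<alpha> A"
      "ennreal (1 / m) * (emeasure \<beta> A * ennreal m) = emeasure \<beta> A"
      using small[of A] by (auto intro: cancel_m)
    have "(\<integral>\<^sup>+z. indicator A (fst z) \<partial>\<pi>) = emeasure \<nu> (A \<inter> Y) + emeasure \<mu> (A - Y) + emeasure \<alpha> A"
      by (subst int) (auto simp: ind nn_integral_multc spaces mass cancel)
    also have "\<dots> = (emeasure \<alpha> A + emeasure \<nu> (A \<inter> Y)) + emeasure \<mu> (A - Y)" by (simp add: ac_simps)
    also have "\<dots> = emeasure \<mu> A" using \<alpha>[of A] split(1) by simp
    finally show "(\<integral>\<^sup>+z. indicator A (fst z) \<partial>\<pi>) = emeasure \<mu> A" .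
    have "(\<integral>\<^sup>+z. indicator A (snd z) \<partial>\<pi>) = emeasure \<nu> (A \<inter> Y) + emeasure \<mu> (A - Y) + emeasure \<beta> A"
      by (subst int) (auto simp: ind spaces mass cancel mult.commute[of "ennreal m"])
    also have "\<dots> = emeasure \<nu> (A \<inter> Y) + (emeasure \<beta> A + emeasure \<mu> (A - Y))" by (simp add: ac_simps)
    also have "\<dots> = emeasure \<nu> A" using \<beta>[of A] split(2) by simp
    finally show "(\<integral>\<^sup>+z. indicator A (snd z) \<partial>\<pi>) = emeasure \<nu> A" .
  qed
  moreover have "transport_cost p \<pi> \<le> ennreal (2 powr p) *
     ((\<integral>\<^sup>+x. ennreal (dist x x0 powr p) \<partial>\<alpha>) + (\<integral>\<^sup>+x. ennreal (dist x x0 powr p) \<partial>\<beta>))"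
  proof -
    let ?d = "\<lambda>x. ennreal (dist x x0 powr p)"
    have "transport_cost p \<pi> = ennreal (1 / m) * (\<integral>\<^sup>+x. \<integral>\<^sup>+y. ennreal (dist x y powr p) \<partial>\<beta> \<partial>\<alpha>)"
      unfolding transport_cost_def by (subst int) auto
    also have "\<dots> \<le> ennreal (1 / m) * (\<integral>\<^sup>+x. \<integral>\<^sup>+y. ennreal (2 powr p) * (?d x + ?d y) \<partial>\<beta> \<partial>\<alpha>)"
    proof (intro mult_left_mono nn_integral_mono)
      fix x y
      have "dist x y powr p \<le> (dist x x0 + dist y x0) powr p"
        using p by (intro powr_mono2 dist_triangle2) auto
      also have "\<dots> \<le> 2 powr p * (dist x x0 powr p + dist y x0 powr p)"
        using p by (intro powr_add_le) auto
      finally show "ennreal (dist x y powr p) \<le> ennreal (2 powr p) * (?d x + ?d y)"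
        by (simp flip: ennreal_plus ennreal_mult add: ennreal_leI)
    qed simp
    also have "(\<integral>\<^sup>+x. \<integral>\<^sup>+y. ennreal (2 powr p) * (?d x + ?d y) \<partial>\<beta> \<partial>\<alpha>) =
        ennreal (2 powr p) * ((\<integral>\<^sup>+x. ?d x \<partial>\<alpha>) + (\<integral>\<^sup>+x. ?d x \<partial>\<beta>)) * ennreal m"
      by (simp add: nn_integral_cmult nn_integral_add nn_integral_multc mass spaces distrib_left distrib_right ac_simps)
    also have "ennreal (1 / m) * (ennreal (2 powr p) * ((\<integral>\<^sup>+x. ?d x \<partial>\<alpha>) + (\<integral>\<^sup>+x. ?d x \<partial>\<beta>)) * ennreal m)
        \<le> ennreal (2 powr p) * ((\<integral>\<^sup>+x. ?d x \<partial>\<alpha>) + (\<integral>\<^sup>+x. ?d x \<partial>\<beta>))"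
      by (cases "m = 0") (simp_all add: cancel_m)
    finally show ?thesis .
  qed
  ultimately show ?thesis by blast
qed

text \<open>The parts \<open>\<alpha> \<le> \<mu>\<close> and \<open>\<beta> \<le> \<nu>\<close> have mass at most \<open>\<delta>\<close>, so each contributes at most
  \<open>L \<delta> + \<epsilon> M\<close> to the \<open>p\<close>-th moment that \<open>coupling_of_jordan_parts\<close> has to pay for.\<close>

lemma wasserstein_le_of_tv:
  fixes \<mu> \<nu> :: "'x::polish_space measure" and w :: "'x \<Rightarrow> real"
  assumes \<mu>: "\<mu> \<in> space (prob_algebra borel)" and \<nu>: "\<nu> \<in> space (prob_algebra borel)"
    and [measurable]: "w \<in> borel_measurable borel" and p: "1 \<le> p"
    and dist_le: "\<And>x. dist x x0 powr p \<le> L + \<epsilon> * w x" and nonneg: "0 \<le> L" "0 \<le> \<epsilon>" "\<And>x. 0 \<le> w x"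
    and moments: "(\<integral>\<^sup>+x. ennreal (w x) \<partial>\<mu>) \<le> ennreal M" "(\<integral>\<^sup>+x. ennreal (w x) \<partial>\<nu>) \<le> ennreal M" "0 \<le> M"
    and tv: "\<And>Y. Y \<in> sets borel \<Longrightarrow> measure \<mu> Y - measure \<nu> Y \<le> \<delta>"
    and A: "0 \<le> A" "2 powr p * (2 * (L * \<delta> + \<epsilon> * M)) \<le> A powr p"
  shows "wasserstein p \<mu> \<nu> \<le> A"
proof -
  have sp: "sets \<mu> = sets borel" "sets \<nu> = sets borel" and "prob_space \<mu>" "prob_space \<nu>"
    using \<mu> \<nu> by (auto simp: space_prob_algebra)
  interpret M: prob_space \<mu> by fact
  interpret N: prob_space \<nu> by fact
  note [measurable_cong] = sp
  obtain Y \<alpha> \<beta> where Y: "Y \<in> sets \<mu>" and s\<alpha>': "sets \<alpha> = sets \<mu>" and s\<beta>': "sets \<beta> = sets \<mu>"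
    and \<alpha>: "\<And>A. A \<in> sets \<mu> \<Longrightarrow> emeasure \<alpha> A + emeasure \<nu> (A \<inter> Y) = emeasure \<mu> (A \<inter> Y)"
    and \<beta>: "\<And>A. A \<in> sets \<mu> \<Longrightarrow> emeasure \<beta> A + emeasure \<mu> (A - Y) = emeasure \<nu> (A - Y)"
    by (rule jordan_parts[OF M.finite_measure N.finite_measure]) (simp add: sp, rule that)
  have [measurable]: "Y \<in> sets borel" using Y sp by simp
  have s\<alpha>: "sets \<alpha> = sets borel" and s\<beta>: "sets \<beta> = sets borel" using s\<alpha>' s\<beta>' sp by simp_all
  note [measurable_cong] = s\<alpha> s\<beta>
  have spaces: "space \<mu> = UNIV" "space \<nu> = UNIV" "space \<alpha> = UNIV" "space \<beta> = UNIV"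
    using sp s\<alpha> s\<beta> sets_eq_imp_space_eq[of _ "borel :: 'x measure"] by simp_all
  define m where "m = measure \<mu> Y - measure \<nu> Y"
  have "emeasure \<nu> Y \<le> emeasure \<mu> Y"
    using \<alpha>[of UNIV] sp by (metis Int_UNIV_left le_iff_add add.commute sets.top spaces(1))
  then have m0: "0 \<le> m" unfolding m_def by (simp add: M.emeasure_eq_measure N.emeasure_eq_measure)
  have cancel: "x = ennreal (b - a)" if "x + ennreal a = ennreal b" "0 \<le> a" "0 \<le> b" for x a b
  proof -
    have "x = ennreal b - ennreal a" using that by (metis ennreal_add_diff_cancel_right ennreal_neq_top)
    then show ?thesis using that(2) by (simp add: ennreal_minus)
  qed
  have mass: "emeasure \<alpha> UNIV = ennreal m"
    using \<alpha>[of UNIV] Y sp unfolding m_def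
    by (intro cancel) (auto simp: M.emeasure_eq_measure[symmetric] N.emeasure_eq_measure[symmetric])
  have compl: "measure \<mu> (UNIV - Y) = 1 - measure \<mu> Y" "measure \<nu> (UNIV - Y) = 1 - measure \<nu> Y"
    using M.prob_compl[of Y] N.prob_compl[of Y] Y sp spaces by simp_all
  have mass\<beta>: "emeasure \<beta> UNIV = ennreal m"
  proof -
    have "emeasure \<beta> UNIV = ennreal (measure \<nu> (UNIV - Y) - measure \<mu> (UNIV - Y))"
      using \<beta>[of UNIV] sp
      by (intro cancel) (auto simp: M.emeasure_eq_measure[symmetric] N.emeasure_eq_measure[symmetric])
    then show ?thesis by (simp add: compl m_def)
  qed
  have m1: "m \<le> 1" using M.prob_le_1[of Y] measure_nonneg[of \<nu> Y] unfolding m_def by linarith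
  have m\<delta>: "m \<le> \<delta>" unfolding m_def by (rule tv) measurable
  have sub: "subprob_space \<alpha>" "subprob_space \<beta>"
    using m1 m0 by (auto intro!: subprob_spaceI simp: spaces mass mass\<beta> ennreal_le_1)
  have le: "\<alpha> \<le> \<mu>" "\<beta> \<le> \<nu>"
  proof -
    have "emeasure \<alpha> A \<le> emeasure \<mu> A" "emeasure \<beta> A \<le> emeasure \<nu> A" if "A \<in> sets borel" for A
    proof -
      have "emeasure \<alpha> A \<le> emeasure \<mu> (A \<inter> Y)" using \<alpha>[of A] that sp by (metis le_iff_add)
      also have "\<dots> \<le> emeasure \<mu> A" using that by (intro emeasure_mono) (auto simp: sp)
      finally show "emeasure \<alpha> A \<le> emeasure \<mu> A" .
      have "emeasure \<beta> A \<le> emeasure \<nu> (A - Y)" using \<beta>[of A] that sp by (metis le_iff_add)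
      also have "\<dots> \<le> emeasure \<nu> A" using that by (intro emeasure_mono) (auto simp: sp)
      finally show "emeasure \<beta> A \<le> emeasure \<nu> A" .
    qed
    then show "\<alpha> \<le> \<mu>" "\<beta> \<le> \<nu>"
      by (simp_all add: le_measure sp s\<alpha> s\<beta>)
  qed
  obtain \<pi> where \<pi>: "\<pi> \<in> couplings \<mu> \<nu>" "transport_cost p \<pi> \<le> ennreal (2 powr p) *
     ((\<integral>\<^sup>+x. ennreal (dist x x0 powr p) \<partial>\<alpha>) + (\<integral>\<^sup>+x. ennreal (dist x x0 powr p) \<partial>\<beta>))"
    using coupling_of_jordan_parts[OF \<mu> \<nu> \<open>Y \<in> sets borel\<close> s\<alpha> s\<beta> sub _ _ mass mass\<beta> m0, of p x0] \<alpha> \<beta> p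
    by (auto simp: sp)
  have moment: "(\<integral>\<^sup>+x. ennreal (dist x x0 powr p) \<partial>\<tau>) \<le> ennreal (L * \<delta> + \<epsilon> * M)"
    if [measurable_cong]: "sets \<tau> = sets borel" and "emeasure \<tau> (space \<tau>) = ennreal m"
      and le: "(\<integral>\<^sup>+x. ennreal (w x) \<partial>\<tau>) \<le> ennreal M" for \<tau> :: "'x measure"
  proof -
    have "(\<integral>\<^sup>+x. ennreal (dist x x0 powr p) \<partial>\<tau>) \<le> (\<integral>\<^sup>+x. ennreal L + ennreal \<epsilon> * ennreal (w x) \<partial>\<tau>)"
      using dist_le nonneg by (intro nn_integral_mono) (simp flip: ennreal_plus ennreal_mult add: ennreal_leI)
    also have "\<dots> = ennreal L * ennreal m + ennreal \<epsilon> * (\<integral>\<^sup>+x. ennreal (w x) \<partial>\<tau>)"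
      by (simp add: nn_integral_add nn_integral_cmult that(2))
    also have "\<dots> \<le> ennreal L * ennreal \<delta> + ennreal \<epsilon> * ennreal M"
      using le m\<delta> by (intro add_mono mult_left_mono ennreal_leI) auto
    also have "\<dots> = ennreal (L * \<delta> + \<epsilon> * M)"
      using nonneg m0 m\<delta> moments(3) by (simp add: ennreal_plus ennreal_mult)
    finally show ?thesis .
  qed
  have "(\<integral>\<^sup>+x. ennreal (w x) \<partial>\<alpha>) \<le> ennreal M" "(\<integral>\<^sup>+x. ennreal (w x) \<partial>\<beta>) \<le> ennreal M"
    using nn_integral_mono_measure[OF _ le(1), of "\<lambda>x. ennreal (w x)"]
      nn_integral_mono_measure[OF _ le(2), of "\<lambda>x. ennreal (w x)"] moments
    by (auto simp: sp s\<alpha> s\<beta> intro: order_trans)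
  then have "(\<integral>\<^sup>+x. ennreal (dist x x0 powr p) \<partial>\<alpha>) + (\<integral>\<^sup>+x. ennreal (dist x x0 powr p) \<partial>\<beta>) \<le>
      ennreal (L * \<delta> + \<epsilon> * M) + ennreal (L * \<delta> + \<epsilon> * M)"
    by (intro add_mono moment s\<alpha> s\<beta>) (simp_all add: spaces mass mass\<beta>)
  then have "transport_cost p \<pi> \<le> ennreal (2 powr p) * (ennreal (L * \<delta> + \<epsilon> * M) + ennreal (L * \<delta> + \<epsilon> * M))"
    by (intro order_trans[OF \<pi>(2)] mult_left_mono) auto
  also have "\<dots> = ennreal (2 powr p * (2 * (L * \<delta> + \<epsilon> * M)))"
    using nonneg m0 m\<delta> moments(3) by (simp flip: ennreal_plus ennreal_mult)
  also have "\<dots> \<le> ennreal (A powr p)" by (intro ennreal_leI A)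
  finally show ?thesis by (rule wasserstein_le[OF \<pi>(1) _ A(1) p])
qed

section \<open>Invariant measures of a kernel with drift and minorization\<close>

text \<open>The drift inequality is written without subtraction, so that it can be integrated in
  \<^typ>\<open>ennreal\<close> even where the integral of \<open>W\<close> is not yet known to be finite.\<close>

locale drift_kernel =
  fixes Q :: "'x::polish_space \<Rightarrow> 'x measure" and W :: "'x \<Rightarrow> real" and C :: "'x set"
    and \<beta>1 \<beta>2 B \<gamma> :: real and \<nu> :: "'x measure"
  assumes Q [measurable]: "Q \<in> borel \<rightarrow>\<^sub>M prob_algebra borel"
    and W [measurable]: "W \<in> borel_measurable borel" and W_ge_1: "\<And>x. 1 \<le> W x"
    and C [measurable]: "C \<in> sets borel" and \<beta>1: "0 < \<beta>1" and \<beta>2: "0 \<le> \<beta>2"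
    and drift: "\<And>x. (\<integral>\<^sup>+y. ennreal (W y) \<partial>Q x) + ennreal (\<beta>1 * W x) * indicator (- C) x \<le>
        ennreal (W x) + ennreal \<beta>2 * indicator C x"
    and W_le: "\<And>x. x \<in> C \<Longrightarrow> W x \<le> B"
    and \<nu>: "\<nu> \<in> space (prob_algebra borel)" and \<nu>_C: "emeasure \<nu> C = 1" and \<gamma>: "0 < \<gamma>"
    and minorization: "\<And>x A. x \<in> C \<Longrightarrow> A \<in> sets borel \<Longrightarrow> ennreal \<gamma> * emeasure \<nu> A \<le> emeasure (Q x) A"
begin

lemma Q_subprob [measurable]: "Q \<in> borel \<rightarrow>\<^sub>M subprob_algebra borel"
  by (rule measurable_prob_algebraD) (rule Q)

lemma Q_prob: "prob_space (Q x)" and sets_Q: "sets (Q x) = sets borel"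
  using measurable_space[OF Q, of x] by (auto simp: space_prob_algebra)

lemma nn_integral_bind_Q:
  assumes "sets \<eta> = sets borel" "f \<in> borel_measurable borel"
  shows "(\<integral>\<^sup>+x. f x \<partial>(\<eta> \<bind> Q)) = (\<integral>\<^sup>+x. \<integral>\<^sup>+y. f y \<partial>Q x \<partial>\<eta>)"
  using assms by (intro nn_integral_bind) (auto simp: Q_subprob cong: measurable_cong_sets)

lemma emeasure_bind_Q:
  assumes "sets \<eta> = sets borel" "A \<in> sets borel"
  shows "emeasure (\<eta> \<bind> Q) A = (\<integral>\<^sup>+x. emeasure (Q x) A \<partial>\<eta>)"
proof -
  have "space \<eta> \<noteq> {}" using sets_eq_imp_space_eq[OF assms(1)] by simp
  then show ?thesis
    using assms by (intro emeasure_bind) (auto simp: Q_subprob cong: measurable_cong_sets)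
qed

lemma C_nonempty: "C \<noteq> {}" using \<nu>_C by auto

lemma B_ge_1: "1 \<le> B" using C_nonempty W_ge_1 W_le by (meson all_not_in_conv order_trans)

definition invariant :: "'x measure \<Rightarrow> bool" where
  "invariant \<eta> \<longleftrightarrow> \<eta> \<in> space (prob_algebra borel) \<and> \<eta> \<bind> Q = \<eta>"

text \<open>As \<open>W\<close> may not be integrable, the invariance equation is applied to \<open>min W m\<close>. One step lowers its
  mean by \<open>\<beta>1 W\<close> at least where \<open>W \<le> m\<close> outside \<open>C\<close>, and where \<open>W > m\<close> does not raise it.\<close>

lemma invariant_truncated_drift:
  assumes "invariant \<eta>"
  shows "(\<integral>\<^sup>+x. ennreal (\<beta>1 * W x) * indicator (- C \<inter> {x. W x \<le> real m}) x \<partial>\<eta>) \<le> ennreal \<beta>2 * emeasure \<eta> C"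
proof -
  have [measurable_cong]: "sets \<eta> = sets borel" and "prob_space \<eta>" and inv: "\<eta> \<bind> Q = \<eta>"
    using assms by (auto simp: invariant_def space_prob_algebra)
  interpret prob_space \<eta> by fact
  let ?\<phi> = "\<lambda>x. ennreal (min (W x) (real m))"
  let ?g = "\<lambda>x. ennreal (\<beta>1 * W x) * indicator (- C \<inter> {x. W x \<le> real m}) x"
  have pointwise: "(\<integral>\<^sup>+y. ?\<phi> y \<partial>Q x) + ?g x \<le> ?\<phi> x + ennreal \<beta>2 * indicator C x" for x
  proof (cases "W x \<le> real m")
    case True
    have "(\<integral>\<^sup>+y. ?\<phi> y \<partial>Q x) \<le> (\<integral>\<^sup>+y. ennreal (W y) \<partial>Q x)" by (intro nn_integral_mono ennreal_leI) auto
    then have "(\<integral>\<^sup>+y. ?\<phi> y \<partial>Q x) + ?g x \<le>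
        (\<integral>\<^sup>+y. ennreal (W y) \<partial>Q x) + ennreal (\<beta>1 * W x) * indicator (- C) x"
      by (intro add_mono) (auto split: split_indicator)
    also note drift
    finally show ?thesis using True by (simp add: min_def)
  next
    case False
    have "(\<integral>\<^sup>+y. ?\<phi> y \<partial>Q x) \<le> (\<integral>\<^sup>+y. ennreal (real m) \<partial>Q x)" by (intro nn_integral_mono ennreal_leI) auto
    also have "\<dots> = ennreal (real m)" using prob_space.emeasure_space_1[OF Q_prob] by simp
    finally show ?thesis using False by (auto simp: min_def intro: add_increasing2)
  qed
  have "(\<integral>\<^sup>+x. ?\<phi> x \<partial>\<eta>) + (\<integral>\<^sup>+x. ?g x \<partial>\<eta>) = (\<integral>\<^sup>+x. \<integral>\<^sup>+y. ?\<phi> y \<partial>Q x \<partial>\<eta>) + (\<integral>\<^sup>+x. ?g x \<partial>\<eta>)"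
    by (subst inv[symmetric], subst nn_integral_bind_Q) (auto simp: \<open>sets \<eta> = sets borel\<close>)
  also have "\<dots> = (\<integral>\<^sup>+x. (\<integral>\<^sup>+y. ?\<phi> y \<partial>Q x) + ?g x \<partial>\<eta>)"
    by (subst nn_integral_add) auto
  also have "\<dots> \<le> (\<integral>\<^sup>+x. ?\<phi> x + ennreal \<beta>2 * indicator C x \<partial>\<eta>)"
    by (intro nn_integral_mono pointwise)
  also have "\<dots> = (\<integral>\<^sup>+x. ?\<phi> x \<partial>\<eta>) + ennreal \<beta>2 * emeasure \<eta> C"
    by (subst nn_integral_add) (auto simp: nn_integral_cmult)
  finally have le: "(\<integral>\<^sup>+x. ?\<phi> x \<partial>\<eta>) + (\<integral>\<^sup>+x. ?g x \<partial>\<eta>) \<le> (\<integral>\<^sup>+x. ?\<phi> x \<partial>\<eta>) + ennreal \<beta>2 * emeasure \<eta> C" .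
  have "(\<integral>\<^sup>+x. ?\<phi> x \<partial>\<eta>) \<le> (\<integral>\<^sup>+x. ennreal (real m) \<partial>\<eta>)" by (intro nn_integral_mono ennreal_leI) auto
  then have "(\<integral>\<^sup>+x. ?\<phi> x \<partial>\<eta>) \<noteq> \<top>" by (auto simp: emeasure_space_1 top_unique)
  with le show ?thesis by (simp add: ennreal_add_left_cancel_le)
qed

lemma truncations_SUP:
  assumes [measurable]: "f \<in> borel_measurable borel" and "sets \<eta> = sets borel"
  shows "(\<integral>\<^sup>+x. f x \<partial>\<eta>) = (SUP m. \<integral>\<^sup>+x. f x * indicator {x. W x \<le> real m} x \<partial>\<eta>)"
proof -
  note [measurable_cong] = assms(2)
  have "(SUP m. f x * indicator {x. W x \<le> real m} x) = f x" for x
  proof (rule antisym)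
    obtain m where "W x \<le> real m" using real_arch_simple by blast
    then show "f x \<le> (SUP m. f x * indicator {x. W x \<le> real m} x)"
      by (intro SUP_upper2[of m]) auto
  qed (auto intro!: SUP_least split: split_indicator)
  then have "(\<integral>\<^sup>+x. f x \<partial>\<eta>) = (\<integral>\<^sup>+x. (SUP m. f x * indicator {x. W x \<le> real m} x) \<partial>\<eta>)" by simp
  also have "\<dots> = (SUP m. \<integral>\<^sup>+x. f x * indicator {x. W x \<le> real m} x \<partial>\<eta>)"
    by (rule nn_integral_monotone_convergence_SUP)
      (auto simp: incseq_def le_fun_def split: split_indicator)
  finally show ?thesis .
qed

lemma invariant_drift:
  assumes "invariant \<eta>"
  shows "(\<integral>\<^sup>+x. ennreal (\<beta>1 * W x) * indicator (- C) x \<partial>\<eta>) \<le> ennreal \<beta>2 * emeasure \<eta> C"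
proof -
  have s: "sets \<eta> = sets borel" using assms by (auto simp: invariant_def space_prob_algebra)
  have "(\<integral>\<^sup>+x. ennreal (\<beta>1 * W x) * indicator (- C) x \<partial>\<eta>) =
      (SUP m. \<integral>\<^sup>+x. ennreal (\<beta>1 * W x) * indicator (- C) x * indicator {x. W x \<le> real m} x \<partial>\<eta>)"
    by (rule truncations_SUP[OF _ s]) measurable
  also have "\<dots> \<le> ennreal \<beta>2 * emeasure \<eta> C"
    using invariant_truncated_drift[OF assms] by (intro SUP_least) (simp add: indicator_inter_arith mult.assoc)
  finally show ?thesis .
qed

lemma invariant_moment:
  assumes "invariant \<eta>"
  shows "(\<integral>\<^sup>+x. ennreal (W x) \<partial>\<eta>) \<le> ennreal (\<beta>2 / \<beta>1 + B)"
proof -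
  have [measurable_cong]: "sets \<eta> = sets borel" and "prob_space \<eta>"
    using assms by (auto simp: invariant_def space_prob_algebra)
  interpret prob_space \<eta> by fact
  have "(\<integral>\<^sup>+x. ennreal (W x) \<partial>\<eta>) \<le>
      (\<integral>\<^sup>+x. ennreal (1 / \<beta>1) * (ennreal (\<beta>1 * W x) * indicator (- C) x) + ennreal B \<partial>\<eta>)"
  proof (rule nn_integral_mono)
    fix x
    show "ennreal (W x) \<le> ennreal (1 / \<beta>1) * (ennreal (\<beta>1 * W x) * indicator (- C) x) + ennreal B"
    proof (cases "x \<in> C")
      case True
      then show ?thesis using W_le by (simp add: ennreal_leI)
    next
      case False
      then show ?thesis using \<beta>1 W_ge_1[of x] by (simp flip: ennreal_mult)
    qed
  qed
  also have "\<dots> = ennreal (1 / \<beta>1) * (\<integral>\<^sup>+x. ennreal (\<beta>1 * W x) * indicator (- C) x \<partial>\<eta>) + ennreal B"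
    by (subst nn_integral_add) (auto simp: nn_integral_cmult emeasure_space_1)
  also have "\<dots> \<le> ennreal (1 / \<beta>1) * (ennreal \<beta>2 * 1) + ennreal B"
    by (intro add_mono mult_left_mono order_trans[OF invariant_drift[OF assms]] measure_le_1) auto
  also have "\<dots> = ennreal (\<beta>2 / \<beta>1 + B)"
    using \<beta>1 \<beta>2 B_ge_1 by (simp flip: ennreal_mult add: ennreal_plus)
  finally show ?thesis .
qed

text \<open>Outside \<open>C\<close> the drift is strictly negative, and in equilibrium only \<open>C\<close> can make up for it.\<close>

lemma invariant_charges_C:
  assumes "invariant \<eta>"
  shows "emeasure \<eta> C \<noteq> 0"
proof
  assume 0: "emeasure \<eta> C = 0"
  have [measurable_cong]: "sets \<eta> = sets borel" and "prob_space \<eta>"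
    using assms by (auto simp: invariant_def space_prob_algebra)
  interpret prob_space \<eta> by fact
  have sp: "space \<eta> = UNIV" using sets_eq_imp_space_eq[OF \<open>sets \<eta> = sets borel\<close>] by simp
  have "ennreal \<beta>1 * emeasure \<eta> (- C) = (\<integral>\<^sup>+x. ennreal \<beta>1 * indicator (- C) x \<partial>\<eta>)"
    by (simp add: nn_integral_cmult)
  also have "\<dots> \<le> (\<integral>\<^sup>+x. ennreal (\<beta>1 * W x) * indicator (- C) x \<partial>\<eta>)"
    using \<beta>1 W_ge_1 by (intro nn_integral_mono mult_right_mono ennreal_leI) auto
  also have "\<dots> = 0" using invariant_drift[OF assms] by (simp add: 0)
  finally have "emeasure \<eta> (- C) = 0" using \<beta>1 by simp
  moreover have "emeasure \<eta> UNIV = emeasure \<eta> C + emeasure \<eta> (- C)"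
    by (subst plus_emeasure) (auto simp: \<open>sets \<eta> = sets borel\<close>)
  ultimately show False using 0 emeasure_space_1 by (simp add: sp)
qed

lemma bind_Q_ge_minorization:
  assumes "sets \<eta> = sets borel" "A \<in> sets borel"
  shows "ennreal \<gamma> * emeasure \<eta> C * emeasure \<nu> A \<le> emeasure (\<eta> \<bind> Q) A"
proof -
  note [measurable_cong] = assms(1)
  have "ennreal \<gamma> * emeasure \<eta> C * emeasure \<nu> A = (\<integral>\<^sup>+x. ennreal \<gamma> * emeasure \<nu> A * indicator C x \<partial>\<eta>)"
    by (subst nn_integral_cmult) (auto simp: ac_simps)
  also have "\<dots> \<le> (\<integral>\<^sup>+x. emeasure (Q x) A \<partial>\<eta>)"
    using minorization[OF _ assms(2)] by (intro nn_integral_mono) (auto split: split_indicator)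
  finally show ?thesis by (simp add: emeasure_bind_Q assms)
qed

lemma emeasure_bind_Q_UNIV:
  assumes "sets \<eta> = sets borel"
  shows "emeasure (\<eta> \<bind> Q) UNIV = emeasure \<eta> UNIV"
proof -
  have "space (Q x) = UNIV" "space \<eta> = UNIV" for x
    using sets_eq_imp_space_eq[OF sets_Q[of x]] sets_eq_imp_space_eq[OF assms] by auto
  then have "emeasure (Q x) UNIV = 1" for x
    using prob_space.emeasure_space_1[OF Q_prob[of x]] by simp
  then show ?thesis using \<open>space \<eta> = UNIV\<close> by (simp add: emeasure_bind_Q[OF assms])
qed

lemma sets_bind_Q: "sets \<eta> = sets borel \<Longrightarrow> sets (\<eta> \<bind> Q) = sets borel"
  using sets_eq_imp_space_eq[of \<eta> borel] by (intro sets_bind[where N = borel] sets_Q) auto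

lemma scaled_invariant:
  assumes s: "sets \<alpha> = sets borel" and inv: "\<alpha> \<bind> Q = \<alpha>"
    and mass: "emeasure \<alpha> UNIV \<noteq> 0" "emeasure \<alpha> UNIV \<noteq> \<infinity>"
  shows "invariant (scale_measure (1 / emeasure \<alpha> UNIV) \<alpha>)"
proof -
  let ?c = "1 / emeasure \<alpha> UNIV" let ?\<eta> = "scale_measure ?c \<alpha>"
  have s': "sets ?\<eta> = sets borel" by (simp add: s)
  have "emeasure ?\<eta> UNIV = 1"
    using mass by (simp add: ennreal_divide_times ennreal_divide_self less_top)
  then have "prob_space ?\<eta>" using sets_eq_imp_space_eq[OF s'] by (intro prob_spaceI) simp
  moreover have "?\<eta> \<bind> Q = ?\<eta>"
  proof (rule measure_eqI)
    show "sets (?\<eta> \<bind> Q) = sets ?\<eta>" by (simp add: sets_bind_Q[OF s'] s' del: sets_scale_measure)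
    fix A assume "A \<in> sets (?\<eta> \<bind> Q)"
    then have A: "A \<in> sets borel" by (simp add: sets_bind_Q[OF s'])
    have "emeasure (?\<eta> \<bind> Q) A = ?c * (\<integral>\<^sup>+x. emeasure (Q x) A \<partial>\<alpha>)"
      using A s by (subst emeasure_bind_Q[OF s' A])
        (auto intro!: nn_integral_scale_measure measurable_emeasure_kernel[OF Q_subprob] cong: measurable_cong_sets)
    also have "(\<integral>\<^sup>+x. emeasure (Q x) A \<partial>\<alpha>) = emeasure \<alpha> A"
      using emeasure_bind_Q[OF s A] inv by simp
    finally show "emeasure (?\<eta> \<bind> Q) A = emeasure ?\<eta> A" by simp
  qed
  ultimately show ?thesis using s' by (simp add: invariant_def space_prob_algebra)
qed

lemma null_sets_of_finite_invariant:
  assumes s: "sets \<alpha> = sets borel" and inv: "\<alpha> \<bind> Q = \<alpha>"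
    and mass: "emeasure \<alpha> UNIV \<noteq> 0" "emeasure \<alpha> UNIV \<noteq> \<infinity>"
    and Z: "Z \<in> sets borel" "emeasure \<alpha> Z = 0"
  shows "emeasure \<nu> Z = 0"
proof -
  have "emeasure \<alpha> C \<noteq> 0"
    using invariant_charges_C[OF scaled_invariant[OF s inv mass]] by auto
  moreover have "ennreal \<gamma> * emeasure \<alpha> C * emeasure \<nu> Z = 0"
    using bind_Q_ge_minorization[OF s Z(1)] Z(2) by (simp add: inv)
  ultimately show ?thesis using \<gamma> by simp
qed

text \<open>Since \<open>\<alpha> + \<eta>2\<close> dominates \<open>\<eta>1\<close>, applying the kernel gives \<open>\<alpha>Q \<ge> \<eta>1 - \<eta>2\<close> and so \<open>\<alpha>Q \<ge> \<alpha>\<close>. Both sides have the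
  same mass, hence they agree.\<close>

lemma positive_part_invariant:
  assumes \<eta>1: "invariant \<eta>1" and \<eta>2: "invariant \<eta>2" and s: "sets \<alpha> = sets borel"
    and [measurable]: "Y \<in> sets borel"
    and \<alpha>: "\<And>A. A \<in> sets borel \<Longrightarrow> emeasure \<alpha> A + emeasure \<eta>2 (A \<inter> Y) = emeasure \<eta>1 (A \<inter> Y)"
    and le: "\<And>A. A \<in> sets borel \<Longrightarrow> emeasure \<eta>1 (A - Y) \<le> emeasure \<eta>2 (A - Y)"
  shows "\<alpha> \<bind> Q = \<alpha>"
proof -
  have s12: "sets \<eta>1 = sets borel" "sets \<eta>2 = sets borel" and p12: "prob_space \<eta>1" "prob_space \<eta>2"
    and inv: "\<eta>1 \<bind> Q = \<eta>1" "\<eta>2 \<bind> Q = \<eta>2"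
    using \<eta>1 \<eta>2 by (auto simp: invariant_def space_prob_algebra)
  have sp: "space \<alpha> = UNIV" "space \<eta>1 = UNIV" "space \<eta>2 = UNIV"
    using sets_eq_imp_space_eq[OF s] sets_eq_imp_space_eq[OF s12(1)] sets_eq_imp_space_eq[OF s12(2)] by auto
  have fin2: "emeasure \<eta>2 A \<noteq> \<top>" for A
    using prob_space.measure_le_1[OF p12(2), of A] by (auto simp: top_unique)
  have \<alpha>_le: "emeasure \<alpha> A \<le> 1" if "A \<in> sets borel" for A
    using \<alpha>[OF that] prob_space.measure_le_1[OF p12(1), of "A \<inter> Y"]
    by (metis le_iff_add order_trans)
  have sub: "subprob_space \<alpha>" using \<alpha>_le[of UNIV] sp by (intro subprob_spaceI) auto
  define N where "N i = (if i = 0 then \<alpha> else \<eta>2)" for i :: nat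
  have N: "N i \<in> space (subprob_algebra borel)" for i
    using sub s s12 p12 by (auto simp: N_def space_subprob_algebra prob_space_imp_subprob_space)
  let ?S = "mixture 2 (\<lambda>_. 1) N"
  have S: "sets ?S = sets borel"
    using N by (intro sets_mixture) (auto simp: space_subprob_algebra)
  have "\<eta>1 \<le> ?S"
  proof -
    have "emeasure \<eta>1 A \<le> emeasure ?S A" if A[measurable]: "A \<in> sets borel" for A
    proof -
      have split: "emeasure \<eta> (A \<inter> Y) + emeasure \<eta> (A - Y) = emeasure \<eta> A"
        if "sets \<eta> = sets borel" for \<eta> :: "'x measure"
        by (subst plus_emeasure) (auto intro!: arg_cong2[where f = emeasure] simp: that)
      have "emeasure \<eta>1 A \<le> emeasure \<eta>1 (A \<inter> Y) + emeasure \<eta>2 (A - Y)"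
        using le[OF A] split[OF s12(1)] by (metis add_left_mono)
      also have "\<dots> = emeasure \<alpha> A + emeasure \<eta>2 A"
        using \<alpha>[OF A] split[OF s12(2)] by (metis add.assoc)
      also have "\<dots> = emeasure ?S A"
        by (subst emeasure_mixture[OF _ N A]) (auto simp: numeral_2_eq_2 N_def)
      finally show ?thesis .
    qed
    then show ?thesis by (simp add: le_measure S s12)
  qed
  then have dom: "(\<integral>\<^sup>+x. f x \<partial>\<eta>1) \<le> (\<integral>\<^sup>+x. f x \<partial>\<alpha>) + (\<integral>\<^sup>+x. f x \<partial>\<eta>2)"
    if "f \<in> borel_measurable borel" for f
  proof -
    have "(\<integral>\<^sup>+x. f x \<partial>\<eta>1) \<le> (\<integral>\<^sup>+x. f x \<partial>?S)"
      using \<open>\<eta>1 \<le> ?S\<close> by (intro nn_integral_mono_measure) (simp_all only: S s12)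
    also have "\<dots> = (\<Sum>i<2. 1 * (\<integral>\<^sup>+x. f x \<partial>N i))" by (rule nn_integral_mixture[OF N that])
    finally show ?thesis by (simp add: numeral_2_eq_2 N_def)
  qed
  have outside: "emeasure \<alpha> (A - Y) = 0" if "A \<in> sets borel" for A
    using \<alpha>[of "A - Y"] that by (simp add: Diff_Int_distrib2 Int_commute Int_Diff)
  have ge: "emeasure \<alpha> A \<le> emeasure (\<alpha> \<bind> Q) A" if A[measurable]: "A \<in> sets borel" for A
  proof -
    have AY: "A \<inter> Y \<in> sets borel" by measurable
    have "emeasure \<alpha> A + emeasure \<eta>2 (A \<inter> Y) = emeasure (\<eta>1 \<bind> Q) (A \<inter> Y)" by (simp add: \<alpha> inv)
    also have "\<dots> \<le> emeasure (\<alpha> \<bind> Q) (A \<inter> Y) + emeasure (\<eta>2 \<bind> Q) (A \<inter> Y)"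
      unfolding emeasure_bind_Q[OF s AY] emeasure_bind_Q[OF s12(1) AY] emeasure_bind_Q[OF s12(2) AY]
      by (rule dom) measurable
    finally have "emeasure \<alpha> A \<le> emeasure (\<alpha> \<bind> Q) (A \<inter> Y)"
      using fin2 by (simp add: inv add.commute[of _ "emeasure \<eta>2 _"] ennreal_add_left_cancel_le)
    also have "\<dots> \<le> emeasure (\<alpha> \<bind> Q) A" by (intro emeasure_mono) (auto simp: sets_bind_Q[OF s])
    finally show ?thesis .
  qed
  show ?thesis
  proof (rule measure_eqI)
    show "sets (\<alpha> \<bind> Q) = sets \<alpha>" by (simp add: sets_bind_Q s)
    fix A assume "A \<in> sets (\<alpha> \<bind> Q)"
    then have A[measurable]: "A \<in> sets borel" by (simp add: sets_bind_Q[OF s])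
    have split: "emeasure \<eta> A + emeasure \<eta> (- A) = emeasure \<eta> UNIV"
      if "sets \<eta> = sets borel" for \<eta> :: "'x measure"
      by (subst plus_emeasure) (auto intro!: arg_cong2[where f = emeasure] simp: that)
    have "emeasure (\<alpha> \<bind> Q) A + emeasure \<alpha> (- A) \<le> emeasure (\<alpha> \<bind> Q) A + emeasure (\<alpha> \<bind> Q) (- A)"
      by (intro add_left_mono ge) measurable
    also have "\<dots> = emeasure \<alpha> A + emeasure \<alpha> (- A)"
      by (simp add: split s sets_bind_Q emeasure_bind_Q_UNIV)
    finally have "emeasure (\<alpha> \<bind> Q) A \<le> emeasure \<alpha> A"
      using \<alpha>_le[of "- A"] by (auto simp: add.commute[of _ "emeasure \<alpha> (- A)"] ennreal_add_left_cancel_le top_unique)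
    then show "emeasure (\<alpha> \<bind> Q) A = emeasure \<alpha> A" using ge[OF A] by (rule antisym)
  qed
qed

text \<open>The positive and the negative part of \<open>\<eta>1 - \<eta>2\<close> are invariant of equal mass and live on
  complementary sets. Were the mass positive, the minorizing measure would vanish on both sets.\<close>

lemma invariant_unique:
  assumes \<eta>1: "invariant \<eta>1" and \<eta>2: "invariant \<eta>2"
  shows "\<eta>1 = \<eta>2"
proof -
  have s12: "sets \<eta>1 = sets borel" "sets \<eta>2 = sets borel" and p12: "prob_space \<eta>1" "prob_space \<eta>2"
    using \<eta>1 \<eta>2 by (auto simp: invariant_def space_prob_algebra)
  obtain Y \<alpha> \<beta> where Y': "Y \<in> sets \<eta>1" and s\<alpha>': "sets \<alpha> = sets \<eta>1" and s\<beta>': "sets \<beta> = sets \<eta>1"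
    and \<alpha>': "\<And>A. A \<in> sets \<eta>1 \<Longrightarrow> emeasure \<alpha> A + emeasure \<eta>2 (A \<inter> Y) = emeasure \<eta>1 (A \<inter> Y)"
    and \<beta>': "\<And>A. A \<in> sets \<eta>1 \<Longrightarrow> emeasure \<beta> A + emeasure \<eta>1 (A - Y) = emeasure \<eta>2 (A - Y)"
    by (rule jordan_parts[OF prob_space.finite_measure[OF p12(1)] prob_space.finite_measure[OF p12(2)]])
      (simp add: s12, rule that)
  note s\<alpha> = s\<alpha>'[unfolded s12] and s\<beta> = s\<beta>'[unfolded s12] and Y[measurable] = Y'[unfolded s12]
    and \<alpha> = \<alpha>'[unfolded s12] and \<beta> = \<beta>'[unfolded s12]
  have le1: "emeasure \<eta> A \<le> 1" if "\<eta> = \<eta>1 \<or> \<eta> = \<eta>2" for \<eta> A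
    using that p12 prob_space.measure_le_1 by auto
  have fin: "emeasure \<eta> A \<noteq> \<top>" if "\<eta> = \<eta>1 \<or> \<eta> = \<eta>2" for \<eta> A
    using le1[OF that, of A] by (auto simp: top_unique)
  have inv\<alpha>: "\<alpha> \<bind> Q = \<alpha>"
  proof (rule positive_part_invariant[OF \<eta>1 \<eta>2 s\<alpha> Y \<alpha>])
    show "emeasure \<eta>1 (A - Y) \<le> emeasure \<eta>2 (A - Y)" if "A \<in> sets borel" for A
      unfolding \<beta>[OF that, symmetric] by (rule add_increasing) auto
  qed
  have inv\<beta>: "\<beta> \<bind> Q = \<beta>"
  proof (rule positive_part_invariant[OF \<eta>2 \<eta>1 s\<beta>, of "- Y"])
    fix A :: "'x set" assume A: "A \<in> sets borel"
    show "emeasure \<beta> A + emeasure \<eta>1 (A \<inter> - Y) = emeasure \<eta>2 (A \<inter> - Y)"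
      using \<beta>[OF A] by (simp add: Diff_eq)
    show "emeasure \<eta>2 (A - - Y) \<le> emeasure \<eta>1 (A - - Y)"
      using \<alpha>[OF A] by (simp add: Diff_eq) (metis le_iff_add add.commute)
  qed measurable
  have \<alpha>_out: "emeasure \<alpha> (- Y) = 0" and \<beta>_in: "emeasure \<beta> Y = 0" using \<alpha>[of "- Y"] \<beta>[of Y] by auto
  have fin\<alpha>: "emeasure \<alpha> UNIV \<noteq> \<infinity>" and fin\<beta>: "emeasure \<beta> UNIV \<noteq> \<infinity>"
    using \<alpha>[of UNIV] \<beta>[of UNIV] fin[of \<eta>1 "UNIV \<inter> Y"] fin[of \<eta>2 "UNIV - Y"] by auto
  have mass_eq: "emeasure \<alpha> UNIV = emeasure \<beta> UNIV"
  proof -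
    have total: "emeasure \<eta> Y + emeasure \<eta> (UNIV - Y) = 1" if "\<eta> = \<eta>1 \<or> \<eta> = \<eta>2" for \<eta>
    proof -
      have "sets \<eta> = sets borel" "prob_space \<eta>" using that s12 p12 by auto
      then show ?thesis using sets_eq_imp_space_eq[of \<eta> borel] prob_space.emeasure_space_1[of \<eta>]
        by (subst plus_emeasure) auto
    qed
    have "emeasure \<alpha> UNIV + 1 = (emeasure \<alpha> UNIV + emeasure \<eta>2 Y) + emeasure \<eta>2 (UNIV - Y)"
      using total[of \<eta>2] by (simp add: add.assoc)
    also have "\<dots> = emeasure \<eta>1 Y + (emeasure \<beta> UNIV + emeasure \<eta>1 (UNIV - Y))"
      using \<alpha>[of UNIV] \<beta>[of UNIV] by simp
    also have "\<dots> = emeasure \<beta> UNIV + 1" using total[of \<eta>1] by (simp add: ac_simps)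
    finally show ?thesis by (simp add: add.commute[of _ 1] ennreal_add_left_cancel)
  qed
  have mass_0: "emeasure \<alpha> UNIV = 0"
  proof (rule ccontr)
    assume "emeasure \<alpha> UNIV \<noteq> 0"
    then have "emeasure \<nu> (- Y) = 0" "emeasure \<nu> Y = 0"
      using null_sets_of_finite_invariant[OF s\<alpha> inv\<alpha> _ fin\<alpha> _ \<alpha>_out]
        null_sets_of_finite_invariant[OF s\<beta> inv\<beta> _ fin\<beta> Y \<beta>_in] mass_eq by auto
    moreover have "emeasure \<nu> Y + emeasure \<nu> (- Y) = 1"
      using \<nu> in_space_prob_algebra[OF \<nu>] by (subst plus_emeasure) (auto simp: space_prob_algebra)
    ultimately show False by simp
  qed
  show ?thesis
  proof (rule measure_eqI)
    fix A assume "A \<in> sets \<eta>1"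
    then have A[measurable]: "A \<in> sets borel" by (simp add: s12)
    have "emeasure \<alpha> A \<le> emeasure \<alpha> UNIV" "emeasure \<beta> A \<le> emeasure \<beta> UNIV"
      by (auto intro!: emeasure_mono simp: s\<alpha> s\<beta>)
    then have zero: "emeasure \<alpha> A = 0" "emeasure \<beta> A = 0" using mass_0 mass_eq by auto
    have split: "emeasure \<eta> (A \<inter> Y) + emeasure \<eta> (A - Y) = emeasure \<eta> A"
      if "sets \<eta> = sets borel" for \<eta> :: "'x measure"
      by (subst plus_emeasure) (auto intro!: arg_cong2[where f = emeasure] simp: that)
    show "emeasure \<eta>1 A = emeasure \<eta>2 A"
      using \<alpha>[OF A] \<beta>[OF A] split[OF s12(1)] split[OF s12(2)] zero by simp
  qed (simp add: s12)
qed

text \<open>Started in \<open>\<nu>\<close>, the chain regenerates at each visit to \<open>C\<close> with probability \<open>\<gamma>\<close>, and \<open>taboo n\<close> is its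
  law at time \<open>n\<close> restricted to no regeneration so far: it is \<open>\<nu> R\<^sup>n\<close> for the substochastic kernel
  \<open>R = Q - \<gamma> 1\<^sub>C \<otimes> \<nu>\<close>.\<close>

primrec taboo :: "nat \<Rightarrow> 'x measure" where
  "taboo 0 = \<nu>"
| "taboo (Suc n) = diff_measure (taboo n \<bind> Q) (scale_measure (ennreal \<gamma> * emeasure (taboo n) C) \<nu>)"

text \<open>The minorization makes the subtracted measure the smaller one, and the bound on the mass makes both
  finite; so \<^const>\<open>diff_measure\<close> is the difference on every set.\<close>

lemma taboo_props:
  "sets (taboo n) = sets borel \<and> emeasure (taboo n) UNIV \<le> 1 \<and>
   (\<forall>A\<in>sets borel. emeasure (taboo (Suc n)) A + ennreal \<gamma> * emeasure (taboo n) C * emeasure \<nu> A =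
      emeasure (taboo n \<bind> Q) A)"
proof -
  have s\<nu>: "sets \<nu> = sets borel" and \<nu>_UNIV: "emeasure \<nu> UNIV = 1"
    using \<nu> in_space_prob_algebra[OF \<nu>] by (auto simp: space_prob_algebra)
  have step: "emeasure (taboo (Suc n)) A + ennreal \<gamma> * emeasure (taboo n) C * emeasure \<nu> A =
      emeasure (taboo n \<bind> Q) A"
    if s: "sets (taboo n) = sets borel" and mass: "emeasure (taboo n) UNIV \<le> 1" and A: "A \<in> sets borel" for n A
  proof -
    let ?Q = "taboo n \<bind> Q" and ?\<nu> = "scale_measure (ennreal \<gamma> * emeasure (taboo n) C) \<nu>"
    have sQ: "sets ?Q = sets borel" by (rule sets_bind_Q[OF s])
    have spaces: "space ?Q = UNIV" "space ?\<nu> = UNIV"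
      using sets_eq_imp_space_eq[OF sQ] sets_eq_imp_space_eq[OF s\<nu>] by (auto simp: space_scale_measure)
    have "emeasure (taboo n) C \<le> emeasure (taboo n) UNIV" by (intro emeasure_mono) (auto simp: s)
    then have "emeasure (taboo n) C \<noteq> \<top>" using mass by (auto simp: top_unique)
    then have fin: "finite_measure ?Q" "finite_measure ?\<nu>"
      using mass by (auto intro!: finite_measureI simp: spaces emeasure_bind_Q_UNIV[OF s] \<nu>_UNIV top_unique
          ennreal_mult_eq_top_iff)
    have le: "emeasure ?\<nu> A \<le> emeasure ?Q A" if "A \<in> sets borel" for A
      using bind_Q_ge_minorization[OF s that] by simp
    have "emeasure (taboo (Suc n)) A = emeasure ?Q A - emeasure ?\<nu> A"
      unfolding taboo.simps using le A by (intro emeasure_diff_measure fin) (auto simp: sQ s\<nu>)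
    then show ?thesis using le[OF A] by (simp add: diff_add_cancel_ennreal)
  qed
  have "sets (taboo n) = sets borel \<and> emeasure (taboo n) UNIV \<le> 1"
  proof (induction n)
    case (Suc n)
    then have "emeasure (taboo (Suc n)) UNIV \<le> emeasure (taboo n \<bind> Q) UNIV"
      using step[of n UNIV] by (metis le_iff_add sets.top space_borel)
    then show ?case using Suc by (auto simp: sets_bind_Q emeasure_bind_Q_UNIV)
  qed (simp add: s\<nu> \<nu>_UNIV)
  then show ?thesis using step by blast
qed

lemma sets_taboo: "sets (taboo n) = sets borel" using taboo_props by blast

lemma taboo_subprob: "taboo n \<in> space (subprob_algebra borel)"
  using taboo_props[of n] sets_eq_imp_space_eq[OF sets_taboo[of n]]
  by (auto simp: space_subprob_algebra intro!: subprob_spaceI)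

lemma taboo_Suc:
  "A \<in> sets borel \<Longrightarrow>
     emeasure (taboo (Suc n)) A + ennreal \<gamma> * emeasure (taboo n) C * emeasure \<nu> A = emeasure (taboo n \<bind> Q) A"
  using taboo_props by blast

lemma nn_integral_taboo_Suc_le:
  assumes f: "f \<in> borel_measurable borel"
  shows "(\<integral>\<^sup>+x. f x \<partial>taboo (Suc n)) \<le> (\<integral>\<^sup>+x. \<integral>\<^sup>+y. f y \<partial>Q x \<partial>taboo n)"
proof -
  have s: "sets (taboo (Suc n)) = sets (taboo n \<bind> Q)" by (simp only: sets_bind_Q[OF sets_taboo] sets_taboo)
  have "emeasure (taboo (Suc n)) A \<le> emeasure (taboo n \<bind> Q) A" if "A \<in> sets borel" for A
    using taboo_Suc[OF that] by (metis le_iff_add)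
  then have "taboo (Suc n) \<le> taboo n \<bind> Q" by (subst le_measure[OF s]) (auto simp only: sets_taboo)
  from nn_integral_mono_measure[OF s this, of f] show ?thesis
    by (simp only: nn_integral_bind_Q[OF sets_taboo f])
qed

text \<open>At time \<open>N\<close> the chain has either regenerated at an earlier step or is still counted by \<open>taboo N\<close>.\<close>

lemma taboo_total:
  "(\<Sum>n<N. ennreal \<gamma> * emeasure (taboo n) C) + emeasure (taboo N) UNIV = 1"
proof (induction N)
  case (Suc N)
  have "emeasure (taboo (Suc N)) UNIV + ennreal \<gamma> * emeasure (taboo N) C = emeasure (taboo N) UNIV"
    using taboo_Suc[of UNIV N] in_space_prob_algebra[OF \<nu>] by (simp add: emeasure_bind_Q_UNIV sets_taboo del: taboo.simps)
  then have "emeasure (taboo N) UNIV = ennreal \<gamma> * emeasure (taboo N) C + emeasure (taboo (Suc N)) UNIV"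
    by (simp only: add.commute)
  with Suc show ?case by (simp add: add.assoc del: taboo.simps)
qed (use in_space_prob_algebra[OF \<nu>] in simp)

text \<open>The drift inequality summed over the first \<open>N\<close> steps of a cycle, which starts in \<open>C\<close>.\<close>

lemma taboo_drift:
  "(\<integral>\<^sup>+x. ennreal (W x) \<partial>taboo N) + (\<Sum>n<N. ennreal \<beta>1 * emeasure (taboo n) (- C)) \<le>
     ennreal B + (\<Sum>n<N. ennreal \<beta>2 * emeasure (taboo n) C)"
proof (induction N)
  case 0
  have "AE x in \<nu>. x \<in> C"
  proof -
    have "prob_space \<nu>" "sets \<nu> = sets borel" using \<nu> by (auto simp: space_prob_algebra)
    then show ?thesis using \<nu>_C prob_space.AE_in_set_eq_1[of \<nu> C] by (simp add: measure_def)
  qed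
  then have "(\<integral>\<^sup>+x. ennreal (W x) \<partial>\<nu>) \<le> (\<integral>\<^sup>+x. ennreal B \<partial>\<nu>)"
    by (intro nn_integral_mono_AE) (auto intro: ennreal_leI W_le)
  also have "\<dots> = ennreal B"
    using \<nu> by (simp add: space_prob_algebra prob_space.emeasure_space_1)
  finally show ?case by simp
next
  case (Suc N)
  note [measurable_cong] = sets_taboo[of N]
  have "(\<integral>\<^sup>+x. ennreal (W x) \<partial>taboo (Suc N)) + ennreal \<beta>1 * emeasure (taboo N) (- C) \<le>
      (\<integral>\<^sup>+x. \<integral>\<^sup>+y. ennreal (W y) \<partial>Q x \<partial>taboo N) + (\<integral>\<^sup>+x. ennreal \<beta>1 * indicator (- C) x \<partial>taboo N)"
    by (intro add_mono nn_integral_taboo_Suc_le) (auto simp: nn_integral_cmult)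
  also have "\<dots> = (\<integral>\<^sup>+x. (\<integral>\<^sup>+y. ennreal (W y) \<partial>Q x) + ennreal \<beta>1 * indicator (- C) x \<partial>taboo N)"
    by (subst nn_integral_add) auto
  also have "\<dots> \<le> (\<integral>\<^sup>+x. ennreal (W x) + ennreal \<beta>2 * indicator C x \<partial>taboo N)"
  proof (rule nn_integral_mono)
    fix x
    have "ennreal \<beta>1 * indicator (- C) x \<le> ennreal (\<beta>1 * W x) * indicator (- C) x"
      using \<beta>1 W_ge_1[of x] by (intro mult_right_mono ennreal_leI) auto
    then show "(\<integral>\<^sup>+y. ennreal (W y) \<partial>Q x) + ennreal \<beta>1 * indicator (- C) x \<le>
        ennreal (W x) + ennreal \<beta>2 * indicator C x"
      using drift[of x] by (meson add_left_mono order_trans)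
  qed
  also have "\<dots> = (\<integral>\<^sup>+x. ennreal (W x) \<partial>taboo N) + ennreal \<beta>2 * emeasure (taboo N) C"
    by (subst nn_integral_add) (auto simp: nn_integral_cmult)
  finally have "(\<integral>\<^sup>+x. ennreal (W x) \<partial>taboo (Suc N)) + ennreal \<beta>1 * emeasure (taboo N) (- C) +
      (\<Sum>n<N. ennreal \<beta>1 * emeasure (taboo n) (- C)) \<le>
      ((\<integral>\<^sup>+x. ennreal (W x) \<partial>taboo N) + ennreal \<beta>2 * emeasure (taboo N) C) +
      (\<Sum>n<N. ennreal \<beta>1 * emeasure (taboo n) (- C))"
    by (rule add_right_mono)
  also have "\<dots> \<le> (ennreal B + (\<Sum>n<N. ennreal \<beta>2 * emeasure (taboo n) C)) + ennreal \<beta>2 * emeasure (taboo N) C"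
    using add_right_mono[OF Suc, of "ennreal \<beta>2 * emeasure (taboo N) C"] by (simp add: ac_simps)
  finally show ?case by (simp add: ac_simps del: taboo.simps)
qed

text \<open>The mean length of a cycle is finite: \<open>taboo_total\<close> bounds the time spent in \<open>C\<close> by
  \<open>1 / \<gamma>\<close>, and then \<open>taboo_drift\<close> bounds the time spent outside.\<close>

lemma taboo_mass_summable: "(\<Sum>n. emeasure (taboo n) UNIV) < \<infinity>"
proof -
  have C_part: "(\<Sum>n<N. emeasure (taboo n) C) \<le> ennreal (1 / \<gamma>)" for N
  proof -
    have "(\<Sum>n<N. emeasure (taboo n) C) = ennreal (1 / \<gamma>) * (ennreal \<gamma> * (\<Sum>n<N. emeasure (taboo n) C))"
      using \<gamma> by (simp add: mult.assoc[symmetric] ennreal_mult[symmetric])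
    also have "\<dots> \<le> ennreal (1 / \<gamma>) * 1"
      using taboo_total[of N] by (intro mult_left_mono) (auto simp: sum_distrib_left le_iff_add intro: sym)
    finally show ?thesis by simp
  qed
  define K where "K = ennreal (1 / \<beta>1) * (ennreal B + ennreal \<beta>2 * ennreal (1 / \<gamma>))"
  have out_part: "(\<Sum>n<N. emeasure (taboo n) (- C)) \<le> K" for N
  proof -
    have "ennreal \<beta>1 * (\<Sum>n<N. emeasure (taboo n) (- C)) \<le>
        (\<integral>\<^sup>+x. ennreal (W x) \<partial>taboo N) + ennreal \<beta>1 * (\<Sum>n<N. emeasure (taboo n) (- C))"
      by (simp add: add_increasing)
    also have "\<dots> \<le> ennreal B + ennreal \<beta>2 * (\<Sum>n<N. emeasure (taboo n) C)"
      using taboo_drift[of N] by (simp add: sum_distrib_left)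
    also have "\<dots> \<le> ennreal B + ennreal \<beta>2 * ennreal (1 / \<gamma>)"
      by (intro add_left_mono mult_left_mono C_part) simp
    finally have "ennreal (1 / \<beta>1) * (ennreal \<beta>1 * (\<Sum>n<N. emeasure (taboo n) (- C))) \<le> K"
      unfolding K_def by (intro mult_left_mono) auto
    then show ?thesis using \<beta>1 by (simp add: mult.assoc[symmetric] ennreal_mult[symmetric])
  qed
  have "(\<Sum>n<N. emeasure (taboo n) UNIV) \<le> ennreal (1 / \<gamma>) + K" for N
  proof -
    have "emeasure (taboo n) UNIV = emeasure (taboo n) C + emeasure (taboo n) (- C)" for n
      by (subst plus_emeasure) (auto simp: sets_taboo)
    then show ?thesis using add_mono[OF C_part out_part] by (simp add: sum.distrib)
  qed
  then have "(\<Sum>n. emeasure (taboo n) UNIV) \<le> ennreal (1 / \<gamma>) + K"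
    by (intro suminf_le_const) auto
  also have "\<dots> < \<infinity>" by (simp add: K_def ennreal_mult_less_top)
  finally show ?thesis .
qed

lemma taboo_returns: "(\<Sum>n. ennreal \<gamma> * emeasure (taboo n) C) = 1"
proof -
  let ?a = "\<lambda>n. ennreal \<gamma> * emeasure (taboo n) C"
  have "(\<lambda>n. emeasure (taboo n) UNIV) \<longlonglongrightarrow> 0"
  proof -
    have fin: "emeasure (taboo n) UNIV \<noteq> \<top>" for n
      using taboo_props[of n] by (auto simp: top_unique)
    have eq: "emeasure (taboo n) UNIV = ennreal (measure (taboo n) UNIV)" for n
      using fin[of n] by (simp add: measure_def less_top)
    have "(\<Sum>n. ennreal (measure (taboo n) UNIV)) \<noteq> \<top>"
      using taboo_mass_summable by (simp add: eq[symmetric])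
    then have "summable (\<lambda>n. measure (taboo n) UNIV)" by (rule summable_suminf_not_top[rotated]) simp
    then have "(\<lambda>n. measure (taboo n) UNIV) \<longlonglongrightarrow> 0" by (rule summable_LIMSEQ_zero)
    then show ?thesis unfolding eq using tendsto_ennrealI by fastforce
  qed
  moreover have "(\<lambda>N. \<Sum>n<N. ?a n) \<longlonglongrightarrow> (\<Sum>n. ?a n)" by (intro summable_LIMSEQ) simp
  ultimately have "(\<lambda>N. (\<Sum>n<N. ?a n) + emeasure (taboo N) UNIV) \<longlonglongrightarrow> (\<Sum>n. ?a n) + 0"
    by (intro tendsto_add)
  then show ?thesis unfolding taboo_total by (simp add: LIMSEQ_const_iff)
qed

text \<open>The expected occupation \<open>m\<close> of a cycle is invariant, since the steps that end the cycle restart it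
  in \<open>\<nu>\<close>, with total probability 1 by \<open>taboo_returns\<close>.\<close>

lemma invariant_exists: "\<exists>\<eta>. invariant \<eta>"
proof -
  define m where "m = count_space UNIV \<bind> taboo"
  have taboo_kernel: "taboo \<in> count_space UNIV \<rightarrow>\<^sub>M subprob_algebra borel"
    by (simp add: measurable_count_space_eq1 taboo_subprob)
  have s: "sets m = sets borel" unfolding m_def by (intro sets_bind sets_taboo) auto
  have m_int: "(\<integral>\<^sup>+x. f x \<partial>m) = (\<Sum>n. \<integral>\<^sup>+x. f x \<partial>taboo n)" if "f \<in> borel_measurable borel" for f
    unfolding m_def nn_integral_bind[OF that taboo_kernel] by (simp add: nn_integral_count_space_nat)
  have m: "emeasure m A = (\<Sum>n. emeasure (taboo n) A)" if "A \<in> sets borel" for A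
    using m_int[of "indicator A"] that by (simp add: s sets_taboo)
  have inv: "m \<bind> Q = m"
  proof (rule measure_eqI)
    show "sets (m \<bind> Q) = sets m" by (simp add: sets_bind_Q s)
    fix A assume "A \<in> sets (m \<bind> Q)"
    then have A[measurable]: "A \<in> sets borel" by (simp add: sets_bind_Q[OF s])
    have "emeasure (m \<bind> Q) A = (\<Sum>n. emeasure (taboo n \<bind> Q) A)"
      unfolding emeasure_bind_Q[OF s A] emeasure_bind_Q[OF sets_taboo A] by (rule m_int) measurable
    also have "\<dots> = (\<Sum>n. emeasure (taboo (Suc n)) A) + (\<Sum>n. ennreal \<gamma> * emeasure (taboo n) C * emeasure \<nu> A)"
      by (subst suminf_add) (simp_all only: taboo_Suc[OF A] summableI)
    also have "(\<Sum>n. ennreal \<gamma> * emeasure (taboo n) C * emeasure \<nu> A) = emeasure (taboo 0) A"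
      using taboo_returns by (simp add: ennreal_suminf_multc)
    also have "(\<Sum>n. emeasure (taboo (Suc n)) A) + emeasure (taboo 0) A = emeasure m A"
      unfolding m[OF A] using suminf_offset[of "\<lambda>n. emeasure (taboo n) A" 1] by (simp add: add.commute del: taboo.simps)
    finally show "emeasure (m \<bind> Q) A = emeasure m A" .
  qed
  have "emeasure m UNIV \<noteq> 0"
  proof -
    have "emeasure (taboo 0) UNIV = 1" using in_space_prob_algebra[OF \<nu>] by simp
    then have "1 \<le> (\<Sum>n. emeasure (taboo n) UNIV)" 
      using sum_le_suminf[of "\<lambda>n. emeasure (taboo n) UNIV" "{0}"] by (simp del: taboo.simps)
    then show ?thesis by (simp add: m) auto
  qed
  moreover have "emeasure m UNIV \<noteq> \<infinity>" using taboo_mass_summable by (simp add: m)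
  ultimately show ?thesis using scaled_invariant[OF s inv] by blast
qed

end

section \<open>One step of the controlled chain\<close>

definition step ::
  "('x::polish_space \<Rightarrow> 'u::polish_space \<Rightarrow> 'x measure) \<Rightarrow> ('x \<Rightarrow> 'u measure) \<Rightarrow> 'x \<Rightarrow> 'x measure" where
  "step P v x = v x \<bind> P x"

lemma measurable_stochastic_kernel:
  "stochastic_kernel P \<Longrightarrow> (\<lambda>(x, u). P x u) \<in> borel \<Otimes>\<^sub>M borel \<rightarrow>\<^sub>M prob_algebra borel"
  by (simp add: stochastic_kernel_def borel_prod)

lemma measurable_step [measurable]:
  assumes "stochastic_kernel P" "v \<in> stationary_controls"
  shows "step P v \<in> borel \<rightarrow>\<^sub>M prob_algebra borel"
  unfolding step_def
  using assms(2) measurable_stochastic_kernel[OF assms(1)]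
  by (intro measurable_bind_prob_space2) (auto simp: stationary_controls_def)

text \<open>The path law is built by Ionescu-Tulcea from a Dirac measure and the one-step kernels; its
  marginal on the first two times is the Dirac measure at \<open>x\<close> followed by one step.\<close>

lemma distr_stationary_law_1:
  fixes P :: "'x::polish_space \<Rightarrow> 'u::polish_space \<Rightarrow> 'x measure"
  assumes P: "stochastic_kernel P" and v: "v \<in> stationary_controls"
  shows "(\<lambda>\<omega>. \<omega> 1) \<in> stationary_law P v x \<rightarrow>\<^sub>M borel"
    and "distr (stationary_law P v x) borel (\<lambda>\<omega>. \<omega> 1) = step P v x"
proof -
  let ?M = "\<lambda>_ :: nat. borel :: 'x measure"
  define \<kappa> where "\<kappa> i \<omega> = (case i of 0 \<Rightarrow> return borel x | Suc n \<Rightarrow> v (\<omega> n) \<bind> P (\<omega> n))"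
    for i :: nat and \<omega> :: "nat \<Rightarrow> 'x"
  have \<kappa>_prob: "\<kappa> i \<in> PiM {0..<i} ?M \<rightarrow>\<^sub>M prob_algebra borel" for i
  proof (cases i)
    case 0
    then show ?thesis by (simp add: \<kappa>_def[abs_def] space_prob_algebra prob_space_return)
  next
    case (Suc n)
    have "(\<lambda>\<omega>. \<omega> n) \<in> PiM {0..<i} ?M \<rightarrow>\<^sub>M borel"
      using Suc by (intro measurable_component_singleton) auto
    from measurable_compose[OF this measurable_step[OF P v]] show ?thesis
      by (simp add: \<kappa>_def[abs_def] Suc step_def)
  qed
  have \<kappa>_sub: "\<kappa> i \<in> PiM {0..<i} ?M \<rightarrow>\<^sub>M subprob_algebra borel" for i
    by (rule measurable_prob_algebraD) (rule \<kappa>_prob)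
  have "prob_space (\<kappa> i \<omega>)" if "\<omega> \<in> space (PiM {0..<i} ?M)" for i \<omega>
    using measurable_space[OF \<kappa>_prob that] by (simp add: space_prob_algebra)
  then interpret IT: Ionescu_Tulcea \<kappa> ?M by (intro Ionescu_Tulcea.intro \<kappa>_sub)
  have law: "stationary_law P v x = IT.PF.lim"
    unfolding chain_law_def \<kappa>_def[abs_def] by simp
  have sets_law: "sets (stationary_law P v x) = sets (PiM UNIV ?M)" by (simp add: law)
  show meas: "(\<lambda>\<omega>. \<omega> 1) \<in> stationary_law P v x \<rightarrow>\<^sub>M borel"
    by (subst measurable_cong_sets[OF sets_law refl]) (rule measurable_component_singleton, simp)
  let ?u = "\<lambda>_ :: nat. undefined :: 'x"
  let ?P2 = "PiM {0..<2} ?M"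
  have "?u \<in> space (PiM {0..<0} ?M)" by (simp add: space_PiM)
  note u = this
  have C2: "IT.C 0 2 ?u = distr (step P v x) ?P2 (fun_upd (?u(0 := x)) 1)"
  proof -
    have x0: "?u(0 := x) \<in> space (PiM {0..<Suc 0} ?M)" by (simp add: space_PiM PiE_iff extensional_def)
    have e0: "IT.eP 0 ?u = return (PiM {0..<Suc 0} ?M) (?u(0 := x))"
    proof -
      have "fun_upd ?u 0 \<in> borel \<rightarrow>\<^sub>M PiM {0..<Suc 0} ?M"
        by (rule measurable_fun_upd[where J = "{0..<0}"]) (auto intro: u)
      then show ?thesis unfolding IT.eP_def \<kappa>_def by (simp add: distr_return)
    qed
    have "IT.C 0 2 ?u = (return (PiM {0..<0} ?M) ?u \<bind> IT.eP 0) \<bind> IT.eP 1"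
      by (simp add: numeral_2_eq_2)
    also have "return (PiM {0..<0} ?M) ?u \<bind> IT.eP 0 = IT.eP 0 ?u"
      by (rule bind_return[OF IT.measurable_eP u])
    also have "IT.eP 0 ?u \<bind> IT.eP 1 = IT.eP 1 (?u(0 := x))"
      unfolding e0 using IT.measurable_eP[of 1] x0 by (intro bind_return) auto
    also have "IT.eP 1 (?u(0 := x)) = distr (step P v x) ?P2 (fun_upd (?u(0 := x)) 1)"
      by (simp add: IT.eP_def \<kappa>_def step_def numeral_2_eq_2)
    finally show ?thesis .
  qed
  have "distr (stationary_law P v x) borel (\<lambda>\<omega>. \<omega> 1) =
      distr (distr IT.PF.lim ?P2 (\<lambda>\<omega>. restrict \<omega> {0..<2})) borel (\<lambda>\<omega>. \<omega> 1)"
  proof -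
    have m1: "(\<lambda>\<omega>. restrict \<omega> {0..<2}) \<in> IT.PF.lim \<rightarrow>\<^sub>M ?P2"
      by (subst measurable_cong_sets[OF IT.PF.sets_lim refl]) (rule measurable_restrict_subset, simp)
    have m2: "(\<lambda>\<omega>. \<omega> 1) \<in> ?P2 \<rightarrow>\<^sub>M borel" by (rule measurable_component_singleton) simp
    show ?thesis unfolding law distr_distr[OF m2 m1] by (rule distr_cong) auto
  qed
  also have "distr IT.PF.lim ?P2 (\<lambda>\<omega>. restrict \<omega> {0..<2}) = IT.CI {0..<2}" by (rule IT.distr_lim) simp
  also have "IT.CI {0..<2} = IT.C 0 2 ?u"
  proof (rule measure_eqI)
    show s: "sets (IT.CI {0..<2}) = sets (IT.C 0 2 ?u)"
      using IT.PF.sets_P[of "{0..<2}"] IT.sets_C[OF u, of 2] by (simp add: numeral_2_eq_2)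
    fix X assume "X \<in> sets (IT.CI {0..<2})"
    then have X: "X \<in> sets ?P2" using IT.PF.sets_P[of "{0..<2}"] by simp
    then show "emeasure (IT.CI {0..<2}) X = emeasure (IT.C 0 2 ?u) X"
      using sets.sets_into_space[OF X]
      by (subst IT.emeasure_CI[of _ 2]) (simp_all add: prod_emb_id space_PiM)
  qed
  also have "distr (IT.C 0 2 ?u) borel (\<lambda>\<omega>. \<omega> 1) = step P v x"
  proof -
    have s: "sets (step P v x) = sets borel"
      using measurable_space[OF measurable_step[OF P v], of x] by (simp add: space_prob_algebra)
    have "fun_upd (?u(0 := x)) 1 \<in> borel \<rightarrow>\<^sub>M ?P2"
      by (rule measurable_fun_upd[where J = "{0..<1}"])
        (auto simp: space_PiM PiE_iff extensional_def numeral_2_eq_2)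
    then have m1: "fun_upd (?u(0 := x)) 1 \<in> step P v x \<rightarrow>\<^sub>M ?P2" by (simp cong: measurable_cong_sets add: s)
    have m2: "(\<lambda>\<omega>. \<omega> 1) \<in> ?P2 \<rightarrow>\<^sub>M borel" by (rule measurable_component_singleton) simp
    show ?thesis unfolding C2 distr_distr[OF m2 m1] by (simp add: o_def distr_id2[OF s[symmetric]])
  qed
  finally show "distr (stationary_law P v x) borel (\<lambda>\<omega>. \<omega> 1) = step P v x" .
qed

lemma integral_stationary_law:
  fixes f :: "'x::polish_space \<Rightarrow> real"
  assumes "stochastic_kernel P" "v \<in> stationary_controls" "f \<in> borel_measurable borel"
  shows "(\<integral>\<omega>. f (\<omega> 1) \<partial>stationary_law P v x) = (\<integral>y. f y \<partial>step P v x)"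
  unfolding distr_stationary_law_1(2)[OF assms(1,2), symmetric]
  by (rule integral_distr[symmetric, OF distr_stationary_law_1(1)[OF assms(1,2)] assms(3)])

text \<open>Fubini's theorem for a kernel and a function that is integrable but not bounded.\<close>

lemma integral_bind_kernel:
  fixes f :: "'b \<Rightarrow> real"
  assumes \<eta>: "\<eta> \<in> space (prob_algebra M)" and N: "N \<in> M \<rightarrow>\<^sub>M prob_algebra K"
    and f[measurable]: "f \<in> borel_measurable K" and fin: "(\<integral>\<^sup>+y. ennreal \<bar>f y\<bar> \<partial>(\<eta> \<bind> N)) < \<infinity>"
  shows "AE x in \<eta>. integrable (N x) f" "integrable \<eta> (\<lambda>x. \<integral>y. f y \<partial>N x)"
    "(\<integral>y. f y \<partial>(\<eta> \<bind> N)) = (\<integral>x. \<integral>y. f y \<partial>N x \<partial>\<eta>)"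
proof -
  have s[measurable_cong]: "sets \<eta> = sets M" and "prob_space \<eta>" using \<eta> by (auto simp: space_prob_algebra)
  have spM: "space \<eta> = space M" by (rule sets_eq_imp_space_eq[OF s])
  have N'[measurable]: "N \<in> \<eta> \<rightarrow>\<^sub>M subprob_algebra K"
    using measurable_prob_algebraD[OF N] by (simp cong: measurable_cong_sets)
  have sN: "sets (N x) = sets K" if "x \<in> space \<eta>" for x
    using measurable_space[OF N, of x] that by (simp add: space_prob_algebra spM)
  have int: "(\<integral>\<^sup>+y. g y \<partial>(\<eta> \<bind> N)) = (\<integral>\<^sup>+x. \<integral>\<^sup>+y. g y \<partial>N x \<partial>\<eta>)" if "g \<in> borel_measurable K" for g
    by (rule nn_integral_bind[OF that N'])
  have "(\<integral>\<^sup>+x. \<integral>\<^sup>+y. ennreal \<bar>f y\<bar> \<partial>N x \<partial>\<eta>) \<noteq> \<infinity>" using fin by (subst (asm) int) auto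
  then have "AE x in \<eta>. (\<integral>\<^sup>+y. ennreal \<bar>f y\<bar> \<partial>N x) \<noteq> \<infinity>"
    by (intro nn_integral_PInf_AE) auto
  then have ae: "AE x in \<eta>. (\<integral>\<^sup>+y. ennreal \<bar>f y\<bar> \<partial>N x) < \<infinity>" by (simp add: less_top)
  show ae_int: "AE x in \<eta>. integrable (N x) f"
    using ae AE_space
  proof eventually_elim
    case (elim x)
    then show ?case using sN[of x] by (intro integrableI_bounded) (auto cong: measurable_cong_sets)
  qed
  have sb: "sets (\<eta> \<bind> N) = sets K" by (rule sets_bind'[OF \<eta> N])
  have int_bind: "integrable (\<eta> \<bind> N) f"
    using fin by (intro integrableI_bounded) (auto simp: sb cong: measurable_cong_sets)
  have m[measurable]: "(\<lambda>x. \<integral>y. f y \<partial>N x) \<in> borel_measurable \<eta>"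
    by (rule measurable_compose[OF N' integral_measurable_subprob_algebra]) (rule f)
  show "integrable \<eta> (\<lambda>x. \<integral>y. f y \<partial>N x)"
  proof (rule integrableI_bounded[OF m])
    have "(\<integral>\<^sup>+x. ennreal (norm (\<integral>y. f y \<partial>N x)) \<partial>\<eta>) \<le> (\<integral>\<^sup>+x. \<integral>\<^sup>+y. ennreal \<bar>f y\<bar> \<partial>N x \<partial>\<eta>)"
      using ae_int by (intro nn_integral_mono_AE) (auto elim!: eventually_mono dest: integral_norm_bound_ennreal)
    also have "\<dots> < \<infinity>" using fin by (subst (asm) int) auto
    finally show "(\<integral>\<^sup>+x. ennreal (norm (\<integral>y. f y \<partial>N x)) \<partial>\<eta>) < \<infinity>" .
  qed
  have part: "integrable \<eta> (\<lambda>x. enn2real (\<integral>\<^sup>+y. ennreal (g y) \<partial>N x)) \<and>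
      (\<integral>x. enn2real (\<integral>\<^sup>+y. ennreal (g y) \<partial>N x) \<partial>\<eta>) = enn2real (\<integral>\<^sup>+y. ennreal (g y) \<partial>(\<eta> \<bind> N))"
    if g[measurable]: "g \<in> borel_measurable K" and le: "\<And>y. g y \<le> \<bar>f y\<bar>" for g
  proof -
    have "AE x in \<eta>. ennreal (enn2real (\<integral>\<^sup>+y. ennreal (g y) \<partial>N x)) = (\<integral>\<^sup>+y. ennreal (g y) \<partial>N x)"
      using ae
    proof eventually_elim
      case (elim x)
      have "(\<integral>\<^sup>+y. ennreal (g y) \<partial>N x) \<le> (\<integral>\<^sup>+y. ennreal \<bar>f y\<bar> \<partial>N x)"
        by (intro nn_integral_mono ennreal_leI le)
      then show ?case using elim by (simp add: order_le_less_trans)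
    qed
    then have eq: "(\<integral>\<^sup>+x. ennreal (enn2real (\<integral>\<^sup>+y. ennreal (g y) \<partial>N x)) \<partial>\<eta>) = (\<integral>\<^sup>+y. ennreal (g y) \<partial>(\<eta> \<bind> N))"
      by (subst int) (auto intro: nn_integral_cong_AE)
    also have "\<dots> \<le> (\<integral>\<^sup>+y. ennreal \<bar>f y\<bar> \<partial>(\<eta> \<bind> N))" by (intro nn_integral_mono ennreal_leI le)
    finally have fin': "(\<integral>\<^sup>+x. ennreal (enn2real (\<integral>\<^sup>+y. ennreal (g y) \<partial>N x)) \<partial>\<eta>) < \<infinity>"
      using fin by (rule order_le_less_trans)
    have meas: "(\<lambda>x. enn2real (\<integral>\<^sup>+y. ennreal (g y) \<partial>N x)) \<in> borel_measurable \<eta>" by measurable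
    show ?thesis
      using fin' meas by (auto intro!: integrableI_bounded simp: integral_eq_nn_integral eq)
  qed
  have "(\<integral>x. \<integral>y. f y \<partial>N x \<partial>\<eta>) =
      (\<integral>x. enn2real (\<integral>\<^sup>+y. ennreal (f y) \<partial>N x) - enn2real (\<integral>\<^sup>+y. ennreal (- f y) \<partial>N x) \<partial>\<eta>)"
    using ae_int by (intro integral_cong_AE) (auto elim!: eventually_mono simp: real_lebesgue_integral_def)
  also have "\<dots> = enn2real (\<integral>\<^sup>+y. ennreal (f y) \<partial>(\<eta> \<bind> N)) - enn2real (\<integral>\<^sup>+y. ennreal (- f y) \<partial>(\<eta> \<bind> N))"
    using part[of f] part[of "\<lambda>y. - f y"] by simp
  also have "\<dots> = (\<integral>y. f y \<partial>(\<eta> \<bind> N))" using int_bind by (simp add: real_lebesgue_integral_def)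
  finally show "(\<integral>y. f y \<partial>(\<eta> \<bind> N)) = (\<integral>x. \<integral>y. f y \<partial>N x \<partial>\<eta>)" by simp
qed

lemma invariant_measure_iff:
  assumes P: "stochastic_kernel P" and v: "v \<in> stationary_controls"
  shows "invariant_measure P v \<eta> \<longleftrightarrow> \<eta> \<in> space (prob_algebra borel) \<and> \<eta> \<bind> step P v = \<eta>"
proof (cases "\<eta> \<in> space (prob_algebra borel)")
  case True
  note Q = measurable_step[OF P v]
  have pb: "prob_space (\<eta> \<bind> step P v)" "sets (\<eta> \<bind> step P v) = sets borel"
    using prob_space_bind'[OF True Q] sets_bind'[OF True Q] by auto
  have \<eta>: "prob_space \<eta>" "sets \<eta> = sets borel" using True by (auto simp: space_prob_algebra)
  have eq: "(\<integral>y. (\<integral>\<omega>. f (\<omega> 1) \<partial>stationary_law P v y) \<partial>\<eta>) = (\<integral>x. f x \<partial>(\<eta> \<bind> step P v))"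
    if f: "f \<in> borel_measurable borel" "bounded (range f)" for f :: "'a \<Rightarrow> real"
  proof -
    obtain b where b: "\<And>x. \<bar>f x\<bar> \<le> b" using f(2) by (auto simp: bounded_iff)
    have "(\<integral>\<^sup>+y. ennreal \<bar>f y\<bar> \<partial>(\<eta> \<bind> step P v)) \<le> (\<integral>\<^sup>+y. ennreal b \<partial>(\<eta> \<bind> step P v))"
      by (intro nn_integral_mono ennreal_leI b)
    also have "\<dots> < \<infinity>" using prob_space.emeasure_space_1[OF pb(1)] by simp
    finally show ?thesis
      using integral_bind_kernel(3)[OF True Q f(1)] integral_stationary_law[OF P v f(1)] by simp
  qed
  show ?thesis
  proof
    assume inv: "invariant_measure P v \<eta>"
    have "emeasure (\<eta> \<bind> step P v) A = emeasure \<eta> A" if A: "A \<in> sets borel" for A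
    proof -
      have ind: "(indicator A :: 'a \<Rightarrow> real) \<in> borel_measurable borel" "bounded (range (indicator A :: 'a \<Rightarrow> real))"
        using A by (auto simp: bounded_iff indicator_def intro!: exI[of _ 1])
      have "(\<integral>x. indicator A x \<partial>\<eta>) = (\<integral>x. indicator A x \<partial>(\<eta> \<bind> step P v) :: real)"
        using inv ind unfolding invariant_measure_def eq[OF ind, symmetric] by blast
      moreover have "space \<eta> = UNIV" "space (\<eta> \<bind> step P v) = UNIV"
        using sets_eq_imp_space_eq[OF \<eta>(2)] sets_eq_imp_space_eq[OF pb(2)] by simp_all
      ultimately have "measure \<eta> A = measure (\<eta> \<bind> step P v) A" by simp
      then show ?thesis
        using finite_measure.emeasure_eq_measure[OF prob_space.finite_measure[OF pb(1)], of A]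
          finite_measure.emeasure_eq_measure[OF prob_space.finite_measure[OF \<eta>(1)], of A] by simp
    qed
    then have "\<eta> \<bind> step P v = \<eta>" by (intro measure_eqI) (auto simp: pb \<eta>)
    with True show "\<eta> \<in> space (prob_algebra borel) \<and> \<eta> \<bind> step P v = \<eta>" by simp
  next
    assume "\<eta> \<in> space (prob_algebra borel) \<and> \<eta> \<bind> step P v = \<eta>"
    then show "invariant_measure P v \<eta>" unfolding invariant_measure_def using eq by simp
  qed
qed (simp add: invariant_measure_def)

section \<open>Negligible functions, total variation and occupation measures\<close>

lemma small_o_bound:
  fixes g :: "'x::topological_space \<Rightarrow> real"
  assumes f: "f \<in> small_o K g" and g: "\<And>x. 1 \<le> g x" and \<epsilon>: "0 < \<epsilon>"
  shows "\<exists>N. \<forall>x. x \<notin> K N \<longrightarrow> \<bar>f x\<bar> \<le> \<epsilon> * g x"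
proof -
  have "limsup (\<lambda>n. SUP x \<in> - K n. ennreal (\<bar>f x\<bar> / (1 + g x))) < ennreal (\<epsilon> / 2)"
    using f \<epsilon> by (simp add: small_o_def)
  then have "\<forall>\<^sub>F n in sequentially. (SUP x \<in> - K n. ennreal (\<bar>f x\<bar> / (1 + g x))) < ennreal (\<epsilon> / 2)"
    by (rule Limsup_lessD)
  then obtain N where N: "(SUP x \<in> - K N. ennreal (\<bar>f x\<bar> / (1 + g x))) < ennreal (\<epsilon> / 2)"
    by (auto simp: eventually_sequentially)
  have "\<bar>f x\<bar> \<le> \<epsilon> * g x" if "x \<notin> K N" for x
  proof -
    have "ennreal (\<bar>f x\<bar> / (1 + g x)) < ennreal (\<epsilon> / 2)"
      using SUP_lessD[OF N, of x] that by simp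
    moreover have "0 \<le> \<bar>f x\<bar> / (1 + g x)" using g[of x] by simp
    ultimately have "\<bar>f x\<bar> / (1 + g x) < \<epsilon> / 2" by (simp add: ennreal_less_iff)
    then have "\<bar>f x\<bar> \<le> \<epsilon> / 2 * (1 + g x)" using g[of x] by (simp add: divide_less_eq)
    also have "\<dots> \<le> \<epsilon> / 2 * (2 * g x)" using g[of x] \<epsilon> by (intro mult_left_mono) auto
    finally show ?thesis by simp
  qed
  then show ?thesis by blast
qed

text \<open>If \<open>g\<close> has bounded integrals over a family of measures, such \<open>f\<close> are uniformly integrable over it:
  truncation of \<open>f\<close> at \<open>L\<close> costs at most \<open>\<epsilon> g\<close>.\<close>

definition negligible_wrt :: "('x \<Rightarrow> real) \<Rightarrow> ('x \<Rightarrow> real) \<Rightarrow> bool" where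
  "negligible_wrt g f \<longleftrightarrow> (\<forall>\<epsilon>>0. \<exists>L\<ge>0. \<forall>x. \<bar>f x\<bar> \<le> L + \<epsilon> * g x)"

lemma negligible_wrtI:
  fixes g :: "'x::topological_space \<Rightarrow> real"
  assumes f: "f \<in> small_o K g" and g: "\<And>x. 1 \<le> g x"
    and bdd: "\<And>n. \<exists>L. \<forall>x\<in>K n. \<bar>f x\<bar> \<le> L"
  shows "negligible_wrt g f"
  unfolding negligible_wrt_def
proof (intro allI impI)
  fix \<epsilon> :: real assume \<epsilon>: "0 < \<epsilon>"
  obtain N where N: "\<forall>x. x \<notin> K N \<longrightarrow> \<bar>f x\<bar> \<le> \<epsilon> * g x" using small_o_bound[OF f g \<epsilon>] by blast
  obtain L where L: "\<forall>x\<in>K N. \<bar>f x\<bar> \<le> L" using bdd by blast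
  have "\<bar>f x\<bar> \<le> \<bar>L\<bar> + \<epsilon> * g x" for x
  proof (cases "x \<in> K N")
    case True
    then show ?thesis using L g[of x] \<epsilon> by (smt (verit) mult_nonneg_nonneg)
  qed (use N in force)
  then show "\<exists>L\<ge>0. \<forall>x. \<bar>f x\<bar> \<le> L + \<epsilon> * g x" by (intro exI[of _ "\<bar>L\<bar>"]) auto
qed

lemma continuous_bounded_on_compact:
  fixes f :: "'x::topological_space \<Rightarrow> real"
  assumes "continuous_on UNIV f" "compact S"
  shows "\<exists>L. \<forall>x\<in>S. \<bar>f x\<bar> \<le> L"
proof -
  have "compact (f ` S)" using assms by (intro compact_continuous_image continuous_on_subset[OF assms(1)]) auto
  from compact_imp_bounded[OF this] show ?thesis by (auto simp: bounded_iff)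
qed

lemma tv_dist_bound:
  assumes \<mu>: "\<mu> \<in> space (prob_algebra borel)" and \<nu>: "\<nu> \<in> space (prob_algebra borel)"
    and f: "f \<in> borel_measurable borel" "\<And>x. \<bar>f x\<bar> \<le> b" and b: "0 < b"
  shows "\<bar>(\<integral>x. f x \<partial>\<mu>) - (\<integral>x. f x \<partial>\<nu>)\<bar> \<le> b * tv_dist \<mu> \<nu>"
proof -
  let ?F = "{f \<in> borel_measurable borel. \<forall>x. \<bar>f x\<bar> \<le> (1 :: real)}"
  have bound: "\<bar>\<integral>x. h x \<partial>\<tau>\<bar> \<le> 1" if "h \<in> ?F" "\<tau> \<in> space (prob_algebra borel)" for h and \<tau> :: "'a measure"
  proof -
    have "prob_space \<tau>" "sets \<tau> = sets borel" using that by (auto simp: space_prob_algebra)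
    then interpret prob_space \<tau> by simp
    have "\<bar>\<integral>x. h x \<partial>\<tau>\<bar> \<le> (\<integral>x. 1 \<partial>\<tau>)"
      using that \<open>sets \<tau> = sets borel\<close>
      by (intro order_trans[OF integral_abs_bound] integral_mono_AE' AE_I2) (auto intro: integrable_const_bound)
    then show ?thesis by (simp add: prob_space)
  qed
  have "bdd_above ((\<lambda>f. \<bar>(\<integral>x. f x \<partial>\<mu>) - (\<integral>x. f x \<partial>\<nu>)\<bar>) ` ?F)"
    using bound[OF _ \<mu>] bound[OF _ \<nu>] by (intro bdd_aboveI[of _ 2]) fastforce
  moreover have "(\<lambda>x. f x / b) \<in> ?F" using f b by (auto simp: divide_le_eq)
  ultimately have "\<bar>(\<integral>x. f x / b \<partial>\<mu>) - (\<integral>x. f x / b \<partial>\<nu>)\<bar> \<le> tv_dist \<mu> \<nu>"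
    unfolding tv_dist_def by (intro cSUP_upper)
  then show ?thesis using b by (simp add: diff_divide_distrib[symmetric] divide_le_eq mult.commute)
qed

lemma tv_dist_measure:
  assumes \<mu>: "\<mu> \<in> space (prob_algebra borel)" and \<nu>: "\<nu> \<in> space (prob_algebra borel)"
    and Y: "Y \<in> sets (borel :: 'a::topological_space measure)"
  shows "measure \<mu> Y - measure \<nu> Y \<le> tv_dist \<mu> \<nu>"
proof -
  have s: "sets \<mu> = sets borel" "sets \<nu> = sets borel" using \<mu> \<nu> by (auto simp: space_prob_algebra)
  have "space \<mu> = UNIV" "space \<nu> = UNIV"
    using sets_eq_imp_space_eq[OF s(1)] sets_eq_imp_space_eq[OF s(2)] by simp_all
  moreover have "\<bar>(\<integral>x. indicator Y x \<partial>\<mu>) - (\<integral>x. indicator Y x \<partial>\<nu>)\<bar> \<le> 1 * tv_dist \<mu> \<nu>"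
    using Y by (intro tv_dist_bound[OF \<mu> \<nu>]) (auto split: split_indicator)
  ultimately show ?thesis by (simp add: abs_le_iff)
qed

text \<open>In the bound \<open>2\<^sup>p \<cdot> 2 (L \<delta> + \<epsilon> M)\<close> of \<open>wasserstein_le_of_tv\<close>, the choice of \<open>\<epsilon>\<close> makes the second
  term at most half of \<open>A\<^sup>p\<close>. This fixes \<open>L\<close>, and then small total variation \<open>\<delta>\<close> does the same
  to the first term.\<close>

lemma wasserstein_tendsto_of_tv:
  fixes \<mu> :: "nat \<Rightarrow> 'x::polish_space measure" and w :: "'x \<Rightarrow> real"
  assumes \<mu>: "\<And>n. \<mu> n \<in> space (prob_algebra borel)" and \<nu>: "\<nu> \<in> space (prob_algebra borel)"
    and w: "w \<in> borel_measurable borel" "\<And>x. 0 \<le> w x" and p: "1 \<le> p"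
    and small: "negligible_wrt w (\<lambda>x. dist x x0 powr p)"
    and moments: "\<And>n. (\<integral>\<^sup>+x. ennreal (w x) \<partial>\<mu> n) \<le> ennreal M" "(\<integral>\<^sup>+x. ennreal (w x) \<partial>\<nu>) \<le> ennreal M" "0 < M"
    and tv: "(\<lambda>n. tv_dist (\<mu> n) \<nu>) \<longlonglongrightarrow> 0"
  shows "(\<lambda>n. wasserstein p (\<mu> n) \<nu>) \<longlonglongrightarrow> 0"
proof (rule LIMSEQ_I)
  fix A' :: real assume "0 < A'"
  define A where "A = A' / 2"
  have A: "0 < A" "A < A'" using \<open>0 < A'\<close> by (auto simp: A_def)
  define \<epsilon> where "\<epsilon> = A powr p / (2 powr p * 4 * M)"
  have \<epsilon>: "0 < \<epsilon>" using A moments(3) by (simp add: \<epsilon>_def)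
  obtain L where L: "0 \<le> L" "\<And>x. \<bar>dist x x0 powr p\<bar> \<le> L + \<epsilon> * w x"
    using small \<epsilon> unfolding negligible_wrt_def by blast
  define \<delta> where "\<delta> = A powr p / (2 powr p * 4 * (L + 1))"
  have \<delta>: "0 < \<delta>" using A L by (simp add: \<delta>_def)
  have "L * \<delta> \<le> (L + 1) * \<delta>" using \<delta> by (intro mult_right_mono) auto
  also have "\<dots> = A powr p / (2 powr p * 4)" using L(1) by (simp add: \<delta>_def)
  finally have "2 powr p * (2 * (L * \<delta> + \<epsilon> * M)) \<le> 2 powr p * (2 * (A powr p / (2 powr p * 4) + A powr p / (2 powr p * 4)))"
    using moments(3) by (intro mult_left_mono add_mono) (auto simp: \<epsilon>_def)
  also have "\<dots> = A powr p" by simp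
  finally have key: "2 powr p * (2 * (L * \<delta> + \<epsilon> * M)) \<le> A powr p" .
  obtain N where N: "\<And>n. n \<ge> N \<Longrightarrow> \<bar>tv_dist (\<mu> n) \<nu>\<bar> < \<delta>"
    using LIMSEQ_D[OF tv \<delta>] by auto
  show "\<exists>N. \<forall>n\<ge>N. norm (wasserstein p (\<mu> n) \<nu> - 0) < A'"
  proof (intro exI allI impI)
    fix n assume n: "n \<ge> N"
    have "measure (\<mu> n) Y - measure \<nu> Y \<le> \<delta>" if "Y \<in> sets borel" for Y
      using tv_dist_measure[OF \<mu> \<nu> that, of n] N[OF n] by simp
    then have "wasserstein p (\<mu> n) \<nu> \<le> A"
      by (intro wasserstein_le_of_tv[OF \<mu> \<nu> w(1) p _ L(1) less_imp_le[OF \<epsilon>] w(2) moments(1,2) less_imp_le[OF moments(3)]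
          _ less_imp_le[OF A(1)] key]) (use L(2) in auto)
    then show "norm (wasserstein p (\<mu> n) \<nu> - 0) < A'" using A by (simp add: wasserstein_def)
  qed
qed

definition occupation :: "('x::polish_space \<Rightarrow> 'u::polish_space measure) \<Rightarrow> 'x measure \<Rightarrow> ('x \<times> 'u) measure" where
  "occupation v \<eta> = \<eta> \<bind> (\<lambda>x. distr (v x) borel (Pair x))"

context
  fixes v :: "'x::polish_space \<Rightarrow> 'u::polish_space measure" and \<eta> :: "'x measure"
  assumes v: "v \<in> stationary_controls" and \<eta>: "\<eta> \<in> space (prob_algebra borel)"
begin

lemma measurable_control: "v \<in> borel \<rightarrow>\<^sub>M prob_algebra borel"
  using v by (simp add: stationary_controls_def)

lemma sets_control: "sets (v x) = sets borel" and prob_space_control: "prob_space (v x)"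
  using measurable_space[OF measurable_control, of x] by (auto simp: space_prob_algebra)

lemma measurable_Pair_control: "Pair x \<in> v x \<rightarrow>\<^sub>M (borel :: ('x \<times> 'u) measure)"
  by (simp add: borel_prod[symmetric] sets_control cong: measurable_cong_sets)

lemma measurable_occupation_kernel:
  "(\<lambda>x. distr (v x) borel (Pair x)) \<in> borel \<rightarrow>\<^sub>M prob_algebra (borel :: ('x \<times> 'u) measure)"
  by (rule measurable_distr_prob_space2[OF measurable_control]) (simp add: borel_prod[symmetric])

lemma occupation_prob: "occupation v \<eta> \<in> space (prob_algebra borel)"
  using prob_space_bind'[OF \<eta> measurable_occupation_kernel] sets_bind'[OF \<eta> measurable_occupation_kernel]
  by (simp add: occupation_def space_prob_algebra)

lemma nn_integral_occupation:
  assumes f: "f \<in> borel_measurable borel"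
  shows "(\<integral>\<^sup>+z. f z \<partial>occupation v \<eta>) = (\<integral>\<^sup>+x. \<integral>\<^sup>+u. f (x, u) \<partial>v x \<partial>\<eta>)"
proof -
  have "(\<lambda>x. distr (v x) borel (Pair x)) \<in> \<eta> \<rightarrow>\<^sub>M subprob_algebra (borel :: ('x \<times> 'u) measure)"
    using measurable_prob_algebraD[OF measurable_occupation_kernel] \<eta>
    by (simp add: space_prob_algebra cong: measurable_cong_sets)
  then show ?thesis
    unfolding occupation_def using f
    by (simp add: nn_integral_bind nn_integral_distr[OF measurable_Pair_control])
qed

lemma nn_integral_occupation_fst:
  assumes f: "f \<in> borel_measurable borel"
  shows "(\<integral>\<^sup>+z. f (fst z) \<partial>occupation v \<eta>) = (\<integral>\<^sup>+x. f x \<partial>\<eta>)"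
proof -
  have "(\<lambda>z :: 'x \<times> 'u. f (fst z)) \<in> borel_measurable borel"
    using f by (simp add: borel_prod[symmetric])
  then show ?thesis
    by (simp add: nn_integral_occupation prob_space.emeasure_space_1[OF prob_space_control])
qed

lemma integral_occupation:
  fixes f :: "'x \<times> 'u \<Rightarrow> real"
  assumes f: "f \<in> borel_measurable borel" and fin: "(\<integral>\<^sup>+z. ennreal \<bar>f z\<bar> \<partial>occupation v \<eta>) < \<infinity>"
  shows "AE x in \<eta>. integrable (v x) (\<lambda>u. f (x, u))" "integrable \<eta> (\<lambda>x. \<integral>u. f (x, u) \<partial>v x)"
    "(\<integral>z. f z \<partial>occupation v \<eta>) = (\<integral>x. \<integral>u. f (x, u) \<partial>v x \<partial>\<eta>)"
  using integral_bind_kernel[OF \<eta> measurable_occupation_kernel f fin[unfolded occupation_def]] f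
  by (simp_all add: occupation_def integrable_distr_eq[OF measurable_Pair_control] integral_distr[OF measurable_Pair_control])

lemma AE_occupation:
  assumes "Measurable.pred borel Q" "AE z in occupation v \<eta>. Q z"
  shows "AE x in \<eta>. AE u in v x. Q (x, u)"
proof -
  have k: "(\<lambda>x. distr (v x) borel (Pair x)) \<in> \<eta> \<rightarrow>\<^sub>M subprob_algebra (borel :: ('x \<times> 'u) measure)"
    using measurable_prob_algebraD[OF measurable_occupation_kernel] \<eta>
    by (simp add: space_prob_algebra cong: measurable_cong_sets)
  have "AE x in \<eta>. AE z in distr (v x) borel (Pair x). Q z"
    by (rule iffD1[OF AE_bind[OF k assms(1)] assms(2)[unfolded occupation_def]])
  moreover have "{z \<in> space borel. Q z} \<in> sets borel" using assms(1) by (rule predE)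
  ultimately show ?thesis by (simp add: AE_distr_iff[OF measurable_Pair_control])
qed

lemma occupation_bind:
  assumes P: "stochastic_kernel P"
  shows "occupation v \<eta> \<bind> (\<lambda>(x, u). P x u) = \<eta> \<bind> step P v"
proof -
  have k: "(\<lambda>x. distr (v x) borel (Pair x)) \<in> \<eta> \<rightarrow>\<^sub>M subprob_algebra (borel :: ('x \<times> 'u) measure)"
    using measurable_prob_algebraD[OF measurable_occupation_kernel] \<eta>
    by (simp add: space_prob_algebra cong: measurable_cong_sets)
  have P': "(\<lambda>(x, u). P x u) \<in> borel \<rightarrow>\<^sub>M subprob_algebra borel"
    using measurable_prob_algebraD P by (auto simp: stochastic_kernel_def)
  have "distr (v x) borel (Pair x) \<bind> (\<lambda>(x, u). P x u) = step P v x" for x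
    using bind_distr[OF measurable_Pair_control P' prob_space.not_empty[OF prob_space_control]]
    by (simp add: step_def)
  then show ?thesis unfolding occupation_def bind_assoc[OF k P'] by simp
qed

end

section \<open>Controlled chains with a uniform drift\<close>

text \<open>Here \<open>W\<close> is the drift function \<open>\<V>\<close>, or the constant 1 if \<open>C\<close> is the whole space. The model
  is phrased with a \<open>W\<close> that is bounded on \<open>C\<close>, so that the mean of \<open>W\<close> over a cycle, and hence
  under every invariant law, has a bound that is the same for all controls.\<close>

locale controlled_drift_model =
  fixes P :: "'x::polish_space \<Rightarrow> 'u::polish_space \<Rightarrow> 'x measure"
    and x0 :: 'x and K :: "nat \<Rightarrow> 'x set" and r :: "'x \<Rightarrow> 'u \<Rightarrow> 'x measure \<Rightarrow> real"
    and p :: real and W :: "'x \<Rightarrow> real" and C :: "'x set" and \<beta>1 \<beta>2 B \<gamma> :: real and \<nu> :: "'x measure"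
    and d_M :: "('x \<Rightarrow> 'u measure) \<Rightarrow> ('x \<Rightarrow> 'u measure) \<Rightarrow> real"
  assumes compact_U: "compact (UNIV :: 'u set)"
    and kernel: "stochastic_kernel P"
    and compact_K: "\<And>n. compact (K n)"
    and drift_step: "\<And>v. v \<in> stationary_controls \<Longrightarrow> drift_kernel (step P v) W C \<beta>1 \<beta>2 B \<gamma> \<nu>"
    and drift_P: "\<And>x u. (\<integral>\<^sup>+y. ennreal (W y) \<partial>P x u) \<le> ennreal (W x + \<beta>2)"
    and W_meas [measurable]: "W \<in> borel_measurable borel" and W_ge_1: "\<And>x. 1 \<le> W x"
    and controls: "control_topology P d_M"
    and p: "1 \<le> p" and dist_o: "(\<lambda>x. dist x x0 powr p) \<in> small_o K W"
    and cost: "running_cost p x0 r" and growth: "cost_growth p x0 K W r"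
    and tv: "tv_continuity P d_M"
begin

abbreviation SM :: "('x \<Rightarrow> 'u measure) set" where "SM \<equiv> stationary_controls"

abbreviation TM :: "('x \<Rightarrow> 'u measure) topology" where "TM \<equiv> Metric_space.mtopology SM d_M"

abbreviation TW :: "'x measure topology" where "TW \<equiv> wasserstein_topology p x0"

abbreviation occ :: "('x \<Rightarrow> 'u measure) \<Rightarrow> ('x \<times> 'u) measure" where "occ v \<equiv> occupation v (\<eta>_inv P v)"

text \<open>The bound of \<open>invariant_moment\<close>, common to all controls.\<close>

definition M where "M = \<beta>2 / \<beta>1 + B"

definition J :: "('x \<Rightarrow> 'u measure) \<Rightarrow> 'x measure \<Rightarrow> real" where
  "J v \<mu> = (\<integral>z. r (fst z) (snd z) \<mu> \<partial>occ v)"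

lemma SM_metric: "Metric_space SM d_M" and compact_TM: "compact_space TM"
  using controls by (auto simp: control_topology_def)

lemma P_p_metric: "Metric_space (P_p p x0) (wasserstein p)"
  by (rule Metric_space_wasserstein[OF p])

lemma topspace_TM: "topspace TM = SM" and topspace_TW: "topspace TW = P_p p x0"
  by (simp_all add: Metric_space.topspace_mtopology[OF SM_metric] Metric_space.topspace_mtopology[OF P_p_metric])

lemma constant_control: "(\<lambda>_. return borel u) \<in> SM"
  by (simp add: stationary_controls_def space_prob_algebra prob_space_return)

lemma prob_P: "prob_space (P x u)" "sets (P x u) = sets borel"
  using measurable_space[OF kernel[unfolded stochastic_kernel_def], of "(x, u)"]
  by (auto simp: space_prob_algebra)

lemma measurable_P_snd: "P x \<in> borel \<rightarrow>\<^sub>M prob_algebra borel"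
proof -
  have "Pair x \<in> borel \<rightarrow>\<^sub>M (borel :: ('x \<times> 'u) measure)" by (simp add: borel_prod[symmetric])
  from measurable_compose[OF this kernel[unfolded stochastic_kernel_def]] show ?thesis by simp
qed

lemma step_constant_control: "step P (\<lambda>_. return borel u) x = P x u"
  unfolding step_def by (rule bind_return[OF measurable_prob_algebraD[OF measurable_P_snd]]) simp

lemma M_pos: "0 < M"
proof -
  interpret drift_kernel "step P (\<lambda>_. return borel undefined)" W C \<beta>1 \<beta>2 B \<gamma> \<nu>
    by (rule drift_step[OF constant_control])
  show "0 < M" unfolding M_def using B_ge_1 \<beta>1 \<beta>2 by (simp add: add_nonneg_pos)
qed

lemma eta_invariant_measure:
  assumes "v \<in> SM"
  shows "invariant_measure P v (\<eta>_inv P v)"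
    and "invariant_measure P v \<eta> \<Longrightarrow> \<eta> = \<eta>_inv P v"
proof -
  interpret drift_kernel "step P v" W C \<beta>1 \<beta>2 B \<gamma> \<nu> by (rule drift_step[OF assms])
  have iff: "invariant_measure P v \<eta> \<longleftrightarrow> invariant \<eta>" for \<eta>
    by (simp add: invariant_measure_iff[OF kernel assms] invariant_def)
  have "\<exists>!\<eta>. invariant_measure P v \<eta>" unfolding iff using invariant_exists invariant_unique by blast
  note ex1 = this
  show "invariant_measure P v (\<eta>_inv P v)" unfolding \<eta>_inv_def by (rule theI'[OF ex1])
  show "\<eta> = \<eta>_inv P v" if "invariant_measure P v \<eta>"
    unfolding \<eta>_inv_def by (rule the1_equality[OF ex1 that, symmetric])
qed

lemma eta_prob: "v \<in> SM \<Longrightarrow> \<eta>_inv P v \<in> space (prob_algebra borel)"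
  and eta_bind: "v \<in> SM \<Longrightarrow> \<eta>_inv P v \<bind> step P v = \<eta>_inv P v"
  using eta_invariant_measure(1) invariant_measure_iff[OF kernel] by blast+

lemma eta_unique:
  assumes "v \<in> SM" "\<eta> \<in> space (prob_algebra borel)" "\<eta> \<bind> step P v = \<eta>"
  shows "\<eta> = \<eta>_inv P v"
  using eta_invariant_measure(2)[OF assms(1)] assms invariant_measure_iff[OF kernel assms(1)] by blast

lemma eta_moment: "v \<in> SM \<Longrightarrow> (\<integral>\<^sup>+x. ennreal (W x) \<partial>\<eta>_inv P v) \<le> ennreal M"
  using drift_kernel.invariant_moment[OF drift_step] eta_prob eta_bind drift_kernel.invariant_def[OF drift_step]
  unfolding M_def by blast

lemma occ_prob: "v \<in> SM \<Longrightarrow> occ v \<in> space (prob_algebra borel)"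
  by (rule occupation_prob[OF _ eta_prob])

lemma occ_moment:
  assumes "v \<in> SM"
  shows "(\<integral>\<^sup>+z. ennreal (W (fst z)) \<partial>occ v) \<le> ennreal M"
  using nn_integral_occupation_fst[OF assms eta_prob[OF assms], of "\<lambda>x. ennreal (W x)"] eta_moment[OF assms]
  by simp

lemma measurable_fst_borel: "f \<in> borel_measurable borel \<Longrightarrow> (\<lambda>z :: 'x \<times> 'u. f (fst z)) \<in> borel_measurable borel"
  by (simp add: borel_prod[symmetric])

lemma occ_W:
  assumes "v \<in> SM"
  shows "integrable (occ v) (\<lambda>z. W (fst z))" "(\<integral>z. W (fst z) \<partial>occ v) \<le> M"
proof -
  have s: "sets (occ v) = sets borel" using occ_prob[OF assms] by (simp add: space_prob_algebra)
  have m: "(\<lambda>z. W (fst z)) \<in> borel_measurable (occ v)"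
    using measurable_fst_borel[OF W_meas] s by (simp cong: measurable_cong_sets)
  have nn: "0 \<le> W x" for x using W_ge_1[of x] by simp
  show int: "integrable (occ v) (\<lambda>z. W (fst z))"
    using occ_moment[OF assms] m nn by (intro integrableI_bounded) (auto simp: order_le_less_trans)
  have "ennreal (\<integral>z. W (fst z) \<partial>occ v) \<le> ennreal M"
    using occ_moment[OF assms] nn_integral_eq_integral[OF int] nn by simp
  then show "(\<integral>z. W (fst z) \<partial>occ v) \<le> M" using M_pos by simp
qed

lemma occ_dominated:
  fixes f :: "'x \<times> 'u \<Rightarrow> real"
  assumes v: "v \<in> SM" and f: "f \<in> borel_measurable borel" and le: "\<And>z. \<bar>f z\<bar> \<le> L + \<epsilon> * W (fst z)" and "0 \<le> \<epsilon>"
  shows "integrable (occ v) f" "\<bar>\<integral>z. f z \<partial>occ v\<bar> \<le> L + \<epsilon> * M"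
proof -
  have s: "sets (occ v) = sets borel" and ps: "prob_space (occ v)"
    using occ_prob[OF v] by (auto simp: space_prob_algebra)
  interpret prob_space "occ v" by (rule ps)
  have int: "integrable (occ v) (\<lambda>z. L + \<epsilon> * W (fst z))" using occ_W(1)[OF v] by simp
  have m: "f \<in> borel_measurable (occ v)" using f s by (simp cong: measurable_cong_sets)
  show intf: "integrable (occ v) f"
  proof (rule Bochner_Integration.integrable_bound[OF int m AE_I2])
    fix z
    show "norm (f z) \<le> norm (L + \<epsilon> * W (fst z))" using le[of z] by simp
  qed
  have "\<bar>\<integral>z. f z \<partial>occ v\<bar> \<le> (\<integral>z. \<bar>f z\<bar> \<partial>occ v)" by (rule integral_abs_bound)
  also have "\<dots> \<le> (\<integral>z. L + \<epsilon> * W (fst z) \<partial>occ v)" using intf int le by (intro integral_mono) auto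
  also have "\<dots> = L + \<epsilon> * (\<integral>z. W (fst z) \<partial>occ v)" using occ_W(1)[OF v] by (simp add: prob_space)
  also have "\<dots> \<le> L + \<epsilon> * M" using occ_W(2)[OF v] \<open>0 \<le> \<epsilon>\<close> by (intro add_left_mono mult_left_mono) auto
  finally show "\<bar>\<integral>z. f z \<partial>occ v\<bar> \<le> L + \<epsilon> * M" .
qed

lemma dist_negligible: "negligible_wrt W (\<lambda>x. dist x x0 powr p)"
proof (rule negligible_wrtI[OF dist_o W_ge_1])
  have "continuous_on UNIV (\<lambda>x. dist x x0 powr p)" using p by (intro continuous_on_powr' continuous_intros) auto
  then show "\<exists>L. \<forall>x\<in>K n. \<bar>dist x x0 powr p\<bar> \<le> L" for n
    by (rule continuous_bounded_on_compact[OF _ compact_K])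
qed

lemma eta_P_p: 
  assumes "v \<in> SM"
  shows "\<eta>_inv P v \<in> P_p p x0"
proof -
  obtain L where L: "0 \<le> L" "\<forall>x. \<bar>dist x x0 powr p\<bar> \<le> L + 1 * W x"
    using dist_negligible unfolding negligible_wrt_def by (meson zero_less_one)
  have "prob_space (\<eta>_inv P v)" and s[measurable_cong]: "sets (\<eta>_inv P v) = sets borel"
    using eta_prob[OF assms] by (auto simp: space_prob_algebra)
  have nn: "0 \<le> W x" for x using W_ge_1[of x] by simp
  have "(\<integral>\<^sup>+x. ennreal (dist x x0 powr p) \<partial>\<eta>_inv P v) \<le> (\<integral>\<^sup>+x. ennreal L + ennreal (W x) \<partial>\<eta>_inv P v)"
    using L nn by (intro nn_integral_mono) (simp flip: ennreal_plus add: ennreal_leI)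
  also have "\<dots> = ennreal L + (\<integral>\<^sup>+x. ennreal (W x) \<partial>\<eta>_inv P v)"
    using prob_space.emeasure_space_1[OF \<open>prob_space _\<close>] by (simp add: nn_integral_add)
  also have "\<dots> < \<infinity>" using eta_moment[OF assms] by (auto simp: order_le_less_trans)
  finally show ?thesis using eta_prob[OF assms] by (simp add: P_p_def)
qed

lemma limitin_TM: "limitin TM vs v sequentially \<longleftrightarrow> v \<in> SM \<and> (\<forall>\<^sub>F n in sequentially. vs n \<in> SM) \<and> (\<lambda>n. d_M (vs n) v) \<longlonglongrightarrow> 0"
  using Metric_space.limitin_metric_dist_null[OF SM_metric] .

lemma limitin_TW: "limitin TW \<mu>s \<mu> sequentially \<longleftrightarrow> \<mu> \<in> P_p p x0 \<and> (\<forall>\<^sub>F n in sequentially. \<mu>s n \<in> P_p p x0) \<and>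
    (\<lambda>n. wasserstein p (\<mu>s n) \<mu>) \<longlonglongrightarrow> 0"
  using Metric_space.limitin_metric_dist_null[OF P_p_metric] .

lemma eta_tv_tendsto:
  assumes "\<And>n. vs n \<in> SM" "limitin TM vs v sequentially"
  shows "(\<lambda>n. tv_dist (\<eta>_inv P (vs n)) (\<eta>_inv P v)) \<longlonglongrightarrow> 0"
  using tv assms limitin_TM unfolding tv_continuity_def by blast

lemma eta_tendsto_of_tv:
  assumes "\<And>n. vs n \<in> SM" "v \<in> SM" "(\<lambda>n. tv_dist (\<eta>_inv P (vs n)) (\<eta>_inv P v)) \<longlonglongrightarrow> 0"
  shows "limitin TW (\<lambda>n. \<eta>_inv P (vs n)) (\<eta>_inv P v) sequentially"
proof -
  have "0 \<le> W x" for x using W_ge_1[of x] by simp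
  then have "(\<lambda>n. wasserstein p (\<eta>_inv P (vs n)) (\<eta>_inv P v)) \<longlonglongrightarrow> 0"
    using assms M_pos by (intro wasserstein_tendsto_of_tv[where w = W and M = M and ?x0.0 = x0] eta_prob W_meas p
        dist_negligible eta_moment) auto
  then show ?thesis using assms eta_P_p by (auto simp: limitin_TW)
qed

lemma eta_tendsto:
  assumes "\<And>n. vs n \<in> SM" "limitin TM vs v sequentially"
  shows "limitin TW (\<lambda>n. \<eta>_inv P (vs n)) (\<eta>_inv P v) sequentially"
  using assms limitin_TM by (intro eta_tendsto_of_tv eta_tv_tendsto) auto

text \<open>The domain is metrizable, so preimages of closed sets may be tested on sequences.\<close>

lemma continuous_map_eta: "continuous_map TM TW (\<eta>_inv P)"
  unfolding continuous_map_closedin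
proof (intro conjI allI impI)
  show "\<eta>_inv P \<in> topspace TM \<rightarrow> topspace TW" using eta_P_p by (simp add: topspace_TM topspace_TW)
  fix S assume S: "closedin TW S"
  show "closedin TM {v \<in> topspace TM. \<eta>_inv P v \<in> S}"
    unfolding Metric_space.metric_closedin_iff_sequentially_closed[OF SM_metric]
  proof (intro conjI allI impI)
    fix \<sigma> v assume *: "range \<sigma> \<subseteq> {v \<in> topspace TM. \<eta>_inv P v \<in> S} \<and> limitin TM \<sigma> v sequentially"
    then have \<sigma>: "\<sigma> n \<in> SM" "\<eta>_inv P (\<sigma> n) \<in> S" for n by (auto simp: topspace_TM)
    have "\<eta>_inv P v \<in> S"
      by (rule limitin_closedin[OF eta_tendsto[OF \<sigma>(1)] S]) (use * \<sigma>(2) in auto)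
    then show "v \<in> {v \<in> topspace TM. \<eta>_inv P v \<in> S}" using * limitin_TM by (simp add: topspace_TM)
  qed (auto simp: topspace_TM)
qed

abbreviation \<G> where "\<G> \<equiv> \<eta>_inv P ` SM"

lemma compactin_G: "compactin TW \<G>"
  using image_compactin[OF _ continuous_map_eta, of SM] compact_TM by (simp add: compact_space_def topspace_TM)

lemma cost_joint_limit:
  assumes "xs \<longlonglongrightarrow> x" "us \<longlonglongrightarrow> u" "limitin TW \<mu>s \<mu> sequentially"
  shows "(\<lambda>n. r (xs n) (us n) (\<mu>s n)) \<longlonglongrightarrow> r x u \<mu>"
proof -
  have "continuous_map (prod_topology euclidean (prod_topology euclidean TW)) euclideanreal (\<lambda>(x, u, \<mu>). r x u \<mu>)"
    using cost by (simp add: running_cost_def)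
  moreover have "limitin (prod_topology euclidean (prod_topology euclidean TW)) (\<lambda>n. (xs n, us n, \<mu>s n)) (x, u, \<mu>) sequentially"
    using assms by (simp add: limitin_pairwise o_def)
  ultimately have "limitin euclideanreal ((\<lambda>(x, u, \<mu>). r x u \<mu>) \<circ> (\<lambda>n. (xs n, us n, \<mu>s n)))
      ((\<lambda>(x, u, \<mu>). r x u \<mu>) (x, u, \<mu>)) sequentially" by (rule continuous_map_limit)
  then show ?thesis by (simp add: o_def)
qed

lemma cost_continuous:
  assumes "\<mu> \<in> P_p p x0"
  shows "continuous_on UNIV (\<lambda>z. r (fst z) (snd z) \<mu>)"
  unfolding continuous_on_sequentially
proof (intro allI ballI impI)
  fix zs and z :: "'x \<times> 'u" assume "(\<forall>n. zs n \<in> UNIV) \<and> zs \<longlonglongrightarrow> z"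
  then have "(\<lambda>n. fst (zs n)) \<longlonglongrightarrow> fst z" "(\<lambda>n. snd (zs n)) \<longlonglongrightarrow> snd z" by (auto intro: tendsto_intros)
  then have "(\<lambda>n. r (fst (zs n)) (snd (zs n)) \<mu>) \<longlonglongrightarrow> r (fst z) (snd z) \<mu>"
    by (rule cost_joint_limit) (simp add: topspace_TW assms)
  then show "((\<lambda>z. r (fst z) (snd z) \<mu>) \<circ> zs) \<longlonglongrightarrow> r (fst z) (snd z) \<mu>" by (simp add: o_def)
qed

lemma cost_nonneg: "\<mu> \<in> P_p p x0 \<Longrightarrow> 0 \<le> r x u \<mu>"
  using cost by (simp add: running_cost_def)

text \<open>The envelope of the cost over all populations that are invariant laws. As these form a
  compact set, the growth condition on the cost applies to it.\<close>

definition R :: "'x \<Rightarrow> real" where "R x = (SUP (u, \<mu>) \<in> UNIV \<times> \<G>. r x u \<mu>)"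

text \<open>The cost is continuous on the compact product of \<open>S\<close>, the actions and the invariant laws.\<close>

lemma cost_bounded_on_compact:
  assumes "compact S"
  shows "\<exists>L. \<forall>x\<in>S. \<forall>u. \<forall>\<mu>\<in>\<G>. r x u \<mu> \<le> L"
proof -
  let ?T = "prod_topology euclidean (prod_topology euclidean TW) :: ('x \<times> 'u \<times> 'x measure) topology"
  have "compactin ?T (S \<times> (UNIV \<times> \<G>))"
    using assms compact_U compactin_G by (simp add: compactin_Times)
  then have "compactin euclideanreal ((\<lambda>(x, u, \<mu>). r x u \<mu>) ` (S \<times> (UNIV \<times> \<G>)))"
    using cost by (intro image_compactin[of ?T]) (auto simp: running_cost_def)
  then have "bounded ((\<lambda>(x, u, \<mu>). r x u \<mu>) ` (S \<times> (UNIV \<times> \<G>)))"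
    by (simp add: compact_imp_bounded)
  then obtain L where "\<forall>y \<in> (\<lambda>(x, u, \<mu>). r x u \<mu>) ` (S \<times> (UNIV \<times> \<G>)). \<bar>y\<bar> \<le> L"
    by (auto simp: bounded_iff)
  then have "\<forall>x\<in>S. \<forall>u. \<forall>\<mu>\<in>\<G>. r x u \<mu> \<le> L" by (fastforce simp: abs_le_iff)
  then show ?thesis by blast
qed

lemma G_nonempty: "\<G> \<noteq> {}" using constant_control by blast

lemma cost_le_R: "\<mu> \<in> \<G> \<Longrightarrow> r x u \<mu> \<le> R x"
  and R_le: "(\<And>u \<mu>. \<mu> \<in> \<G> \<Longrightarrow> r x u \<mu> \<le> L) \<Longrightarrow> R x \<le> L"
  and R_nonneg: "0 \<le> R x"
proof -
  obtain L where L: "\<forall>u. \<forall>\<mu>\<in>\<G>. r x u \<mu> \<le> L" using cost_bounded_on_compact[of "{x}"] by auto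
  have bdd: "bdd_above ((\<lambda>(u, \<mu>). r x u \<mu>) ` (UNIV \<times> \<G>))"
    using L by (intro bdd_aboveI[of _ L]) auto
  show le: "r x u \<mu> \<le> R x" if "\<mu> \<in> \<G>" for u \<mu>
    unfolding R_def using cSUP_upper[OF _ bdd, of "(u, \<mu>)"] that by simp
  show "(\<And>u \<mu>. \<mu> \<in> \<G> \<Longrightarrow> r x u \<mu> \<le> L) \<Longrightarrow> R x \<le> L" for L
    unfolding R_def using G_nonempty by (intro cSUP_least) auto
  obtain \<mu> where \<mu>: "\<mu> \<in> \<G>" using G_nonempty by blast
  then have "0 \<le> r x undefined \<mu>" using eta_P_p by (intro cost_nonneg) auto
  then show "0 \<le> R x" using le[OF \<mu>, of undefined] by simp
qed

lemma R_small_o: "R \<in> small_o K W"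
  using growth compactin_G G_nonempty unfolding cost_growth_def R_def[abs_def] by blast

lemma R_negligible: "negligible_wrt W R"
proof (rule negligible_wrtI[OF R_small_o W_ge_1])
  fix n
  obtain L where "\<forall>x\<in>K n. \<forall>u. \<forall>\<mu>\<in>\<G>. r x u \<mu> \<le> L" using cost_bounded_on_compact[OF compact_K] by blast
  then have "R x \<le> L" if "x \<in> K n" for x using that by (intro R_le) auto
  then have "\<forall>x\<in>K n. \<bar>R x\<bar> \<le> L" using R_nonneg by simp
  then show "\<exists>L. \<forall>x\<in>K n. \<bar>R x\<bar> \<le> L" by blast
qed

end

section \<open>Continuity of the average cost\<close>

lemma integral_mixture:
  fixes f :: "'a \<Rightarrow> real"
  assumes t: "t \<in> weights n" and N: "\<And>i. i < n \<Longrightarrow> N i \<in> space (prob_algebra B)"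
    and f: "f \<in> borel_measurable B" and int: "\<And>i. i < n \<Longrightarrow> integrable (N i) f"
  shows "(\<integral>x. f x \<partial>mixture n (\<lambda>i. ennreal (t i)) N) = (\<Sum>i<n. t i * (\<integral>x. f x \<partial>N i))"
proof -
  let ?D = "density (count_space {..<n}) (\<lambda>i. ennreal (t i))"
  have t0: "\<And>i. i < n \<Longrightarrow> 0 \<le> t i" and t1: "(\<Sum>i<n. t i) = 1" using t by (auto simp: weights_def)
  have "emeasure ?D (space ?D) = 1"
    using t1 sum_ennreal[of "{..<n}" t] t0 by (simp add: emeasure_density nn_integral_count_space_finite)
  then have D: "?D \<in> space (prob_algebra (count_space {..<n}))"
    by (auto simp: space_prob_algebra intro: prob_spaceI)
  have N': "N \<in> count_space {..<n} \<rightarrow>\<^sub>M prob_algebra B" using N by (simp add: measurable_count_space_eq1)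
  have sub: "N i \<in> space (subprob_algebra B)" if "i < n" for i
    using N[OF that] by (auto simp: space_prob_algebra space_subprob_algebra prob_space_imp_subprob_space)
  have "(\<integral>\<^sup>+y. ennreal \<bar>f y\<bar> \<partial>mixture n (\<lambda>i. ennreal (t i)) N) = (\<Sum>i<n. ennreal (t i) * (\<integral>\<^sup>+y. ennreal \<bar>f y\<bar> \<partial>N i))"
    using f by (intro nn_integral_mixture[where B = B] sub) auto
  also have "\<dots> < \<infinity>" using int by (auto simp: integrable_iff_bounded ennreal_mult_less_top)
  finally have fin: "(\<integral>\<^sup>+y. ennreal \<bar>f y\<bar> \<partial>(?D \<bind> N)) < \<infinity>" by (simp add: mixture_def)
  have "(\<integral>x. f x \<partial>mixture n (\<lambda>i. ennreal (t i)) N) = (\<integral>i. \<integral>x. f x \<partial>N i \<partial>?D)"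
    unfolding mixture_def by (rule integral_bind_kernel(3)[OF D N' f fin])
  also have "\<dots> = (\<integral>i. t i *\<^sub>R (\<integral>x. f x \<partial>N i) \<partial>count_space {..<n})"
    using t0 by (intro integral_density) (auto simp: AE_count_space)
  also have "\<dots> = (\<Sum>i<n. t i * (\<integral>x. f x \<partial>N i))" by (subst lebesgue_integral_count_space_finite) auto
  finally show ?thesis .
qed

context controlled_drift_model
begin

text \<open>By invariance, the integral of \<open>f\<close> against \<open>\<pi>\<^sub>v\<close> is the integral of \<open>E v x\<close>, the expectation of
  \<open>f(X\<^sub>1, v(X\<^sub>1))\<close> from \<open>x\<close>, against \<open>\<eta>\<^sub>v\<close>. Along a convergent sequence of controls, \<open>E\<close> converges pointwise by the
  assumption on the topology of controls and \<open>\<eta>\<^sub>v\<close> converges in total variation.\<close>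

lemma occ_weakly_continuous:
  fixes f :: "'x \<times> 'u \<Rightarrow> real"
  assumes vs: "\<And>n. vs n \<in> SM" and lim: "limitin TM vs v sequentially"
    and f: "continuous_on UNIV f" "\<And>z. \<bar>f z\<bar> \<le> b" and b: "0 < b"
  shows "(\<lambda>n. \<integral>z. f z \<partial>occ (vs n)) \<longlonglongrightarrow> (\<integral>z. f z \<partial>occ v)"
proof -
  have v: "v \<in> SM" using lim limitin_TM by blast
  have fm: "f \<in> borel_measurable borel" by (rule borel_measurable_continuous_onI[OF f(1)])
  define g where "g w x = (\<integral>u. f (x, u) \<partial>w x)" for w :: "'x \<Rightarrow> 'u measure" and x
  define E where "E w x = (\<integral>y. g w y \<partial>step P w x)" for w x
  have g_meas: "g w \<in> borel_measurable borel" if "w \<in> SM" for w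
  proof -
    have w: "w \<in> borel \<rightarrow>\<^sub>M subprob_algebra borel"
      using that by (intro measurable_prob_algebraD) (simp add: stationary_controls_def)
    have "(\<lambda>x. distr (w x) borel (Pair x)) \<in> borel \<rightarrow>\<^sub>M subprob_algebra (borel :: ('x \<times> 'u) measure)"
      by (rule measurable_prob_algebraD[OF measurable_occupation_kernel[OF that eta_prob[OF that]]])
    from measurable_compose[OF this integral_measurable_subprob_algebra[OF fm]]
    show ?thesis unfolding g_def
      by (simp add: integral_distr[OF measurable_Pair_control[OF that eta_prob[OF that]] fm])
  qed
  have bounded_int: "\<bar>\<integral>x. h x \<partial>\<tau>\<bar> \<le> b" if "prob_space \<tau>" "\<And>x. \<bar>h x\<bar> \<le> b"
    for h :: "'c \<Rightarrow> real" and \<tau> :: "'c measure"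
  proof -
    interpret prob_space \<tau> by fact
    show ?thesis
    proof (cases "integrable \<tau> h")
      case True
      then have "\<bar>\<integral>x. h x \<partial>\<tau>\<bar> \<le> (\<integral>x. b \<partial>\<tau>)"
        using that by (intro order_trans[OF integral_abs_bound] integral_mono) auto
      then show ?thesis by (simp add: prob_space)
    qed (use b in \<open>simp add: not_integrable_integral_eq\<close>)
  qed
  have finite_int: "(\<integral>\<^sup>+x. ennreal \<bar>h x\<bar> \<partial>\<tau>) < \<infinity>" if "prob_space \<tau>" "\<And>x. \<bar>h x\<bar> \<le> b"
    for h :: "'c \<Rightarrow> real" and \<tau> :: "'c measure"
  proof -
    have "(\<integral>\<^sup>+x. ennreal \<bar>h x\<bar> \<partial>\<tau>) \<le> (\<integral>\<^sup>+x. ennreal b \<partial>\<tau>)" by (intro nn_integral_mono ennreal_leI that)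
    then show ?thesis using prob_space.emeasure_space_1[OF that(1)] by (simp add: order_le_less_trans)
  qed
  have g_le: "\<bar>g w x\<bar> \<le> b" if "w \<in> SM" for w x
    unfolding g_def using f(2) by (intro bounded_int prob_space_control[OF that eta_prob[OF that]])
  have step_prob: "prob_space (step P w x)" "sets (step P w x) = sets borel" if "w \<in> SM" for w x
    using measurable_space[OF measurable_step[OF kernel that], of x] by (auto simp: space_prob_algebra)
  have E_le: "\<bar>E w x\<bar> \<le> b" if "w \<in> SM" for w x
    unfolding E_def by (intro bounded_int step_prob g_le that)
  have E_meas: "E w \<in> borel_measurable borel" if "w \<in> SM" for w
    unfolding E_def
    by (rule measurable_compose[OF measurable_prob_algebraD[OF measurable_step[OF kernel that]]
          integral_measurable_subprob_algebra[OF g_meas[OF that]]])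
  have occ_E: "(\<integral>z. f z \<partial>occ w) = (\<integral>x. E w x \<partial>\<eta>_inv P w)" if "w \<in> SM" for w
  proof -
    have "(\<integral>z. f z \<partial>occ w) = (\<integral>x. g w x \<partial>\<eta>_inv P w)"
      unfolding g_def using occ_prob[OF that] f(2)
      by (intro integral_occupation(3)[OF that eta_prob[OF that] fm] finite_int) (auto simp: space_prob_algebra)
    also have "\<dots> = (\<integral>x. g w x \<partial>(\<eta>_inv P w \<bind> step P w))" by (simp add: eta_bind[OF that])
    also have "\<dots> = (\<integral>x. E w x \<partial>\<eta>_inv P w)"
      unfolding E_def using eta_prob[OF that] g_le[OF that]
      by (intro integral_bind_kernel(3)[OF eta_prob[OF that] measurable_step[OF kernel that] g_meas[OF that]] finite_int)
        (auto simp: space_prob_algebra eta_bind[OF that])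
    finally show ?thesis .
  qed
  have E_law: "(\<integral>\<omega>. (\<integral>u. f (\<omega> 1, u) \<partial>w (\<omega> 1)) \<partial>stationary_law P w x) = E w x" if "w \<in> SM" for w x
    using integral_stationary_law[OF kernel that g_meas[OF that]] by (simp add: E_def g_def)
  have E_lim: "(\<lambda>n. E (vs n) x) \<longlonglongrightarrow> E v x" for x
  proof -
    let ?F = "\<lambda>(x, w). \<lambda>i\<in>{1..1 :: nat}. \<integral>\<omega>. (\<integral>u. f (\<omega> i, u) \<partial>w (\<omega> i)) \<partial>stationary_law P w x"
    have "bounded (range f)" using f(2) by (auto simp: bounded_iff)
    then have "continuous_map (prod_topology euclidean TM) (powertop_real {1..1}) ?F"
      using controls f(1) unfolding control_topology_def by blast
    moreover have "limitin (prod_topology euclidean TM) (\<lambda>n. (x, vs n)) (x, v) sequentially"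
      using lim by (simp add: limitin_pairwise o_def)
    ultimately have "limitin (powertop_real {1..1 :: nat}) (?F \<circ> (\<lambda>n. (x, vs n))) (?F (x, v)) sequentially"
      by (rule continuous_map_limit)
    then have "limitin euclideanreal (\<lambda>n. (?F \<circ> (\<lambda>n. (x, vs n))) n 1) (?F (x, v) 1) sequentially"
      unfolding limitin_componentwise by auto
    moreover have "(?F \<circ> (\<lambda>n. (x, vs n))) n 1 = E (vs n) x" for n
      using E_law[OF vs[of n], of x] by simp
    moreover have "?F (x, v) 1 = E v x" using E_law[OF v, of x] by simp
    ultimately show ?thesis by simp
  qed
  let ?\<eta> = "\<eta>_inv P v"
  have ps: "prob_space ?\<eta>" and s: "sets ?\<eta> = sets borel" using eta_prob[OF v] by (auto simp: space_prob_algebra)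
  interpret prob_space ?\<eta> by fact
  have "(\<lambda>n. \<integral>x. E (vs n) x \<partial>?\<eta>) \<longlonglongrightarrow> (\<integral>x. E v x \<partial>?\<eta>)"
    using E_meas[OF v] E_meas[OF vs] E_lim E_le[OF vs] s
    by (intro integral_dominated_convergence[where w = "\<lambda>_. b"]) (auto cong: measurable_cong_sets)
  moreover have "(\<lambda>n. (\<integral>x. E (vs n) x \<partial>\<eta>_inv P (vs n)) - (\<integral>x. E (vs n) x \<partial>?\<eta>)) \<longlonglongrightarrow> 0"
  proof (rule tendsto_rabs_zero_cancel, rule tendsto_sandwich[OF _ _ tendsto_const])
    show "(\<lambda>n. b * tv_dist (\<eta>_inv P (vs n)) ?\<eta>) \<longlonglongrightarrow> 0"
      using tendsto_mult_left[OF eta_tv_tendsto[OF vs lim], of b] by simp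
    show "\<forall>\<^sub>F n in sequentially. \<bar>(\<integral>x. E (vs n) x \<partial>\<eta>_inv P (vs n)) - (\<integral>x. E (vs n) x \<partial>?\<eta>)\<bar> \<le>
        b * tv_dist (\<eta>_inv P (vs n)) ?\<eta>"
      by (intro always_eventually allI tv_dist_bound eta_prob vs v E_meas E_le b)
  qed auto
  ultimately have "(\<lambda>n. (\<integral>x. E (vs n) x \<partial>?\<eta>) + ((\<integral>x. E (vs n) x \<partial>\<eta>_inv P (vs n)) - (\<integral>x. E (vs n) x \<partial>?\<eta>)))
      \<longlonglongrightarrow> (\<integral>x. E v x \<partial>?\<eta>) + 0"
    by (rule tendsto_add)
  then show ?thesis by (simp add: occ_E vs v)
qed

lemma G_P_p: "\<mu> \<in> \<G> \<Longrightarrow> \<mu> \<in> P_p p x0"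
  using eta_P_p by auto

lemma cost_meas: "\<mu> \<in> \<G> \<Longrightarrow> (\<lambda>z. r (fst z) (snd z) \<mu>) \<in> borel_measurable borel"
  by (intro borel_measurable_continuous_onI cost_continuous G_P_p)

text \<open>Otherwise a limit point of violating state-action pairs, which exists by compactness, would
  contradict joint continuity of the cost.\<close>

lemma cost_uniform_on_compact:
  assumes lim: "limitin TW \<mu>s \<mu> sequentially" and S: "compact S" and \<delta>: "0 < \<delta>"
  shows "\<forall>\<^sub>F n in sequentially. \<forall>x\<in>S. \<forall>u. \<bar>r x u (\<mu>s n) - r x u \<mu>\<bar> < \<delta>"
proof (rule ccontr)
  assume "\<not> ?thesis"
  then obtain \<rho> :: "nat \<Rightarrow> nat" where \<rho>: "strict_mono \<rho>" "\<And>k. \<not> (\<forall>x\<in>S. \<forall>u. \<bar>r x u (\<mu>s (\<rho> k)) - r x u \<mu>\<bar> < \<delta>)"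
    using not_eventually_sequentiallyD by blast
  then obtain z where z: "\<And>k. fst (z k) \<in> S"
    "\<And>k. \<not> \<bar>r (fst (z k)) (snd (z k)) (\<mu>s (\<rho> k)) - r (fst (z k)) (snd (z k)) \<mu>\<bar> < \<delta>"
  proof -
    have "\<exists>z. fst z \<in> S \<and> \<not> \<bar>r (fst z) (snd z) (\<mu>s (\<rho> k)) - r (fst z) (snd z) \<mu>\<bar> < \<delta>" for k
      using \<rho>(2)[of k] by auto
    then show thesis using that by metis
  qed
  have "seq_compact (S \<times> (UNIV :: 'u set))"
    using compact_Times[OF S compact_U] by (rule compact_imp_seq_compact)
  moreover have "z k \<in> S \<times> UNIV" for k using z(1)[of k] by (simp add: mem_Times_iff)
  ultimately obtain l \<sigma> where \<sigma>: "strict_mono (\<sigma> :: nat \<Rightarrow> nat)" "(z \<circ> \<sigma>) \<longlonglongrightarrow> l"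
    using seq_compactE[of "S \<times> (UNIV :: 'u set)" z] by metis
  have f: "(\<lambda>k. fst (z (\<sigma> k))) \<longlonglongrightarrow> fst l" and s: "(\<lambda>k. snd (z (\<sigma> k))) \<longlonglongrightarrow> snd l"
    using tendsto_fst[OF \<sigma>(2)] tendsto_snd[OF \<sigma>(2)] by (simp_all add: o_def)
  have "limitin TW (\<mu>s \<circ> (\<rho> \<circ> \<sigma>)) \<mu> sequentially"
    by (rule limitin_subsequence[OF strict_mono_o[OF \<rho>(1) \<sigma>(1)] lim])
  then have m: "limitin TW (\<lambda>k. \<mu>s (\<rho> (\<sigma> k))) \<mu> sequentially" by (simp add: o_def)
  have "limitin TW (\<lambda>k. \<mu>) \<mu> sequentially" using limitin_topspace[OF lim] by simp
  from tendsto_diff[OF cost_joint_limit[OF f s m] cost_joint_limit[OF f s this]]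
  have "(\<lambda>k. \<bar>r (fst (z (\<sigma> k))) (snd (z (\<sigma> k))) (\<mu>s (\<rho> (\<sigma> k))) - r (fst (z (\<sigma> k))) (snd (z (\<sigma> k))) \<mu>\<bar>) \<longlonglongrightarrow> 0"
    using tendsto_rabs_zero by fastforce
  from LIMSEQ_le_const[OF this, of \<delta>] z(2) \<delta> show False by (auto simp: not_less)
qed

lemma J_dominated:
  assumes "v \<in> SM" "\<mu> \<in> \<G>"
  shows "integrable (occ v) (\<lambda>z. r (fst z) (snd z) \<mu>)"
proof -
  obtain L where L: "0 \<le> L" "\<forall>x. \<bar>R x\<bar> \<le> L + 1 * W x"
    using R_negligible unfolding negligible_wrt_def by (meson zero_less_one)
  have "\<bar>r (fst z) (snd z) \<mu>\<bar> \<le> L + 1 * W (fst z)" for z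
    using cost_le_R[OF assms(2), of "fst z" "snd z"] cost_nonneg[OF G_P_p[OF assms(2)], of "fst z" "snd z"]
      L(2)[rule_format, of "fst z"] by simp
  then show ?thesis by (rule occ_dominated(1)[OF assms(1) cost_meas[OF assms(2)]]) simp
qed

text \<open>The cost truncated at \<open>L\<close> is bounded and continuous, and the rest is at most \<open>\<epsilon> W\<close>, whose
  integral is at most \<open>\<epsilon> M\<close> for every control.\<close>

lemma J_tendsto_control:
  assumes vs: "\<And>n. vs n \<in> SM" and lim: "limitin TM vs v sequentially" and \<mu>: "\<mu> \<in> \<G>"
  shows "(\<lambda>n. J (vs n) \<mu>) \<longlonglongrightarrow> J v \<mu>"
proof (rule LIMSEQ_I)
  fix e :: real assume e: "0 < e"
  have v: "v \<in> SM" using lim limitin_TM by blast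
  define \<epsilon> where "\<epsilon> = e / (4 * M)"
  have \<epsilon>: "0 < \<epsilon>" "\<epsilon> * M = e / 4" using e M_pos by (auto simp: \<epsilon>_def)
  obtain L where L: "0 \<le> L" "\<And>x. \<bar>R x\<bar> \<le> L + \<epsilon> * W x"
    using R_negligible \<epsilon>(1) unfolding negligible_wrt_def by blast
  let ?f = "\<lambda>z. r (fst z) (snd z) \<mu>" and ?h = "\<lambda>z. min (r (fst z) (snd z) \<mu>) L"
  have r: "0 \<le> r x u \<mu>" "r x u \<mu> \<le> L + \<epsilon> * W x" for x u
    using cost_le_R[OF \<mu>, of x u] cost_nonneg[OF G_P_p[OF \<mu>], of x u] L(2)[of x] by auto
  have hc: "continuous_on UNIV ?h" by (intro continuous_on_min cost_continuous G_P_p[OF \<mu>] continuous_intros)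
  have hb: "\<bar>?h z\<bar> \<le> L + 1" for z using r(1)[of "fst z" "snd z"] L(1) by (auto simp: abs_le_iff min_def)
  have diff: "\<bar>J w \<mu> - (\<integral>z. ?h z \<partial>occ w)\<bar> \<le> e / 4" if w: "w \<in> SM" for w
  proof -
    have hm: "?h \<in> borel_measurable borel" by (rule borel_measurable_continuous_onI[OF hc])
    have ih: "integrable (occ w) ?h" by (rule occ_dominated(1)[OF w hm, of "L + 1" 0]) (use hb in auto)
    have "J w \<mu> - (\<integral>z. ?h z \<partial>occ w) = (\<integral>z. ?f z - ?h z \<partial>occ w)"
      unfolding J_def by (rule Bochner_Integration.integral_diff[OF J_dominated[OF w \<mu>] ih, symmetric])
    also have "\<bar>\<dots>\<bar> \<le> 0 + \<epsilon> * M"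
    proof (rule occ_dominated(2)[OF w])
      show "(\<lambda>z. ?f z - ?h z) \<in> borel_measurable borel" using cost_meas[OF \<mu>] hm by simp
      show "\<bar>?f z - ?h z\<bar> \<le> 0 + \<epsilon> * W (fst z)" for z
        using r(2)[of "fst z" "snd z"] \<epsilon>(1) W_ge_1[of "fst z"] by (auto simp: min_def)
    qed (use \<epsilon> in auto)
    finally show ?thesis by (simp add: \<epsilon>(2))
  qed
  have "0 < L + 1" using L(1) by simp
  from occ_weakly_continuous[OF vs lim hc hb this]
  obtain N where N: "\<And>n. n \<ge> N \<Longrightarrow> norm ((\<integral>z. ?h z \<partial>occ (vs n)) - (\<integral>z. ?h z \<partial>occ v)) < e / 4"
    using e by (meson LIMSEQ_D zero_less_divide_iff zero_less_numeral)
  show "\<exists>N. \<forall>n\<ge>N. norm (J (vs n) \<mu> - J v \<mu>) < e"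
  proof (intro exI allI impI)
    fix n assume "n \<ge> N"
    then show "norm (J (vs n) \<mu> - J v \<mu>) < e"
      using N[of n] diff[OF vs[of n]] diff[OF v] e unfolding real_norm_def by linarith
  qed
qed

text \<open>The two costs are uniformly close on a compact set \<open>K N\<close>, outside of which both are at most
  \<open>\<epsilon> W\<close>.\<close>

lemma J_difference_tendsto:
  assumes vs: "\<And>n. vs n \<in> SM" and \<mu>s: "\<And>n. \<mu>s n \<in> \<G>" and \<mu>: "\<mu> \<in> \<G>"
    and lim: "limitin TW \<mu>s \<mu> sequentially"
  shows "(\<lambda>n. J (vs n) (\<mu>s n) - J (vs n) \<mu>) \<longlonglongrightarrow> 0"
proof (rule LIMSEQ_I)
  fix e :: real assume e: "0 < e"
  define \<epsilon> where "\<epsilon> = e / (4 * M)"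
  have \<epsilon>: "0 < \<epsilon>" "\<epsilon> * M = e / 4" using e M_pos by (auto simp: \<epsilon>_def)
  obtain N where N: "\<And>x. x \<notin> K N \<Longrightarrow> \<bar>R x\<bar> \<le> \<epsilon> * W x"
    using small_o_bound[OF R_small_o W_ge_1 \<epsilon>(1)] by blast
  have "\<forall>\<^sub>F n in sequentially. \<forall>x\<in>K N. \<forall>u. \<bar>r x u (\<mu>s n) - r x u \<mu>\<bar> < e / 4"
    using e by (intro cost_uniform_on_compact[OF lim compact_K]) auto
  then obtain m where m: "\<And>n x u. n \<ge> m \<Longrightarrow> x \<in> K N \<Longrightarrow> \<bar>r x u (\<mu>s n) - r x u \<mu>\<bar> < e / 4"
    by (auto simp: eventually_sequentially)
  show "\<exists>m. \<forall>n\<ge>m. norm (J (vs n) (\<mu>s n) - J (vs n) \<mu> - 0) < e"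
  proof (intro exI allI impI)
    fix n assume n: "n \<ge> m"
    have "J (vs n) (\<mu>s n) - J (vs n) \<mu> = (\<integral>z. r (fst z) (snd z) (\<mu>s n) - r (fst z) (snd z) \<mu> \<partial>occ (vs n))"
      unfolding J_def
      by (rule Bochner_Integration.integral_diff[OF J_dominated[OF vs \<mu>s] J_dominated[OF vs \<mu>], symmetric])
    also have "\<bar>\<dots>\<bar> \<le> e / 4 + \<epsilon> * M"
    proof (rule occ_dominated(2)[OF vs])
      show "(\<lambda>z. r (fst z) (snd z) (\<mu>s n) - r (fst z) (snd z) \<mu>) \<in> borel_measurable borel"
        using cost_meas[OF \<mu>s[of n]] cost_meas[OF \<mu>] by simp
      show "\<bar>r (fst z) (snd z) (\<mu>s n) - r (fst z) (snd z) \<mu>\<bar> \<le> e / 4 + \<epsilon> * W (fst z)" for z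
      proof (cases "fst z \<in> K N")
        case True
        have "0 \<le> \<epsilon> * W (fst z)" using \<epsilon>(1) W_ge_1[of "fst z"] by simp
        then show ?thesis using m[OF n True, of "snd z"] by simp
      next
        case False
        have "\<bar>r (fst z) (snd z) (\<mu>s n) - r (fst z) (snd z) \<mu>\<bar> \<le> R (fst z)"
          using cost_le_R[OF \<mu>s[of n], of "fst z" "snd z"] cost_nonneg[OF G_P_p[OF \<mu>s[of n]], of "fst z" "snd z"]
            cost_le_R[OF \<mu>, of "fst z" "snd z"] cost_nonneg[OF G_P_p[OF \<mu>], of "fst z" "snd z"] by auto
        then show ?thesis using N[OF False] e by simp
      qed
    qed (use \<epsilon> in auto)
    finally show "norm (J (vs n) (\<mu>s n) - J (vs n) \<mu> - 0) < e" using e by (simp add: \<epsilon>(2))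
  qed
qed

end

section \<open>Existence of an equilibrium\<close>

context controlled_drift_model
begin

text \<open>Let \<open>\<eta>\<close> be the mixture of the invariant laws and \<open>h i\<close> the density of \<open>t i \<cdot> \<eta>\<^sub>i\<close> with respect to \<open>\<eta>\<close>.
  The control \<open>v(x) = \<Sum>\<^sub>i h\<^sub>i(x) v\<^sub>i(x)\<close> has \<open>\<eta>(dx) v(du|x) = \<Sum>\<^sub>i t\<^sub>i \<eta>\<^sub>i(dx) v\<^sub>i(du|x)\<close>. The right-hand side
  reproduces \<open>\<eta>\<close> after one step of the kernel, so \<open>\<eta>\<close> is the invariant law of \<open>v\<close>.\<close>

lemma occ_mixture:
  assumes n: "0 < n" and t: "t \<in> weights n" and vs: "\<And>i. i < n \<Longrightarrow> vs i \<in> SM"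
  shows "\<exists>v\<in>SM. occ v = mixture n (\<lambda>i. ennreal (t i)) (\<lambda>i. occ (vs i)) \<and>
     \<eta>_inv P v = mixture n (\<lambda>i. ennreal (t i)) (\<lambda>i. \<eta>_inv P (vs i))"
proof -
  have t0: "\<And>i. i < n \<Longrightarrow> 0 \<le> t i" and t1: "(\<Sum>i<n. t i) = 1" using t by (auto simp: weights_def)
  have t1': "(\<Sum>i<n. ennreal (t i)) = 1" using t1 sum_ennreal[of "{..<n}" t] t0 by simp
  define \<eta> where "\<eta> = mixture n (\<lambda>i. ennreal (t i)) (\<lambda>i. \<eta>_inv P (vs i))"
  have sub: "N i \<in> space (subprob_algebra B)" if "N i \<in> space (prob_algebra B)"
    for N :: "nat \<Rightarrow> 'c measure" and B i
    using that by (auto simp: space_prob_algebra space_subprob_algebra prob_space_imp_subprob_space)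
  have \<eta>_prob: "\<eta> \<in> space (prob_algebra borel)"
    unfolding \<eta>_def using vs eta_prob by (intro mixture_in_prob_algebra n t1') auto
  have s\<eta>: "sets \<eta> = sets borel" and "prob_space \<eta>" using \<eta>_prob by (auto simp: space_prob_algebra)
  interpret prob_space \<eta> by fact
  have \<eta>_int: "(\<integral>\<^sup>+x. f x \<partial>\<eta>) = (\<Sum>i<n. ennreal (t i) * (\<integral>\<^sup>+x. f x \<partial>\<eta>_inv P (vs i)))"
    if "f \<in> borel_measurable borel" for f
    unfolding \<eta>_def using vs eta_prob that by (intro nn_integral_mixture sub) auto
  define \<tau> where "\<tau> i = scale_measure (ennreal (t i)) (\<eta>_inv P (vs i))" for i
  have s_eta: "sets (\<eta>_inv P (vs i)) = sets borel" if "i < n" for i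
    using eta_prob[OF vs[OF that]] by (simp add: space_prob_algebra)
  have s\<tau>: "sets (\<tau> i) = sets \<eta>" if "i < n" for i by (simp add: \<tau>_def s_eta[OF that] s\<eta>)
  have \<eta>_emeasure: "emeasure \<eta> A = (\<Sum>i<n. emeasure (\<tau> i) A)" if "A \<in> sets borel" for A
    unfolding \<eta>_def \<tau>_def using vs eta_prob that
    by (subst emeasure_mixture[OF n sub that]) auto
  have ac: "absolutely_continuous \<eta> (\<tau> i)" if i: "i < n" for i
    unfolding absolutely_continuous_def
  proof (rule subsetI)
    fix A assume "A \<in> null_sets \<eta>"
    then have "A \<in> sets borel" "emeasure \<eta> A = 0" using s\<eta> by auto
    then have A: "A \<in> sets borel" "(\<Sum>i<n. emeasure (\<tau> i) A) = 0" using \<eta>_emeasure[of A] by simp_all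
    then have "emeasure (\<tau> i) A = 0" using i by simp
    then show "A \<in> null_sets (\<tau> i)" using A by (auto simp: s\<tau>[OF i] s\<eta>)
  qed
  define h where "h i = RN_deriv \<eta> (\<tau> i)" for i
  have h_meas: "h i \<in> borel_measurable borel" for i
    using borel_measurable_RN_deriv[of \<eta> "\<tau> i"] s\<eta> by (simp add: h_def cong: measurable_cong_sets)
  have h: "density \<eta> (h i) = \<tau> i" if "i < n" for i
    unfolding h_def by (rule density_RN_deriv[OF ac[OF that] s\<tau>[OF that]])
  have h_int: "(\<integral>\<^sup>+x. h i x * f x \<partial>\<eta>) = ennreal (t i) * (\<integral>\<^sup>+x. f x \<partial>\<eta>_inv P (vs i))"
    if "i < n" "f \<in> borel_measurable borel" for i f
  proof -
    have "(\<integral>\<^sup>+x. h i x * f x \<partial>\<eta>) = (\<integral>\<^sup>+x. f x \<partial>\<tau> i)"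
      using that h_meas s\<eta>
      by (subst h[OF that(1), symmetric], subst nn_integral_density) (auto cong: measurable_cong_sets)
    then show ?thesis
      unfolding \<tau>_def using that s_eta[OF that(1)]
      by (simp add: nn_integral_scale_measure cong: measurable_cong_sets)
  qed
  have sum_h: "AE x in \<eta>. (\<Sum>i<n. h i x) = 1"
  proof (rule density_unique)
    show "(\<lambda>x. \<Sum>i<n. h i x) \<in> borel_measurable \<eta>" "(\<lambda>x. 1) \<in> borel_measurable \<eta>"
      using h_meas s\<eta> by (auto cong: measurable_cong_sets)
    show "density \<eta> (\<lambda>x. \<Sum>i<n. h i x) = density \<eta> (\<lambda>x. 1)"
    proof (rule measure_eqI)
      fix A assume "A \<in> sets (density \<eta> (\<lambda>x. \<Sum>i<n. h i x))"
      then have A: "A \<in> sets borel" by (simp add: s\<eta>)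
      have ind: "(indicator A :: 'x \<Rightarrow> ennreal) \<in> borel_measurable borel" using A by simp
      have "emeasure (density \<eta> (\<lambda>x. \<Sum>i<n. h i x)) A = (\<integral>\<^sup>+x. (\<Sum>i<n. h i x * indicator A x) \<partial>\<eta>)"
        using A h_meas s\<eta> by (subst emeasure_density) (auto simp: sum_distrib_right cong: measurable_cong_sets)
      also have "\<dots> = (\<Sum>i<n. \<integral>\<^sup>+x. h i x * indicator A x \<partial>\<eta>)"
        using A h_meas s\<eta> by (intro nn_integral_sum) (auto cong: measurable_cong_sets)
      also have "\<dots> = (\<integral>\<^sup>+x. indicator A x \<partial>\<eta>)"
        unfolding \<eta>_int[OF ind] using h_int[OF _ ind] by simp
      also have "\<dots> = emeasure (density \<eta> (\<lambda>x. 1)) A"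
        using A s\<eta> by (subst emeasure_density) auto
      finally show "emeasure (density \<eta> (\<lambda>x. \<Sum>i<n. h i x)) A = emeasure (density \<eta> (\<lambda>x. 1)) A" .
    qed simp
  qed
  \<comment> \<open>On the null set where the densities do not sum to 1, the first control is used.\<close>
  define w where "w i x = (if (\<Sum>i<n. h i x) = 1 then h i x else if i = 0 then 1 else 0)" for i x
  have w_meas: "w i \<in> borel_measurable borel" for i
    unfolding w_def using h_meas by (intro measurable_If) (auto intro!: borel_measurable_sum)
  have w_sum: "(\<Sum>i<n. w i x) = 1" for x
    using n by (cases "(\<Sum>i<n. h i x) = 1") (auto simp: w_def)
  define v where "v x = mixture n (\<lambda>i. w i x) (\<lambda>i. vs i x)" for x
  have vs': "vs i \<in> borel \<rightarrow>\<^sub>M prob_algebra borel" if "i < n" for i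
    using vs[OF that] by (simp add: stationary_controls_def)
  have v: "v \<in> SM"
    unfolding stationary_controls_def v_def[abs_def] using vs' w_meas w_sum by (intro measurable_mixture[OF n]) auto
  have v_int: "(\<integral>\<^sup>+u. g u \<partial>v x) = (\<Sum>i<n. w i x * (\<integral>\<^sup>+u. g u \<partial>vs i x))" if "g \<in> borel_measurable borel" for g x
    unfolding v_def using vs' that measurable_space[OF vs', of _ x]
    by (intro nn_integral_mixture sub) auto
  have occ_int: "(\<integral>\<^sup>+z. f z \<partial>occupation v \<eta>) = (\<Sum>i<n. ennreal (t i) * (\<integral>\<^sup>+z. f z \<partial>occ (vs i)))"
    if f: "f \<in> borel_measurable borel" for f
  proof -
    let ?G = "\<lambda>i x. \<integral>\<^sup>+u. f (x, u) \<partial>vs i x"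
    have fx: "(\<lambda>u. f (x, u)) \<in> borel_measurable borel" for x
      by (rule measurable_compose[OF _ f]) (simp add: borel_prod[symmetric])
    have G_meas: "?G i \<in> borel_measurable borel" if "i < n" for i
    proof -
      have "(\<lambda>x. distr (vs i x) borel (Pair x)) \<in> borel \<rightarrow>\<^sub>M subprob_algebra (borel :: ('x \<times> 'u) measure)"
        by (rule measurable_prob_algebraD[OF measurable_occupation_kernel[OF vs[OF that] \<eta>_prob]])
      from measurable_compose[OF this nn_integral_measurable_subprob_algebra[OF f]]
      show ?thesis by (simp add: nn_integral_distr[OF measurable_Pair_control[OF vs[OF that] \<eta>_prob]] f)
    qed
    have "(\<integral>\<^sup>+z. f z \<partial>occupation v \<eta>) = (\<integral>\<^sup>+x. (\<Sum>i<n. w i x * ?G i x) \<partial>\<eta>)"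
      unfolding nn_integral_occupation[OF v \<eta>_prob f] v_int[OF fx] ..
    also have "\<dots> = (\<integral>\<^sup>+x. (\<Sum>i<n. h i x * ?G i x) \<partial>\<eta>)"
      using sum_h by (intro nn_integral_cong_AE) (auto simp: w_def elim!: eventually_mono)
    also have "\<dots> = (\<Sum>i<n. \<integral>\<^sup>+x. h i x * ?G i x \<partial>\<eta>)"
      using h_meas G_meas s\<eta> by (intro nn_integral_sum) (auto cong: measurable_cong_sets)
    also have "\<dots> = (\<Sum>i<n. ennreal (t i) * (\<integral>\<^sup>+x. ?G i x \<partial>\<eta>_inv P (vs i)))"
      using h_int G_meas by simp
    also have "\<dots> = (\<Sum>i<n. ennreal (t i) * (\<integral>\<^sup>+z. f z \<partial>occ (vs i)))"
      using nn_integral_occupation[OF vs eta_prob[OF vs] f] by simp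
    finally show ?thesis .
  qed
  have P_meas: "(\<lambda>z. \<integral>\<^sup>+y. f y \<partial>(case z of (x, u) \<Rightarrow> P x u)) \<in> borel_measurable borel"
    if "f \<in> borel_measurable borel" for f
    using measurable_compose[OF measurable_prob_algebraD[OF kernel[unfolded stochastic_kernel_def]]
        nn_integral_measurable_subprob_algebra[OF that]] by simp
  have bind_int: "(\<integral>\<^sup>+y. f y \<partial>(\<xi> \<bind> step P u)) = (\<integral>\<^sup>+z. \<integral>\<^sup>+y. f y \<partial>(case z of (x, u) \<Rightarrow> P x u) \<partial>occupation u \<xi>)"
    if f: "f \<in> borel_measurable borel" and u: "u \<in> SM" and \<xi>: "\<xi> \<in> space (prob_algebra borel)" for f u \<xi>
  proof -
    have "(\<lambda>(x, u). P x u) \<in> occupation u \<xi> \<rightarrow>\<^sub>M subprob_algebra borel"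
      using measurable_prob_algebraD[OF kernel[unfolded stochastic_kernel_def]] occupation_prob[OF u \<xi>]
      by (simp add: space_prob_algebra cong: measurable_cong_sets)
    then show ?thesis unfolding occupation_bind[OF u \<xi> kernel, symmetric] by (rule nn_integral_bind[OF f])
  qed
  have sb: "sets (\<eta> \<bind> step P v) = sets borel" by (rule sets_bind'[OF \<eta>_prob measurable_step[OF kernel v]])
  have "\<eta> \<bind> step P v = \<eta>"
  proof (rule measure_eqI)
    fix A assume "A \<in> sets (\<eta> \<bind> step P v)"
    then have A: "A \<in> sets borel" by (simp add: sb)
    have ind: "(indicator A :: 'x \<Rightarrow> ennreal) \<in> borel_measurable borel" using A by simp
    have "(\<integral>\<^sup>+y. indicator A y \<partial>(\<eta> \<bind> step P v)) =
        (\<Sum>i<n. ennreal (t i) * (\<integral>\<^sup>+y. indicator A y \<partial>(\<eta>_inv P (vs i) \<bind> step P (vs i))))"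
      unfolding bind_int[OF ind v \<eta>_prob] occ_int[OF P_meas[OF ind]]
      using bind_int[OF ind vs eta_prob[OF vs]] by simp
    also have "\<dots> = (\<integral>\<^sup>+y. indicator A y \<partial>\<eta>)" unfolding \<eta>_int[OF ind] by (simp add: eta_bind[OF vs])
    finally show "emeasure (\<eta> \<bind> step P v) A = emeasure \<eta> A" using A sb s\<eta> by simp
  qed (simp add: sb s\<eta>)
  then have \<eta>_eq: "\<eta> = \<eta>_inv P v" by (rule eta_unique[OF v \<eta>_prob])
  have "occ v = mixture n (\<lambda>i. ennreal (t i)) (\<lambda>i. occ (vs i))"
  proof (rule measure_eqI)
    have s1: "sets (occ v) = sets borel" using occ_prob[OF v] by (simp add: space_prob_algebra)
    have s2: "sets (mixture n (\<lambda>i. ennreal (t i)) (\<lambda>i. occ (vs i))) = sets borel"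
      using occ_prob[OF vs] by (intro sets_mixture[OF n]) (auto simp: space_prob_algebra)
    show "sets (occ v) = sets (mixture n (\<lambda>i. ennreal (t i)) (\<lambda>i. occ (vs i)))" by (simp add: s1 s2)
    fix A assume "A \<in> sets (occ v)"
    then have A: "A \<in> sets borel" by (simp add: s1)
    have ind: "(indicator A :: ('x \<times> 'u) \<Rightarrow> ennreal) \<in> borel_measurable borel" using A by simp
    have "(\<integral>\<^sup>+z. indicator A z \<partial>occ v) = (\<integral>\<^sup>+z. indicator A z \<partial>mixture n (\<lambda>i. ennreal (t i)) (\<lambda>i. occ (vs i)))"
      unfolding \<eta>_eq[symmetric] occ_int[OF ind]
      by (intro nn_integral_mixture[OF _ ind, symmetric] sub occ_prob vs)
    then show "emeasure (occ v) A = emeasure (mixture n (\<lambda>i. ennreal (t i)) (\<lambda>i. occ (vs i))) A"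
      using A by (simp add: s1 s2)
  qed
  with v \<eta>_eq show ?thesis by (auto simp: \<eta>_def)
qed

text \<open>Convergence of the weights thus gives Wasserstein convergence of the mixed invariant laws.\<close>

lemma tv_dist_mixture:
  fixes N :: "nat \<Rightarrow> 'a::topological_space measure"
  assumes s: "s \<in> weights n" and t: "t \<in> weights n" and N: "\<And>i. i < n \<Longrightarrow> N i \<in> space (prob_algebra borel)"
  shows "tv_dist (mixture n (\<lambda>i. ennreal (s i)) N) (mixture n (\<lambda>i. ennreal (t i)) N) \<le> (\<Sum>i<n. \<bar>s i - t i\<bar>)"
  unfolding tv_dist_def
proof (rule cSUP_least)
  show "{f \<in> borel_measurable borel. \<forall>x. \<bar>f x\<bar> \<le> (1 :: real)} \<noteq> {}" by (auto intro!: exI[of _ "\<lambda>_. 0"])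
  fix f :: "'a \<Rightarrow> real" assume f: "f \<in> {f \<in> borel_measurable borel. \<forall>x. \<bar>f x\<bar> \<le> (1 :: real)}"
  have int: "integrable (N i) f" and le: "\<bar>\<integral>x. f x \<partial>N i\<bar> \<le> 1" if i: "i < n" for i
  proof -
    have "prob_space (N i)" and sN: "sets (N i) = sets borel" using N[OF i] by (auto simp: space_prob_algebra)
    then interpret prob_space "N i" by simp
    have "f \<in> borel_measurable (N i)" using f sN by (simp cong: measurable_cong_sets)
    then show int: "integrable (N i) f" using f by (intro integrable_const_bound[of _ 1]) auto
    have "\<bar>\<integral>x. f x \<partial>N i\<bar> \<le> (\<integral>x. 1 \<partial>N i)"
      using f int by (intro order_trans[OF integral_abs_bound] integral_mono) auto
    then show "\<bar>\<integral>x. f x \<partial>N i\<bar> \<le> 1" by (simp add: prob_space)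
  qed
  have fm: "f \<in> borel_measurable borel" using f by simp
  have "\<bar>(\<Sum>i<n. s i * (\<integral>x. f x \<partial>N i)) - (\<Sum>i<n. t i * (\<integral>x. f x \<partial>N i))\<bar> = \<bar>\<Sum>i<n. (s i - t i) * (\<integral>x. f x \<partial>N i)\<bar>"
    by (simp add: sum_subtractf[symmetric] left_diff_distrib)
  also have "\<dots> \<le> (\<Sum>i<n. \<bar>(s i - t i) * (\<integral>x. f x \<partial>N i)\<bar>)" by (rule sum_abs)
  also have "\<dots> \<le> (\<Sum>i<n. \<bar>s i - t i\<bar>)"
    using le by (intro sum_mono) (auto simp: abs_mult intro: mult_left_le)
  finally show "\<bar>(\<integral>x. f x \<partial>mixture n (\<lambda>i. ennreal (s i)) N) - (\<integral>x. f x \<partial>mixture n (\<lambda>i. ennreal (t i)) N)\<bar> \<le>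
      (\<Sum>i<n. \<bar>s i - t i\<bar>)"
    by (simp add: integral_mixture[OF s N fm int] integral_mixture[OF t N fm int])
qed

text \<open>The mixture with weights \<open>t\<close> costs \<open>\<Sum>\<^sub>j t\<^sub>j J(v\<^sub>j, \<mu>)\<close> against every population \<open>\<mu>\<close>, so
  \<open>symmetric_equilibrium_on_simplex\<close> applies with the population of the mixture itself.\<close>

lemma finite_equilibrium:
  fixes n :: nat
  assumes n: "0 < n" and vs: "\<And>i. i < n \<Longrightarrow> vs i \<in> SM"
  shows "\<exists>v\<in>SM. \<forall>i<n. J v (\<eta>_inv P v) \<le> J (vs i) (\<eta>_inv P v)"
proof -
  have "\<forall>t\<in>weights n. \<exists>v. v \<in> SM \<and> occ v = mixture n (\<lambda>i. ennreal (t i)) (\<lambda>i. occ (vs i)) \<and>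
     \<eta>_inv P v = mixture n (\<lambda>i. ennreal (t i)) (\<lambda>i. \<eta>_inv P (vs i))"
    by (intro ballI occ_mixture[OF n _ vs, unfolded Bex_def])
  from bchoice[OF this] obtain mix where *: "\<forall>t\<in>weights n. mix t \<in> SM \<and>
      occ (mix t) = mixture n (\<lambda>i. ennreal (t i)) (\<lambda>i. occ (vs i)) \<and>
      \<eta>_inv P (mix t) = mixture n (\<lambda>i. ennreal (t i)) (\<lambda>i. \<eta>_inv P (vs i))"
    by auto
  have mix: "mix t \<in> SM"
    and occ_mix: "occ (mix t) = mixture n (\<lambda>i. ennreal (t i)) (\<lambda>i. occ (vs i))"
    and eta_mix: "\<eta>_inv P (mix t) = mixture n (\<lambda>i. ennreal (t i)) (\<lambda>i. \<eta>_inv P (vs i))"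
    if "t \<in> weights n" for t
    using *[rule_format, OF that] by - (elim conjE, assumption)+
  define G where "G i t = J (vs i) (\<eta>_inv P (mix t))" for i t
  have "\<exists>t\<in>weights n. \<forall>i<n. (\<Sum>j<n. t j * G j t) \<le> G i t"
  proof (rule symmetric_equilibrium_on_simplex[OF n])
    fix X :: "nat \<Rightarrow> nat \<Rightarrow> real" and t i
    assume X: "\<And>k. X k \<in> weights n" and t: "t \<in> weights n" and lim: "\<And>j. j < n \<Longrightarrow> (\<lambda>k. X k j) \<longlonglongrightarrow> t j"
      and i: "i < n"
    have "(\<lambda>k. tv_dist (\<eta>_inv P (mix (X k))) (\<eta>_inv P (mix t))) \<longlonglongrightarrow> 0"
    proof (rule tendsto_sandwich[OF _ _ tendsto_const])
      have "(\<lambda>k. \<Sum>j<n. \<bar>X k j - t j\<bar>) \<longlonglongrightarrow> (\<Sum>j<n. \<bar>t j - t j\<bar>)"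
        using lim by (intro tendsto_intros) auto
      then show "(\<lambda>k. \<Sum>j<n. \<bar>X k j - t j\<bar>) \<longlonglongrightarrow> 0" by simp
      show "\<forall>\<^sub>F k in sequentially. tv_dist (\<eta>_inv P (mix (X k))) (\<eta>_inv P (mix t)) \<le> (\<Sum>j<n. \<bar>X k j - t j\<bar>)"
        unfolding eta_mix[OF X] eta_mix[OF t]
        by (intro always_eventually allI tv_dist_mixture X t eta_prob vs)
      show "\<forall>\<^sub>F k in sequentially. 0 \<le> tv_dist (\<eta>_inv P (mix (X k))) (\<eta>_inv P (mix t))"
        using tv_dist_bound[OF eta_prob[OF mix[OF X]] eta_prob[OF mix[OF t]], of "\<lambda>_. 0" 1] by simp
    qed
    then have "limitin TW (\<lambda>k. \<eta>_inv P (mix (X k))) (\<eta>_inv P (mix t)) sequentially"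
      by (rule eta_tendsto_of_tv[OF mix[OF X] mix[OF t]])
    then have "(\<lambda>k. J (vs i) (\<eta>_inv P (mix (X k))) - J (vs i) (\<eta>_inv P (mix t))) \<longlonglongrightarrow> 0"
      using vs[OF i] mix[OF X] mix[OF t] by (intro J_difference_tendsto) auto
    then show "(\<lambda>k. G i (X k)) \<longlonglongrightarrow> G i t" unfolding G_def by (simp add: LIM_zero_iff)
  qed
  then obtain t where t: "t \<in> weights n" and le: "\<And>i. i < n \<Longrightarrow> (\<Sum>j<n. t j * G j t) \<le> G i t" by blast
  let ?\<mu> = "\<eta>_inv P (mix t)"
  have \<mu>: "?\<mu> \<in> \<G>" using mix[OF t] by blast
  have "J (mix t) ?\<mu> = (\<Sum>j<n. t j * G j t)"
    unfolding J_def[of "mix t"] occ_mix[OF t] G_def J_def[of "vs _"]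
    by (rule integral_mixture[OF t occ_prob[OF vs] cost_meas[OF \<mu>] J_dominated[OF vs \<mu>]])
  with le mix[OF t] show ?thesis by (auto simp: G_def intro!: bexI[of _ "mix t"])
qed

text \<open>\<open>S w\<close> is the set of controls on which \<open>w\<close> does not improve. It is closed, because both sides of its
  inequality are continuous in \<open>v\<close>, in spite of the population moving along with \<open>v\<close>.\<close>

lemma equilibrium_exists: "\<exists>v\<in>SM. \<forall>w\<in>SM. J v (\<eta>_inv P v) \<le> J w (\<eta>_inv P v)"
proof -
  define S where "S w = {v \<in> SM. J v (\<eta>_inv P v) \<le> J w (\<eta>_inv P v)}" for w
  have closed: "closedin TM (S w)" if w: "w \<in> SM" for w
    unfolding Metric_space.metric_closedin_iff_sequentially_closed[OF SM_metric]
  proof (intro conjI allI impI)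
    fix \<sigma> v assume *: "range \<sigma> \<subseteq> S w \<and> limitin TM \<sigma> v sequentially"
    then have lim: "limitin TM \<sigma> v sequentially" and v: "v \<in> SM" using limitin_TM by auto
    have \<sigma>: "\<sigma> n \<in> SM" "J (\<sigma> n) (\<eta>_inv P (\<sigma> n)) \<le> J w (\<eta>_inv P (\<sigma> n))" for n
      using * by (auto simp: S_def)
    have \<mu>: "\<eta>_inv P v \<in> \<G>" "\<And>n. \<eta>_inv P (\<sigma> n) \<in> \<G>" using v \<sigma> by auto
    note diff = J_difference_tendsto[OF _ \<mu>(2,1) eta_tendsto[OF \<sigma>(1) lim]]
    have "(\<lambda>n. (J (\<sigma> n) (\<eta>_inv P (\<sigma> n)) - J (\<sigma> n) (\<eta>_inv P v)) + J (\<sigma> n) (\<eta>_inv P v)) \<longlonglongrightarrow> 0 + J v (\<eta>_inv P v)"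
      by (intro tendsto_add diff \<sigma> J_tendsto_control lim \<mu>)
    moreover have "(\<lambda>n. J w (\<eta>_inv P (\<sigma> n)) - J w (\<eta>_inv P v)) \<longlonglongrightarrow> 0" by (rule diff[OF w])
    then have "(\<lambda>n. J w (\<eta>_inv P (\<sigma> n))) \<longlonglongrightarrow> J w (\<eta>_inv P v)" by (simp add: LIM_zero_iff)
    ultimately have "J v (\<eta>_inv P v) \<le> J w (\<eta>_inv P v)" using \<sigma>(2) by (intro LIMSEQ_le) auto
    with v show "v \<in> S w" by (simp add: S_def)
  qed (auto simp: S_def)
  have "\<Inter>(S ` SM) \<noteq> {}"
    using compact_TM unfolding compact_space_fip
  proof (elim allE impE)
    show "(\<forall>C\<in>S ` SM. closedin TM C) \<and> (\<forall>\<F>. finite \<F> \<and> \<F> \<subseteq> S ` SM \<longrightarrow> \<Inter>\<F> \<noteq> {})"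
    proof (intro conjI allI impI)
      fix \<F> assume "finite \<F> \<and> \<F> \<subseteq> S ` SM"
      then obtain F where F: "F \<subseteq> SM" "finite F" "\<F> = S ` F" by (meson finite_subset_image)
      show "\<Inter>\<F> \<noteq> {}"
      proof (cases "F = {}")
        case False
        obtain vs where vs: "F = vs ` {..<card F}"
          using ex_bij_betw_nat_finite[OF F(2)] by (auto simp: bij_betw_def atLeast0LessThan)
        have "\<exists>v\<in>SM. \<forall>i<card F. J v (\<eta>_inv P v) \<le> J (vs i) (\<eta>_inv P v)"
        proof (rule finite_equilibrium)
          show "0 < card F" using False F by (simp add: card_gt_0_iff)
          show "vs i \<in> SM" if "i < card F" for i
            using F(1) vs that by (metis imageI lessThan_iff subsetD)
        qed
        then obtain v where v: "v \<in> SM" "\<And>i. i < card F \<Longrightarrow> J v (\<eta>_inv P v) \<le> J (vs i) (\<eta>_inv P v)" by blast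
        have "v \<in> S w" if "w \<in> F" for w
        proof -
          obtain i where "i < card F" "w = vs i" using vs \<open>w \<in> F\<close> by (metis imageE lessThan_iff)
          then show ?thesis using v by (simp add: S_def)
        qed
        then show ?thesis using F(3) by blast
      qed (simp add: F)
    qed (use closed in auto)
  qed
  then obtain v where v: "\<And>w. w \<in> SM \<Longrightarrow> v \<in> S w" by blast
  then have "v \<in> SM" using constant_control by (auto simp: S_def)
  with v show ?thesis by (auto simp: S_def)
qed

end

section \<open>The optimality equation at an equilibrium\<close>

context controlled_drift_model
begin

text \<open>When actions converge, so do the controls that always play them, and for constant
  controls the assumption on the topology of controls is a statement about the kernel.\<close>

lemma kernel_weakly_continuous:
  assumes us: "us \<longlonglongrightarrow> u" and f: "continuous_on UNIV (f :: 'x \<Rightarrow> real)" "bounded (range f)"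
  shows "(\<lambda>n. \<integral>y. f y \<partial>P x (us n)) \<longlonglongrightarrow> (\<integral>y. f y \<partial>P x u)"
proof -
  let ?c = "\<lambda>u _ :: 'x. return borel u :: 'u measure"
  have "weakly_converges (\<lambda>n. ?c (us n) y) (?c u y)" for y :: 'x
    unfolding weakly_converges_def
  proof (intro allI impI, elim conjE)
    fix g :: "'u \<Rightarrow> real" assume g: "continuous_on UNIV g"
    have "g \<in> borel_measurable borel" by (rule borel_measurable_continuous_onI[OF g])
    moreover have "(\<lambda>n. g (us n)) \<longlonglongrightarrow> g u"
      using continuous_on_tendsto_compose[OF g us] by simp
    ultimately show "(\<lambda>n. \<integral>y. g y \<partial>?c (us n) y) \<longlonglongrightarrow> (\<integral>y. g y \<partial>?c u y)"
      by (simp add: integral_return)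
  qed
  moreover have "\<forall>vs. \<forall>v\<in>SM. (\<forall>n. vs n \<in> SM) \<and> (\<forall>x. weakly_converges (\<lambda>n. vs n x) (v x)) \<longrightarrow>
      (\<lambda>n. d_M (vs n) v) \<longlonglongrightarrow> 0"
    using controls unfolding control_topology_def by (elim conjE)
  ultimately have "(\<lambda>n. d_M (?c (us n)) (?c u)) \<longlonglongrightarrow> 0"
    using constant_control by simp
  then have "limitin TM (\<lambda>n. ?c (us n)) (?c u) sequentially"
    using constant_control by (simp add: limitin_TM)
  then have lim: "limitin (prod_topology euclidean TM) (\<lambda>n. (x, ?c (us n))) (x, ?c u) sequentially"
    by (simp add: limitin_pairwise o_def)
  let ?F = "\<lambda>(x, w). \<lambda>i\<in>{1..1 :: nat}. \<integral>\<omega>. (\<integral>u. f (fst (\<omega> i, u)) \<partial>w (\<omega> i)) \<partial>stationary_law P w x"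
  have "continuous_on UNIV (\<lambda>z :: 'x \<times> 'u. f (fst z))"
    by (rule continuous_on_compose2[OF f(1)]) (auto intro: continuous_intros)
  moreover have "bounded (range (\<lambda>z :: 'x \<times> 'u. f (fst z)))"
    by (rule bounded_subset[OF f(2)]) auto
  ultimately have "continuous_map (prod_topology euclidean TM) (powertop_real {1..1}) ?F"
    using controls unfolding control_topology_def by blast
  from continuous_map_limit[OF this lim]
  have "limitin euclideanreal (\<lambda>n. (?F \<circ> (\<lambda>n. (x, ?c (us n)))) n 1) (?F (x, ?c u) 1) sequentially"
    unfolding limitin_componentwise by auto
  moreover have "?F (x, ?c u') 1 = (\<integral>y. f y \<partial>P x u')" for u'
    using integral_stationary_law[OF kernel constant_control, of f u' x] borel_measurable_continuous_onI[OF f(1)]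
      prob_space.prob_space[OF prob_space_return[of u' "borel :: 'u measure"]]
    by (simp add: step_constant_control integral_return)
  ultimately show ?thesis by (simp add: o_def)
qed

context
  fixes \<mu> :: "'x measure" and V :: "'x \<Rightarrow> real" and \<rho> :: real
  assumes \<mu>: "\<mu> \<in> \<G>" and acoe: "acoe_solution P r K W x0 \<mu> V \<rho>"
begin

definition PV :: "'x \<times> 'u \<Rightarrow> real" where "PV z = (\<integral>y. V y \<partial>P (fst z) (snd z))"

text \<open>The loss in the optimality equation from playing \<open>snd z\<close> in the state \<open>fst z\<close>.\<close>

definition gap :: "'x \<times> 'u \<Rightarrow> real" where
  "gap z = r (fst z) (snd z) \<mu> + PV z - (V (fst z) + \<rho>)"

lemma V_continuous: "continuous_on UNIV V" and V_small_o: "V \<in> small_o K W"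
  and V_minimum: "is_minimum (V x + \<rho>) (range (\<lambda>u. r x u \<mu> + (\<integral>y. V y \<partial>P x u)))"
  using acoe by (auto simp: acoe_solution_def)

lemma V_meas [measurable]: "V \<in> borel_measurable borel"
  by (rule borel_measurable_continuous_onI[OF V_continuous])

lemma V_negligible: "negligible_wrt W V"
  by (rule negligible_wrtI[OF V_small_o W_ge_1 continuous_bounded_on_compact[OF V_continuous compact_K]])

lemma gap_nonneg: "0 \<le> gap z"
  using V_minimum[of "fst z"] unfolding is_minimum_def gap_def PV_def by force

lemma V_dominated: "\<exists>c>0. \<forall>x. \<bar>V x\<bar> \<le> c * W x"
proof -
  obtain L where L: "0 \<le> L" "\<forall>x. \<bar>V x\<bar> \<le> L + 1 * W x"
    using V_negligible unfolding negligible_wrt_def by (meson zero_less_one)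
  have "\<bar>V x\<bar> \<le> (L + 1) * W x" for x
    using L(2)[rule_format, of x] mult_left_mono[OF W_ge_1[of x] L(1)] by (simp add: distrib_right)
  then show ?thesis using L(1) by (intro exI[of _ "L + 1"]) auto
qed

lemma \<beta>2_nonneg: "0 \<le> \<beta>2"
  using drift_kernel.\<beta>2[OF drift_step[OF constant_control]] .

lemma W_integrable_P: "integrable (P x u) W" and W_integral_P: "(\<integral>y. W y \<partial>P x u) \<le> W x + \<beta>2"
proof -
  have nn: "0 \<le> W y" for y using W_ge_1[of y] by simp
  have m: "W \<in> borel_measurable (P x u)" using W_meas prob_P(2)[of x u] by (simp cong: measurable_cong_sets)
  show int: "integrable (P x u) W"
    using drift_P[of x u] nn m by (intro integrableI_bounded) (auto simp: order_le_less_trans)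
  have "ennreal (\<integral>y. W y \<partial>P x u) \<le> ennreal (W x + \<beta>2)"
    using drift_P[of x u] nn_integral_eq_integral[OF int] nn by simp
  moreover have "0 \<le> W x + \<beta>2" using \<beta>2_nonneg nn[of x] by simp
  ultimately show "(\<integral>y. W y \<partial>P x u) \<le> W x + \<beta>2" by (rule iffD1[OF ennreal_le_iff, rotated])
qed

lemma P_dominated:
  fixes g :: "'x \<Rightarrow> real"
  assumes g: "g \<in> borel_measurable borel" and le: "\<And>y. \<bar>g y\<bar> \<le> c * W y" and c: "0 \<le> c"
  shows "integrable (P x u) g" "\<bar>\<integral>y. g y \<partial>P x u\<bar> \<le> c * (W x + \<beta>2)"
proof -
  have m: "g \<in> borel_measurable (P x u)" using g prob_P(2)[of x u] by (simp cong: measurable_cong_sets)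
  have int: "integrable (P x u) (\<lambda>y. c * W y)" using W_integrable_P by simp
  show ig: "integrable (P x u) g"
  proof (rule Bochner_Integration.integrable_bound[OF int m AE_I2])
    show "norm (g y) \<le> norm (c * W y)" for y using le[of y] by simp
  qed
  have "\<bar>\<integral>y. g y \<partial>P x u\<bar> \<le> (\<integral>y. \<bar>g y\<bar> \<partial>P x u)" by (rule integral_abs_bound)
  also have "\<dots> \<le> (\<integral>y. c * W y \<partial>P x u)" using ig int le by (intro integral_mono) auto
  also have "\<dots> \<le> c * (W x + \<beta>2)" using W_integral_P c by (simp add: mult_left_mono)
  finally show "\<bar>\<integral>y. g y \<partial>P x u\<bar> \<le> c * (W x + \<beta>2)" .
qed

lemma PV_meas: "PV \<in> borel_measurable borel"
proof -
  have "(\<lambda>(x, u). P x u) \<in> borel \<rightarrow>\<^sub>M subprob_algebra borel"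
    by (rule measurable_prob_algebraD[OF kernel[unfolded stochastic_kernel_def]])
  from measurable_compose[OF this integral_measurable_subprob_algebra[OF V_meas]] show ?thesis
    by (simp add: PV_def[abs_def] case_prod_beta)
qed

lemma PV_dominated: "\<exists>c>0. \<forall>z. \<bar>PV z\<bar> \<le> c * W (fst z)"
proof -
  obtain c where c: "0 < c" "\<forall>x. \<bar>V x\<bar> \<le> c * W x" using V_dominated by blast
  have "\<bar>PV z\<bar> \<le> c * (1 + \<beta>2) * W (fst z)" for z
  proof -
    have "\<bar>PV z\<bar> \<le> c * (W (fst z) + \<beta>2)"
      unfolding PV_def using c by (intro P_dominated V_meas) auto
    also have "\<dots> \<le> c * (W (fst z) + \<beta>2 * W (fst z))"
      using c \<beta>2_nonneg mult_left_mono[OF W_ge_1[of "fst z"] \<beta>2_nonneg] by (intro mult_left_mono) auto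
    finally show ?thesis by (simp add: algebra_simps)
  qed
  then show ?thesis using c(1) \<beta>2_nonneg by (intro exI[of _ "c * (1 + \<beta>2)"]) auto
qed

text \<open>Weak continuity of the kernel covers bounded functions; \<open>V\<close> differs from its truncation
  by at most \<open>\<epsilon> W\<close>, and \<open>W\<close> has integrals bounded in the action.\<close>

lemma PV_continuous_control: "continuous_on UNIV (\<lambda>u. PV (x, u))"
  unfolding continuous_on_sequentially
proof (intro allI ballI impI)
  fix us and u :: 'u assume "(\<forall>n. us n \<in> UNIV) \<and> us \<longlonglongrightarrow> u"
  then have us: "us \<longlonglongrightarrow> u" by simp
  show "((\<lambda>u. PV (x, u)) \<circ> us) \<longlonglongrightarrow> PV (x, u)"
  proof (rule LIMSEQ_I)
    fix e :: real assume e: "0 < e"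
    have pos: "0 < W x + \<beta>2" using W_ge_1[of x] \<beta>2_nonneg by simp
    define \<epsilon> where "\<epsilon> = e / (4 * (W x + \<beta>2))"
    have "e / (4 * a) * a = e / 4" if "0 < a" for a using that by simp
    from this[OF pos] have \<epsilon>: "0 < \<epsilon>" "\<epsilon> * (W x + \<beta>2) = e / 4" using e pos by (simp_all add: \<epsilon>_def)
    obtain L where L: "0 \<le> L" "\<And>y. \<bar>V y\<bar> \<le> L + \<epsilon> * W y"
      using V_negligible \<epsilon>(1) unfolding negligible_wrt_def by blast
    let ?h = "\<lambda>y. max (- L) (min (V y) L)"
    have hc: "continuous_on UNIV ?h" by (intro continuous_intros V_continuous)
    have hb: "bounded (range ?h)" using L(1) by (auto simp: bounded_iff intro!: exI[of _ L])
    have hm: "?h \<in> borel_measurable borel" by (rule borel_measurable_continuous_onI[OF hc])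
    have diff: "\<bar>PV (x, u') - (\<integral>y. ?h y \<partial>P x u')\<bar> \<le> e / 4" for u'
    proof -
      obtain c where c: "0 < c" "\<forall>x. \<bar>V x\<bar> \<le> c * W x" using V_dominated by blast
      have iV: "integrable (P x u') V" using c by (intro P_dominated V_meas) auto
      have ih: "integrable (P x u') ?h"
      proof (rule P_dominated(1)[OF hm])
        show "\<bar>?h y\<bar> \<le> L * W y" for y
          using L(1) mult_left_mono[OF W_ge_1[of y] L(1)] by (auto simp: abs_le_iff max_def min_def)
      qed (rule L(1))
      have "PV (x, u') - (\<integral>y. ?h y \<partial>P x u') = (\<integral>y. V y - ?h y \<partial>P x u')"
        unfolding PV_def by (simp add: Bochner_Integration.integral_diff[OF iV ih])
      also have "\<bar>\<dots>\<bar> \<le> \<epsilon> * (W x + \<beta>2)"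
      proof (rule P_dominated(2))
        show "(\<lambda>y. V y - ?h y) \<in> borel_measurable borel" using hm by simp
        show "\<bar>V y - ?h y\<bar> \<le> \<epsilon> * W y" for y
        proof -
          have "0 \<le> \<epsilon> * W y" using \<epsilon>(1) W_ge_1[of y] by simp
          then show ?thesis using L(2)[of y] L(1) by (auto simp: abs_le_iff max_def min_def)
        qed
      qed (use \<epsilon> in simp)
      finally show ?thesis by (simp add: \<epsilon>(2))
    qed
    obtain N where N: "\<And>n. n \<ge> N \<Longrightarrow> norm ((\<integral>y. ?h y \<partial>P x (us n)) - (\<integral>y. ?h y \<partial>P x u)) < e / 4"
      using kernel_weakly_continuous[OF us hc hb] e by (meson LIMSEQ_D zero_less_divide_iff zero_less_numeral)
    show "\<exists>N. \<forall>n\<ge>N. norm (((\<lambda>u. PV (x, u)) \<circ> us) n - PV (x, u)) < e"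
    proof (intro exI allI impI)
      fix n assume "n \<ge> N"
      then show "norm (((\<lambda>u. PV (x, u)) \<circ> us) n - PV (x, u)) < e"
        using N[of n] diff[of "us n"] diff[of u] e unfolding real_norm_def o_def by linarith
    qed
  qed
qed

lemma gap_integrable_parts:
  assumes v: "v \<in> SM"
  shows "integrable (occ v) PV" "integrable (occ v) (\<lambda>z. V (fst z))"
proof -
  obtain c where c: "0 < c" "\<forall>z. \<bar>PV z\<bar> \<le> c * W (fst z)" using PV_dominated by blast
  then show "integrable (occ v) PV" by (intro occ_dominated(1)[OF v PV_meas, of 0 c]) auto
  obtain c where c: "0 < c" "\<forall>x. \<bar>V x\<bar> \<le> c * W x" using V_dominated by blast
  then show "integrable (occ v) (\<lambda>z. V (fst z))"
    by (intro occ_dominated(1)[OF v measurable_fst_borel[OF V_meas], of 0 c]) auto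
qed

lemma eta_V_finite:
  assumes v: "v \<in> SM"
  shows "(\<integral>\<^sup>+x. ennreal \<bar>V x\<bar> \<partial>\<eta>_inv P v) < \<infinity>"
proof -
  obtain c where c: "0 < c" "\<forall>x. \<bar>V x\<bar> \<le> c * W x" using V_dominated by blast
  have s: "sets (\<eta>_inv P v) = sets borel" using eta_prob[OF v] by (simp add: space_prob_algebra)
  have "(\<integral>\<^sup>+x. ennreal \<bar>V x\<bar> \<partial>\<eta>_inv P v) \<le> (\<integral>\<^sup>+x. ennreal c * ennreal (W x) \<partial>\<eta>_inv P v)"
    using c W_ge_1 by (intro nn_integral_mono) (simp flip: ennreal_mult' add: ennreal_leI)
  also have "\<dots> = ennreal c * (\<integral>\<^sup>+x. ennreal (W x) \<partial>\<eta>_inv P v)"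
    using s by (intro nn_integral_cmult) (simp cong: measurable_cong_sets)
  also have "\<dots> < \<infinity>"
    using eta_moment[OF v] by (auto simp: ennreal_mult_less_top order_le_less_trans)
  finally show ?thesis .
qed

text \<open>After one step from \<open>\<pi>\<^sub>v\<close> the state has law \<open>\<eta>\<^sub>v\<close> again, so \<open>PV\<close> and \<open>V\<close> have the same integral
  against \<open>\<pi>\<^sub>v\<close> and cancel.\<close>

lemma J_eq_gap:
  assumes v: "v \<in> SM"
  shows "integrable (occ v) gap" "J v \<mu> = \<rho> + (\<integral>z. gap z \<partial>occ v)"
proof -
  have "prob_space (occ v)" using occ_prob[OF v] by (simp add: space_prob_algebra)
  then interpret prob_space "occ v" .
  note int = J_dominated[OF v \<mu>] gap_integrable_parts[OF v]
  show "integrable (occ v) gap" unfolding gap_def[abs_def] using int by simp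
  have V_fst: "(\<integral>z. V (fst z) \<partial>occ v) = (\<integral>x. V x \<partial>\<eta>_inv P v)"
  proof -
    have "(\<integral>\<^sup>+z. ennreal \<bar>V (fst z)\<bar> \<partial>occ v) < \<infinity>"
      using nn_integral_occupation_fst[OF v eta_prob[OF v], of "\<lambda>x. ennreal \<bar>V x\<bar>"] eta_V_finite[OF v] by simp
    from integral_occupation(3)[OF v eta_prob[OF v] measurable_fst_borel[OF V_meas] this]
    show ?thesis by (simp add: prob_space.prob_space[OF prob_space_control[OF v eta_prob[OF v]]])
  qed
  have "(\<integral>z. PV z \<partial>occ v) = (\<integral>y. V y \<partial>(occ v \<bind> (\<lambda>(x, u). P x u)))"
    unfolding PV_def
    using integral_bind_kernel(3)[OF occ_prob[OF v] kernel[unfolded stochastic_kernel_def] V_meas]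
      eta_V_finite[OF v] eta_bind[OF v] occupation_bind[OF v eta_prob[OF v] kernel]
    by (simp add: case_prod_beta)
  also have "\<dots> = (\<integral>x. V x \<partial>\<eta>_inv P v)"
    by (simp add: occupation_bind[OF v eta_prob[OF v] kernel] eta_bind[OF v])
  finally have "(\<integral>z. PV z \<partial>occ v) = (\<integral>z. V (fst z) \<partial>occ v)" by (simp add: V_fst)
  then show "J v \<mu> = \<rho> + (\<integral>z. gap z \<partial>occ v)"
    unfolding gap_def J_def using int by (simp add: prob_space)
qed

lemma gap_meas: "gap \<in> borel_measurable borel"
  unfolding gap_def[abs_def] using cost_meas[OF \<mu>] PV_meas measurable_fst_borel[OF V_meas] by simp

lemma gap_continuous_control: "continuous_on UNIV (\<lambda>u. gap (x, u))"
proof -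
  have "continuous_on UNIV (\<lambda>u. r (fst (x, u)) (snd (x, u)) \<mu>)"
    by (rule continuous_on_compose2[OF cost_continuous[OF G_P_p[OF \<mu>]]]) (auto intro!: continuous_intros)
  then have "continuous_on UNIV (\<lambda>u. r x u \<mu> + PV (x, u) - (V x + \<rho>))"
    by (intro continuous_intros PV_continuous_control) simp
  then show ?thesis by (simp add: gap_def)
qed

text \<open>Near-optimal actions form a non-empty open set for each state, so the first element of a dense sequence
  that lies in it depends measurably on the state.\<close>

lemma near_optimal_control:
  assumes e: "0 < e"
  shows "\<exists>w\<in>SM. J w \<mu> \<le> \<rho> + e"
proof -
  obtain D :: "'u set" where D: "countable D" "\<And>X. open X \<Longrightarrow> X \<noteq> {} \<Longrightarrow> \<exists>d\<in>D. d \<in> X"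
    using countable_dense_setE by blast
  have "D \<noteq> {}" using D(2)[of UNIV] by auto
  define q where "q = from_nat_into D"
  have ex: "\<exists>i. gap (x, q i) < e" for x
  proof -
    obtain u where u: "V x + \<rho> = r x u \<mu> + (\<integral>y. V y \<partial>P x u)"
      using V_minimum[of x] by (auto simp: is_minimum_def)
    have "open {u. gap (x, u) < e}"
      using open_Collect_less[OF gap_continuous_control continuous_on_const] .
    moreover have "u \<in> {u. gap (x, u) < e}" using u e by (simp add: gap_def PV_def)
    ultimately obtain d where "d \<in> D" "gap (x, d) < e" using D(2)[of "{u. gap (x, u) < e}"] by auto
    then show ?thesis using from_nat_into_surj[OF D(1)] unfolding q_def by blast
  qed
  define s where "s x = q (LEAST i. gap (x, q i) < e)" for x
  have s_gap: "gap (x, s x) < e" for x unfolding s_def by (rule LeastI_ex[OF ex])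
  have "(\<lambda>x. gap (x, q i)) \<in> borel_measurable borel" for i
    by (rule measurable_compose[OF _ gap_meas]) (simp add: borel_prod[symmetric])
  then have "(\<lambda>x. LEAST i. gap (x, q i) < e) \<in> borel \<rightarrow>\<^sub>M count_space UNIV"
    by (intro measurable_Least) simp
  then have s_meas: "s \<in> borel \<rightarrow>\<^sub>M borel" unfolding s_def by (rule measurable_compose) simp
  define w where "w x = return borel (s x)" for x
  have w: "w \<in> SM"
    unfolding stationary_controls_def w_def by (rule measurable_compose[OF s_meas measurable_return_prob_space])
  have "prob_space (\<eta>_inv P w)" using eta_prob[OF w] by (simp add: space_prob_algebra)
  have gx: "(\<lambda>u. ennreal (gap (x, u))) \<in> borel_measurable borel" for x
    using measurable_compose[OF _ gap_meas, of "Pair x" borel] by (simp add: borel_prod[symmetric])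
  have "(\<integral>\<^sup>+z. ennreal (gap z) \<partial>occ w) = (\<integral>\<^sup>+x. ennreal (gap (x, s x)) \<partial>\<eta>_inv P w)"
    using nn_integral_occupation[OF w eta_prob[OF w], of "\<lambda>z. ennreal (gap z)"] gap_meas
    by (simp add: w_def nn_integral_return gx)
  also have "\<dots> \<le> (\<integral>\<^sup>+x. ennreal e \<partial>\<eta>_inv P w)"
    using s_gap by (intro nn_integral_mono ennreal_leI) (simp add: less_imp_le)
  also have "\<dots> = ennreal e" using prob_space.emeasure_space_1[OF \<open>prob_space (\<eta>_inv P w)\<close>] by simp
  finally have "ennreal (\<integral>z. gap z \<partial>occ w) \<le> ennreal e"
    using nn_integral_eq_integral[OF J_eq_gap(1)[OF w]] gap_nonneg by simp
  then have "(\<integral>z. gap z \<partial>occ w) \<le> e" using e by simp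
  then show ?thesis using w J_eq_gap(2)[OF w] by (intro bexI[of _ w]) auto
qed

text \<open>The cost of an optimal control is \<open>\<rho>\<close>, so the non-negative function \<open>gap\<close> integrates to 0 against
  its occupation measure.\<close>

lemma optimal_control_is_minimizing_selector:
  assumes v: "v \<in> SM" and opt: "\<And>w. w \<in> SM \<Longrightarrow> J v \<mu> \<le> J w \<mu>"
  shows "minimizing_selector P r \<mu> V \<rho> (\<eta>_inv P v) v"
proof -
  have "J v \<mu> \<le> \<rho>"
  proof (rule field_le_epsilon)
    fix e :: real assume "0 < e"
    then obtain w where "w \<in> SM" "J w \<mu> \<le> \<rho> + e" using near_optimal_control by blast
    then show "J v \<mu> \<le> \<rho> + e" using opt by force
  qed
  then have "(\<integral>z. gap z \<partial>occ v) \<le> 0" using J_eq_gap(2)[OF v] by simp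
  then have "(\<integral>z. gap z \<partial>occ v) = 0" using gap_nonneg by (intro antisym integral_nonneg_AE) auto
  then have ae: "AE z in occ v. gap z = 0"
    using integral_nonneg_eq_0_iff_AE[OF J_eq_gap(1)[OF v]] gap_nonneg by simp
  have "Measurable.pred borel (\<lambda>z. gap z = 0)" using gap_meas by measurable
  from AE_occupation[OF v eta_prob[OF v] this ae]
  have "AE x in \<eta>_inv P v. AE u in v x. gap (x, u) = 0" .
  then show ?thesis
    unfolding minimizing_selector_def
  proof eventually_elim
    fix x assume ae: "AE u in v x. gap (x, u) = 0"
    note ctrl = prob_space_control[OF v eta_prob[OF v], of x] sets_control[OF v eta_prob[OF v], of x]
    interpret prob_space "v x" by (rule ctrl(1))
    have mr: "(\<lambda>u. r x u \<mu>) \<in> borel_measurable (v x)" and mP: "(\<lambda>u. PV (x, u)) \<in> borel_measurable (v x)"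
    proof -
      have "Pair x \<in> borel \<rightarrow>\<^sub>M (borel :: ('x \<times> 'u) measure)" by (simp add: borel_prod[symmetric])
      from measurable_compose[OF this cost_meas[OF \<mu>]] measurable_compose[OF this PV_meas]
      show "(\<lambda>u. r x u \<mu>) \<in> borel_measurable (v x)" "(\<lambda>u. PV (x, u)) \<in> borel_measurable (v x)"
        using ctrl(2) by (simp_all cong: measurable_cong_sets)
    qed
    have ir: "integrable (v x) (\<lambda>u. r x u \<mu>)"
      using cost_le_R[OF \<mu>] cost_nonneg[OF G_P_p[OF \<mu>]] mr
      by (intro integrable_const_bound[of _ "R x"]) auto
    obtain c where c: "0 < c" "\<forall>z. \<bar>PV z\<bar> \<le> c * W (fst z)" using PV_dominated by blast
    have iP: "integrable (v x) (\<lambda>u. PV (x, u))"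
      using mP
    proof (intro integrable_const_bound[of _ "c * W x"] AE_I2)
      show "norm (PV (x, u)) \<le> c * W x" for u using c(2)[rule_format, of "(x, u)"] by simp
    qed
    have "V x + \<rho> = (\<integral>u. V x + \<rho> \<partial>v x)" by (simp add: prob_space)
    also have "\<dots> = (\<integral>u. r x u \<mu> + PV (x, u) \<partial>v x)"
      using ae mr mP by (intro integral_cong_AE) (auto simp: gap_def elim!: eventually_mono)
    also have "\<dots> = (\<integral>u. r x u \<mu> \<partial>v x) + (\<integral>u. PV (x, u) \<partial>v x)"
      by (rule Bochner_Integration.integral_add[OF ir iP])
    finally show "V x + \<rho> = (\<integral>u. r x u \<mu> \<partial>v x) + (\<integral>u. (\<integral>y. V y \<partial>P x u) \<partial>v x)"
      by (simp add: PV_def)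
  qed
qed

end

end

lemma lsc_measurable:
  assumes "lsc (f :: 'a::topological_space \<Rightarrow> real)"
  shows "f \<in> borel_measurable borel"
  using assms by (auto simp: borel_measurable_iff_greater lsc_def intro: borel_open)

text \<open>Since the integral of \<open>\<V> \<ge> 1\<close> is at least 1, the right-hand side of the drift condition is
  not truncated, and \<open>\<beta>1 \<V>\<close> can be moved to the left.\<close>

lemma drift_pointwise:
  assumes drift: "drift_condition P \<V> C \<beta>1 \<beta>2" and P: "prob_space (P x u)"
  shows "(\<integral>\<^sup>+y. ennreal (\<V> y) \<partial>P x u) + ennreal (\<beta>1 * \<V> x) * indicator (- C) x \<le>
    ennreal (\<V> x) + ennreal \<beta>2 * indicator C x"
proof -
  have \<V>: "\<And>x. 1 \<le> \<V> x" and \<beta>: "0 < \<beta>1" "0 < \<beta>2" using drift by (auto simp: drift_condition_def)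
  have "(\<integral>\<^sup>+y. ennreal (\<V> y) \<partial>P x u) \<le> (SUP u. \<integral>\<^sup>+y. ennreal (\<V> y) \<partial>P x u)" by (intro SUP_upper) auto
  also have "\<dots> \<le> ennreal (\<V> x - \<beta>1 * \<V> x * indicator (- C) x + \<beta>2 * indicator C x)"
    using drift by (simp add: drift_condition_def)
  finally have le: "(\<integral>\<^sup>+y. ennreal (\<V> y) \<partial>P x u) \<le> ennreal (\<V> x - \<beta>1 * \<V> x * indicator (- C) x + \<beta>2 * indicator C x)" .
  show ?thesis
  proof (cases "x \<in> C")
    case True
    then show ?thesis using le \<V>[of x] \<beta> by (simp add: ennreal_plus)
  next
    case False
    have "1 = (\<integral>\<^sup>+y. 1 \<partial>P x u)" using prob_space.emeasure_space_1[OF P] by simp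
    also have "\<dots> \<le> (\<integral>\<^sup>+y. ennreal (\<V> y) \<partial>P x u)" using \<V> by (intro nn_integral_mono) simp
    also have "\<dots> \<le> ennreal (\<V> x - \<beta>1 * \<V> x)" using le False by simp
    finally have "1 \<le> \<V> x - \<beta>1 * \<V> x" by simp
    moreover have "0 \<le> \<beta>1 * \<V> x" using \<V>[of x] \<beta> by simp
    moreover have "ennreal a + ennreal b = ennreal (a + b)" if "1 \<le> a" "0 \<le> b" for a b
      using that by (simp add: ennreal_plus)
    ultimately have "ennreal (\<V> x - \<beta>1 * \<V> x) + ennreal (\<beta>1 * \<V> x) =
        ennreal (\<V> x - \<beta>1 * \<V> x + \<beta>1 * \<V> x)" by blast
    then have "ennreal (\<V> x - \<beta>1 * \<V> x) + ennreal (\<beta>1 * \<V> x) = ennreal (\<V> x)" by simp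
    then show ?thesis using add_right_mono[OF le, of "ennreal (\<beta>1 * \<V> x)"] False by simp
  qed
qed

text \<open>Drift and minorization are uniform in the action, so they survive averaging over it.\<close>

lemma drift_kernel_step:
  fixes P :: "'x::polish_space \<Rightarrow> 'u::polish_space \<Rightarrow> 'x measure"
  assumes P: "stochastic_kernel P" and v: "v \<in> stationary_controls"
    and W: "W \<in> borel_measurable borel" "\<And>x. 1 \<le> W x" and C: "C \<in> sets borel" and \<beta>: "0 < \<beta>1" "0 \<le> \<beta>2"
    and drift: "\<And>x u. (\<integral>\<^sup>+y. ennreal (W y) \<partial>P x u) + ennreal (\<beta>1 * W x) * indicator (- C) x \<le>
      ennreal (W x) + ennreal \<beta>2 * indicator C x"
    and B: "\<And>x. x \<in> C \<Longrightarrow> W x \<le> B"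
    and \<nu>: "\<nu> \<in> space (prob_algebra borel)" "emeasure \<nu> C = 1" "0 < \<gamma>"
    and minor: "\<And>A x u. A \<in> sets borel \<Longrightarrow> x \<in> C \<Longrightarrow> ennreal \<gamma> * emeasure \<nu> A \<le> emeasure (P x u) A"
  shows "drift_kernel (step P v) W C \<beta>1 \<beta>2 B \<gamma> \<nu>"
proof
  have v': "v \<in> borel \<rightarrow>\<^sub>M prob_algebra borel" using v by (simp add: stationary_controls_def)
  have vx: "v x \<in> space (prob_algebra borel)" for x by (rule measurable_space[OF v']) simp
  have prob: "prob_space (v x)" and sv: "sets (v x) = sets borel" for x using vx[of x] by (auto simp: space_prob_algebra)
  have "Pair x \<in> borel \<rightarrow>\<^sub>M (borel :: ('x \<times> 'u) measure)" for x :: 'x by (simp add: borel_prod[symmetric])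
  from measurable_compose[OF this P[unfolded stochastic_kernel_def]]
  have Px: "P x \<in> borel \<rightarrow>\<^sub>M prob_algebra borel" for x by simp
  have Pv: "P x \<in> v x \<rightarrow>\<^sub>M subprob_algebra borel" for x
    using measurable_prob_algebraD[OF Px] by (simp add: sv cong: measurable_cong_sets)
  show "step P v \<in> borel \<rightarrow>\<^sub>M prob_algebra borel" by (rule measurable_step[OF P v])
  show "(\<integral>\<^sup>+y. ennreal (W y) \<partial>step P v x) + ennreal (\<beta>1 * W x) * indicator (- C) x \<le>
      ennreal (W x) + ennreal \<beta>2 * indicator C x" for x
  proof -
    let ?c = "ennreal (\<beta>1 * W x) * indicator (- C) x :: ennreal"
    have m: "(\<lambda>y. ennreal (W y)) \<in> borel_measurable borel" using W(1) by simp
    have m': "(\<lambda>u. \<integral>\<^sup>+y. ennreal (W y) \<partial>P x u) \<in> borel_measurable (v x)"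
      by (rule measurable_compose[OF Pv nn_integral_measurable_subprob_algebra[OF m]])
    have "(\<integral>\<^sup>+y. ennreal (W y) \<partial>step P v x) + ?c = (\<integral>\<^sup>+u. (\<integral>\<^sup>+y. ennreal (W y) \<partial>P x u) + ?c \<partial>v x)"
      unfolding step_def nn_integral_bind[OF m Pv]
      using nn_integral_add[OF m', of "\<lambda>_. ?c"] prob_space.emeasure_space_1[OF prob] by simp
    also have "\<dots> \<le> (\<integral>\<^sup>+u. ennreal (W x) + ennreal \<beta>2 * indicator C x \<partial>v x)" by (intro nn_integral_mono drift)
    also have "\<dots> = ennreal (W x) + ennreal \<beta>2 * indicator C x"
      using prob_space.emeasure_space_1[OF prob] by simp
    finally show ?thesis .
  qed
  show "ennreal \<gamma> * emeasure \<nu> A \<le> emeasure (step P v x) A" if "x \<in> C" "A \<in> sets borel" for x A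
  proof -
    have "ennreal \<gamma> * emeasure \<nu> A = (\<integral>\<^sup>+u. ennreal \<gamma> * emeasure \<nu> A \<partial>v x)"
      using prob_space.emeasure_space_1[OF prob] by simp
    also have "\<dots> \<le> (\<integral>\<^sup>+u. emeasure (P x u) A \<partial>v x)" by (intro nn_integral_mono minor that)
    also have "\<dots> = emeasure (step P v x) A"
      unfolding step_def by (rule emeasure_bind[OF prob_space.not_empty[OF prob] Pv that(2), symmetric])
    finally show ?thesis .
  qed
qed (use assms in auto)

lemma small_o_compact:
  assumes "compact (UNIV :: 'x::topological_space set)" "compact_exhaustion (K :: nat \<Rightarrow> 'x set)"
  shows "small_o K g = UNIV"
proof -
  have "K n = UNIV" for n using assms by (simp add: compact_exhaustion_def)
  then show ?thesis by (simp add: small_o_def bot_ennreal Limsup_const)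
qed

text \<open>If some point lies outside \<open>C\<close>, the value of \<open>\<V>\<close> there bounds \<open>\<V>\<close> on \<open>C\<close>. If \<open>C\<close> is the whole
  space, \<open>\<V>\<close> may be unbounded on it, but then the state space is compact, every function is in
  \<open>\<oo>(\<V>)\<close>, and the constant 1 can take the place of \<open>\<V>\<close>.\<close>

lemma controlled_drift_model_of_hypotheses:
  fixes P :: "'x::polish_space \<Rightarrow> 'u::polish_space \<Rightarrow> 'x measure" and K :: "nat \<Rightarrow> 'x set"
  assumes U: "compact (UNIV :: 'u set)" and P: "stochastic_kernel P" and K: "compact_exhaustion K"
    and drift: "drift_condition P \<V> C \<beta>1 \<beta>2" and controls: "control_topology P d_M"
    and stable: "stability P C" and p: "1 \<le> p" and dist_o: "(\<lambda>x. dist x x0 powr p) \<in> small_o K \<V>"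
    and cost: "running_cost p x0 r" and growth: "cost_growth p x0 K \<V> r" and tv: "tv_continuity P d_M"
  shows "\<exists>W B \<gamma> \<nu>. controlled_drift_model P x0 K r p W C \<beta>1 \<beta>2 B \<gamma> \<nu> d_M \<and> small_o K W = small_o K \<V>"
proof -
  have \<beta>: "0 < \<beta>1" "0 < \<beta>2" and \<V>: "\<And>x. 1 \<le> \<V> x" "\<V> \<in> borel_measurable borel" and C: "compact C"
    using drift lsc_measurable by (auto simp: drift_condition_def)
  have C_borel: "C \<in> sets borel" using C by (simp add: borel_closed compact_imp_closed)
  obtain \<nu> \<gamma> where \<nu>: "\<nu> \<in> space (prob_algebra borel)" "emeasure \<nu> C = 1" "0 < \<gamma>"
    and inf: "\<forall>A\<in>sets borel. (INF u. INF x\<in>C. emeasure (P x u) A) \<ge> ennreal \<gamma> * emeasure \<nu> A"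
    using stable unfolding stability_def by (elim conjE bexE exE) (rule that)
  have minor: "ennreal \<gamma> * emeasure \<nu> A \<le> emeasure (P x u) A" if "A \<in> sets borel" "x \<in> C" for A x u
  proof -
    have "ennreal \<gamma> * emeasure \<nu> A \<le> (INF u. INF x\<in>C. emeasure (P x u) A)" using inf that(1) by blast
    also have "\<dots> \<le> (INF x\<in>C. emeasure (P x u) A)" by (rule INF_lower) simp
    also have "\<dots> \<le> emeasure (P x u) A" by (rule INF_lower) (rule that(2))
    finally show ?thesis .
  qed
  have prob: "prob_space (P x u)" for x u
    using measurable_space[OF P[unfolded stochastic_kernel_def], of "(x, u)"] by (simp add: space_prob_algebra)
  have compact_K: "compact (K n)" for n using K by (simp add: compact_exhaustion_def)
  have "\<exists>W B. W \<in> borel_measurable borel \<and> (\<forall>x. 1 \<le> W x) \<and> (\<forall>x\<in>C. W x \<le> B) \<and> small_o K W = small_o K \<V> \<and>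
    (\<forall>x u. (\<integral>\<^sup>+y. ennreal (W y) \<partial>P x u) + ennreal (\<beta>1 * W x) * indicator (- C) x \<le>
      ennreal (W x) + ennreal \<beta>2 * indicator C x)"
  proof (cases "C = UNIV")
    case True
    then have "small_o K g = UNIV" for g using C K by (intro small_o_compact) simp_all
    then show ?thesis
      using True prob_space.emeasure_space_1[OF prob]
      by (intro exI[of _ "\<lambda>_. 1"] exI[of _ 1]) simp
  next
    case False
    then obtain y where y: "y \<notin> C" by blast
    have "\<V> x \<le> \<V> y" if "x \<in> C" for x
    proof -
      have "ereal (\<V> x) \<le> (SUP x\<in>C. ereal (\<V> x))" using that by (rule SUP_upper)
      also have "\<dots> \<le> max (SUP x\<in>C. ereal (\<V> x)) (ereal (2 * \<beta>2 / \<beta>1))" by simp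
      also have "\<dots> \<le> (INF x \<in> - C. ereal (\<V> x))" using drift by (simp only: drift_condition_def)
      also have "\<dots> \<le> ereal (\<V> y)" using y by (intro INF_lower) simp
      finally show ?thesis by simp
    qed
    then show ?thesis
      using \<V> drift_pointwise[OF drift prob] by (intro exI[of _ \<V>] exI[of _ "\<V> y"]) blast
  qed
  then obtain W B where W: "W \<in> borel_measurable borel" "\<And>x. 1 \<le> W x" and B: "\<And>x. x \<in> C \<Longrightarrow> W x \<le> B"
    and o_eq: "small_o K W = small_o K \<V>"
    and drift_W: "\<And>x u. (\<integral>\<^sup>+y. ennreal (W y) \<partial>P x u) + ennreal (\<beta>1 * W x) * indicator (- C) x \<le>
      ennreal (W x) + ennreal \<beta>2 * indicator C x"
    by (elim exE conjE) (rule that, blast+)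
  have "controlled_drift_model P x0 K r p W C \<beta>1 \<beta>2 B \<gamma> \<nu> d_M"
  proof (rule controlled_drift_model.intro)
    show "drift_kernel (step P v) W C \<beta>1 \<beta>2 B \<gamma> \<nu>" if "v \<in> stationary_controls" for v
      by (rule drift_kernel_step[OF P that W C_borel \<beta>(1) less_imp_le[OF \<beta>(2)] drift_W B \<nu> minor])
    show "(\<integral>\<^sup>+y. ennreal (W y) \<partial>P x u) \<le> ennreal (W x + \<beta>2)" for x u
    proof -
      have "(\<integral>\<^sup>+y. ennreal (W y) \<partial>P x u) \<le> ennreal (W x) + ennreal \<beta>2 * indicator C x"
        using drift_W[of x u] by (rule order_trans[rotated]) simp
      also have "\<dots> \<le> ennreal (W x) + ennreal \<beta>2" by (intro add_left_mono) (simp split: split_indicator)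
      also have "\<dots> = ennreal (W x + \<beta>2)" using W(2)[of x] \<beta> by (simp add: ennreal_plus)
      finally show ?thesis .
    qed
    show "(\<lambda>x. dist x x0 powr p) \<in> small_o K W" using dist_o by (simp add: o_eq)
    show "cost_growth p x0 K W r" using growth by (simp add: cost_growth_def o_eq)
  qed (fact U P compact_K W controls p cost tv)+
  with o_eq show ?thesis by blast
qed

theorem theorem3p2:
  fixes P :: "'x::polish_space \<Rightarrow> 'u::polish_space \<Rightarrow> 'x measure"
    and x0 :: 'x
    and K :: "nat \<Rightarrow> 'x set"
    and r :: "'x \<Rightarrow> 'u \<Rightarrow> 'x measure \<Rightarrow> real"
    and p :: real
    and \<V> :: "'x \<Rightarrow> real"
    and C :: "'x set"
    and \<beta>1 \<beta>2 :: real
    and d_M :: "('x \<Rightarrow> 'u measure) \<Rightarrow> ('x \<Rightarrow> 'u measure) \<Rightarrow> real"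
  assumes "compact (UNIV :: 'u set)"
    and "stochastic_kernel P"
    and "compact_exhaustion K"
    and "drift_condition P \<V> C \<beta>1 \<beta>2"
    and "control_topology P d_M"
    and "stability P C"
    and "1 \<le> p" and "(\<lambda>x. dist x x0 powr p) \<in> small_o K \<V>"
    and "running_cost p x0 r"
    and "cost_growth p x0 K \<V> r"
    and "tv_continuity P d_M"
    and "acoe_well_posed p P r K \<V> x0"
  shows "(\<exists>\<eta>. mfg_solution P r K \<V> x0 \<eta>) \<and>
    (\<exists>\<eta> \<in> invariant_measures P. \<exists>V \<rho>. \<exists>v \<in> stationary_controls.
       continuous_on UNIV V \<and> V \<in> small_o K \<V> \<and> V x0 = 0 \<and>
       (\<forall>x. is_minimum (V x + \<rho>) (range (\<lambda>u. r x u \<eta> + (\<integral>y. V y \<partial>P x u)))) \<and>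
       (AE x in \<eta>. V x + \<rho> = (\<integral>u. r x u \<eta> \<partial>v x) + (\<integral>u. (\<integral>y. V y \<partial>P x u) \<partial>v x)) \<and>
       \<eta> = \<eta>_inv P v \<and>
       (\<forall>f :: 'x \<Rightarrow> real. continuous_on UNIV f \<and> bounded (range f) \<longrightarrow>
          (\<integral>x. f x \<partial>\<eta>) = (\<integral>y. (\<integral>\<omega>. f (\<omega> 1) \<partial>stationary_law P v y) \<partial>\<eta>)))"
proof -
  obtain W B \<gamma> \<nu> where model: "controlled_drift_model P x0 K r p W C \<beta>1 \<beta>2 B \<gamma> \<nu> d_M"
    and o_eq: "small_o K W = small_o K \<V>"
    using controlled_drift_model_of_hypotheses[OF assms(1-11)] by (elim exE conjE)
  interpret controlled_drift_model P x0 K r p W C \<beta>1 \<beta>2 B \<gamma> \<nu> d_M by (rule model)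
  obtain v where v: "v \<in> SM" and opt: "\<And>w. w \<in> SM \<Longrightarrow> J v (\<eta>_inv P v) \<le> J w (\<eta>_inv P v)"
    using equilibrium_exists by blast
  let ?\<eta> = "\<eta>_inv P v"
  have "?\<eta> \<in> P_p p x0" by (rule eta_P_p[OF v])
  then obtain V \<rho> where acoe: "acoe_solution P r K \<V> x0 ?\<eta> V \<rho>"
    using assms(12) unfolding acoe_well_posed_def by blast
  then have "acoe_solution P r K W x0 ?\<eta> V \<rho>" by (simp add: acoe_solution_def o_eq)
  then have sel: "minimizing_selector P r ?\<eta> V \<rho> ?\<eta> v"
    using v opt by (intro optimal_control_is_minimizing_selector) auto
  have inv: "?\<eta> \<in> invariant_measures P" using v by (simp add: invariant_measures_def)
  have "?\<eta> \<in> \<A>_map P r K \<V> x0 ?\<eta>" unfolding \<A>_map_def using v acoe sel by blast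
  then have "mfg_solution P r K \<V> x0 ?\<eta>" using inv by (simp add: mfg_solution_def)
  moreover have "(\<integral>x. f x \<partial>?\<eta>) = (\<integral>y. (\<integral>\<omega>. f (\<omega> 1) \<partial>stationary_law P v y) \<partial>?\<eta>)"
    if "continuous_on UNIV f \<and> bounded (range f)" for f :: "'x \<Rightarrow> real"
    using eta_invariant_measure(1)[OF v] borel_measurable_continuous_onI[of f] that
    unfolding invariant_measure_def by blast
  ultimately show ?thesis
    using inv v acoe sel unfolding acoe_solution_def minimizing_selector_def by blast
qed

end
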